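(* Let $\gamma_1\ge10$, $\gamma_2\ge 8\sqrt{\gamma_1}+34$ and $\tau\ge1$ be constants. There exist an absolute constant $C>0$, a sufficiently small constant $c_0\in(0,1)$ depending on $\gamma_1$, and a sufficiently large constant $\beta$ depending only on $\gamma_1,\gamma_2$ and $\tau$, such that for all integers $n\ge1$, $1\le k\le p$ and all $\lambda>0$ satisfying $$\frac{\tau k}{n}\log\frac{\mathrm{e}p}{k}\le c_0\qquad\text{and}\qquad \lambda\ge\beta\sqrt{\frac kn\log\frac{\mathrm{e}p}{k}},$$ the rank estimator $\hat r=\hat r(\gamma_1,\gamma_2)$ satisfies $$\sup_{\Sigma\in\Theta_2(k,p,\lambda,\tau)}\mathsf{P}\{\hat r\neq\mathrm{rank}(\Lambda)\}\le C\,p^{1-\gamma_1/2}.$$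
   Context: $\|\cdot\|$ denotes the spectral norm, $'$ denotes transpose, $[p]=\{1,\dots,p\}$, and $O(p,r)=\{V\in\mathbb{R}^{p\times r}:V'V=I_r\}$. For a $p\times r$ matrix $V$, $\mathrm{supp}(V)\subset[p]$ is the set of indices of its nonzero rows. $\sigma_l(\cdot)$ is the $l$-th largest singular value. Parameter spaces: $\Theta_0(k,p,r,\lambda,\tau)=\{\Sigma=V\Lambda V'+I_p:\ \Lambda=\mathrm{diag}(\lambda_1,\dots,\lambda_r),\ \lambda/\tau\le\lambda_r\le\cdots\le\lambda_1\le\lambda,\ V\in O(p,r),\ |\mathrm{supp}(V)|\le k\}$ (for $r=0$ this is $\{I_p\}$, with $\mathrm{rank}(\Lambda)=0$), and $\Theta_2(k,p,\lambda,\tau)=\bigcup_{r=0}^k\Theta_0(k,p,r,\lambda,\tau)$. Thus $\mathrm{rank}(\Lambda)=\mathrm{rank}(\Sigma-I_p)$. Data: an $n\times p$ random matrix $X$ whose rows are i.i.d. $N(0,\Sigma)$; $\mathsf{P}$ is the probability under $\Sigma$. The sample covariance matrix is $S=\frac1n X'X$. For $I,J\subset[p]$, $S_{IJ}$ is the submatrix with rows in $I$ and columns in $J$. For $B\subset[p]$ with complement $B^{c}$, $S_B$ denotes the $p\times p$ matrix with $(S_B)_{ij}=s_{ij}\mathbf 1\{i\in B,j\in B\}+\mathbf 1\{i=j\in B^{c}\}$. Define $$\eta(m,n,p,\gamma_1)=2\Big(\sqrt{\tfrac mn}+\sqrt{\tfrac{\gamma_1}{n}m\log\tfrac{\mathrm{e}p}{m}}\Big)+\Big(\sqrt{\tfrac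 mn}+\sqrt{\tfrac{\gamma_1}{n}m\log\tfrac{\mathrm{e}p}{m}}\Big)^2$$ (with value $0$ at $m=0$), and let $\mathbb{B}_k$ be the collection of all $B\subset[p]$ with $|B|=k$ such that for all $D\subset B^{c}$ with $|D|\le k$: $\|S_D-I_p\|\le\eta(|D|,n,p,\gamma_1)$ and $\|S_{DB}\|\le 2\sqrt{\|S_B\|}\,\eta(k,n,p,\gamma_1)$ (conditions for $D=\emptyset$ hold trivially). If $\mathbb{B}_k\ne\emptyset$, let $\widehat A$ be an arbitrary element of $\mathbb{B}_k$ (e.g. a maximizer of $\mathrm{Tr}(S_{BB})$ over $B\in\mathbb{B}_k$). Rank estimator: if $\mathbb{B}_k\neq\emptyset$, $$\hat r=\max\Big\{l:\ \sigma_l(S_{\widehat A\widehat A})\ge 1+\gamma_2\sqrt{\|S_{\widehat A}\|}\,\eta(k,n,p,\gamma_1)\Big\}$$ (with $\max\emptyset=0$); if $\mathbb{B}_k=\emptyset$, $\hat r=0$. *)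

theory Defs
  imports
    "HOL-Probability.Probability"
    "Jordan_Normal_Form.Char_Poly"
    "Jordan_Normal_Form.DL_Rank"
    "Jordan_Normal_Form.DL_Submatrix"
begin

text \<open>
  The dimensions are quantified variables of the result, so matrices are taken from
  Jordan Normal Form (dimensions in the carrier). Indices start at 0: the set
  of coordinates is \<open>{..<p}\<close> instead of \<open>{1..p}\<close>.
\<close>

definition vnorm :: "real Matrix.vec \<Rightarrow> real" where
  "vnorm v = sqrt (scalar_prod v v)"

text \<open>
  The supremum is over the closed unit ball, not the unit sphere, so that it is over a nonempty
  set (and gives 0) also when the matrix has no columns.
\<close>

definition spectral_norm :: "real Matrix.mat \<Rightarrow> real" where
  "spectral_norm A = (SUP v\<in>{v \<in> carrier_vec (dim_col A). vnorm v \<le> 1}. vnorm (mult_mat_vec A v))"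

text \<open>
  Singular values in decreasing order, with multiplicity: \<open>proots\<close> is the multiset of
  roots of a polynomial. \<open>sing_val\<close> counts from 1 and is only meant for
  \<open>1 \<le> l \<le> dim_col A\<close>.
\<close>

definition sing_vals :: "real Matrix.mat \<Rightarrow> real list" where
  "sing_vals A = rev (map sqrt (sorted_list_of_multiset (proots (char_poly (transpose_mat A * A)))))"

definition sing_val :: "nat \<Rightarrow> real Matrix.mat \<Rightarrow> real" where
  "sing_val l A = sing_vals A ! (l - 1)"

definition orthonormal_mats :: "nat \<Rightarrow> nat \<Rightarrow> real Matrix.mat set" where
  "orthonormal_mats p r = {V \<in> carrier_mat p r. transpose_mat V * V = 1\<^sub>m r}"

definition row_supp :: "real Matrix.mat \<Rightarrow> nat set" where
  "row_supp V = {i. i < dim_row V \<and> Matrix.row V i \<noteq> 0\<^sub>v (dim_col V)}"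

text \<open>
  \<open>\<Lambda>\<close> is the diagonal matrix with entries \<open>ls 0 \<ge> \<dots> \<ge> ls (r - 1)\<close>. For
  \<open>r = 0\<close> the product \<open>V \<Lambda> V'\<close> is the zero matrix and the set is \<open>{1\<^sub>m p}\<close>.
\<close>

definition Theta0 :: "nat \<Rightarrow> nat \<Rightarrow> nat \<Rightarrow> real \<Rightarrow> real \<Rightarrow> real Matrix.mat set" where
  "Theta0 k p r lam \<tau> =
     {V * mat_diag r ls * transpose_mat V + 1\<^sub>m p | V ls.
        V \<in> orthonormal_mats p r \<and> card (row_supp V) \<le> k \<and>
        (\<forall>i<r. lam / \<tau> \<le> ls i \<and> ls i \<le> lam) \<and>
        (\<forall>i<r. \<forall>j<r. i \<le> j \<longrightarrow> ls j \<le> ls i)}"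

definition Theta2 :: "nat \<Rightarrow> nat \<Rightarrow> real \<Rightarrow> real \<Rightarrow> real Matrix.mat set" where
  "Theta2 k p lam \<tau> = (\<Union>r\<in>{0..k}. Theta0 k p r lam \<tau>)"

text \<open>
  The square root is the positive semidefinite one, which exists and is unique for every
  positive semidefinite matrix.
\<close>

definition psd_sqrt :: "nat \<Rightarrow> real Matrix.mat \<Rightarrow> real Matrix.mat" where
  "psd_sqrt p Sig = (SOME R. R \<in> carrier_mat p p \<and> transpose_mat R = R \<and>
     (\<forall>v\<in>carrier_vec p. scalar_prod v (mult_mat_vec R v) \<ge> 0) \<and> R * R = Sig)"

text \<open>
  \<open>N(0, \<Sigma>)\<close> is the law of \<open>\<Sigma>\<^sup>1\<^sup>/\<^sup>2 Z\<close>, where \<open>Z\<close> has independent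
  standard normal coordinates.
\<close>

definition mvn :: "nat \<Rightarrow> real Matrix.mat \<Rightarrow> (nat \<Rightarrow> real) measure" where
  "mvn p Sig = distr
     (\<Pi>\<^sub>M i\<in>{..<p}. density lborel (\<lambda>x. ennreal (std_normal_density x)))
     (\<Pi>\<^sub>M i\<in>{..<p}. borel)
     (\<lambda>z. \<lambda>i\<in>{..<p}. \<Sum>j<p. psd_sqrt p Sig $$ (i, j) * z j)"

text \<open>
  A data set is a function \<open>x\<close> with \<open>x i j\<close> the entry in row \<open>i\<close> and column \<open>j\<close>.
\<close>

definition data_space :: "nat \<Rightarrow> nat \<Rightarrow> (nat \<Rightarrow> nat \<Rightarrow> real) measure" where
  "data_space n p = (\<Pi>\<^sub>M i\<in>{..<n}. \<Pi>\<^sub>M j\<in>{..<p}. borel)"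

definition data_law :: "nat \<Rightarrow> nat \<Rightarrow> real Matrix.mat \<Rightarrow> (nat \<Rightarrow> nat \<Rightarrow> real) measure" where
  "data_law n p Sig = (\<Pi>\<^sub>M i\<in>{..<n}. mvn p Sig)"

definition data_mat :: "nat \<Rightarrow> nat \<Rightarrow> (nat \<Rightarrow> nat \<Rightarrow> real) \<Rightarrow> real Matrix.mat" where
  "data_mat n p x = Matrix.mat n p (\<lambda>(i, j). x i j)"

definition sample_cov :: "nat \<Rightarrow> nat \<Rightarrow> (nat \<Rightarrow> nat \<Rightarrow> real) \<Rightarrow> real Matrix.mat" where
  "sample_cov n p x = (1 / real n) \<cdot>\<^sub>m (transpose_mat (data_mat n p x) * data_mat n p x)"

text \<open>
  \<open>pad_id p S B\<close> is the \<open>p \<times> p\<close> matrix \<open>S\<^sub>B\<close> (identity outside \<open>B\<close>); the genuine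
  submatrix \<open>S\<^sub>I\<^sub>J\<close> is \<open>submatrix S I J\<close>.
\<close>

definition pad_id :: "nat \<Rightarrow> real Matrix.mat \<Rightarrow> nat set \<Rightarrow> real Matrix.mat" where
  "pad_id p S B = Matrix.mat p p (\<lambda>(i, j).
     (if i \<in> B \<and> j \<in> B then S $$ (i, j) else 0) + (if i = j \<and> i \<notin> B then 1 else 0))"

definition eta_root :: "nat \<Rightarrow> nat \<Rightarrow> nat \<Rightarrow> real \<Rightarrow> real" where
  "eta_root m n p \<gamma>1 =
     sqrt (real m / real n) + sqrt (\<gamma>1 / real n * real m * ln (exp 1 * real p / real m))"

definition eta :: "nat \<Rightarrow> nat \<Rightarrow> nat \<Rightarrow> real \<Rightarrow> real" where
  "eta m n p \<gamma>1 = (if m = 0 then 0 else 2 * eta_root m n p \<gamma>1 + (eta_root m n p \<gamma>1)\<^sup>2)"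

definition BB :: "nat \<Rightarrow> nat \<Rightarrow> nat \<Rightarrow> real \<Rightarrow> real Matrix.mat \<Rightarrow> nat set set" where
  "BB k n p \<gamma>1 S = {B. B \<subseteq> {..<p} \<and> card B = k \<and>
     (\<forall>D. D \<subseteq> {..<p} - B \<and> card D \<le> k \<longrightarrow>
        spectral_norm (pad_id p S D - 1\<^sub>m p) \<le> eta (card D) n p \<gamma>1 \<and>
        spectral_norm (submatrix S D B) \<le> 2 * sqrt (spectral_norm (pad_id p S B)) * eta k n p \<gamma>1)}"

text \<open>
  The choice of the estimated support is a statistic, i.e. a measurable function of the data;
  its value is unconstrained where \<open>BB\<close> is empty.
\<close>

definition support_selector ::
    "nat \<Rightarrow> nat \<Rightarrow> nat \<Rightarrow> real \<Rightarrow> ((nat \<Rightarrow> nat \<Rightarrow> real) \<Rightarrow> nat set) \<Rightarrow> bool" where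
  "support_selector k n p \<gamma>1 A \<longleftrightarrow>
     A \<in> measurable (data_space n p) (count_space UNIV) \<and>
     (\<forall>x\<in>space (data_space n p).
        BB k n p \<gamma>1 (sample_cov n p x) \<noteq> {} \<longrightarrow> A x \<in> BB k n p \<gamma>1 (sample_cov n p x))"

text \<open>
  The element 0 is inserted because the maximum of the empty set is 0 by convention. Members of
  \<open>BB\<close> have \<open>k\<close> elements, so \<open>{1..k}\<close> indexes all singular values of the submatrix.
\<close>

definition rank_estimate ::
    "nat \<Rightarrow> nat \<Rightarrow> nat \<Rightarrow> real \<Rightarrow> real \<Rightarrow> real Matrix.mat \<Rightarrow> nat set \<Rightarrow> nat" where
  "rank_estimate k n p \<gamma>1 \<gamma>2 S A =
     (if BB k n p \<gamma>1 S \<noteq> {}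
      then Max (insert 0 {l \<in> {1..k}. sing_val l (submatrix S A A)
                 \<ge> 1 + \<gamma>2 * sqrt (spectral_norm (pad_id p S A)) * eta k n p \<gamma>1})
      else 0)"

end

theory Submission
  imports Defs
begin

text \<open>
  Everything happens on one event: the Gram matrix of any \<open>m \<le> 2 k\<close> columns of the standard
  Gaussian data \<open>Z = X \<Sigma> ^ (- 1/2)\<close> is within \<open>2 * eta_root m\<close> of the identity. For
  one unit vector this is a chi-square tail; a lattice net and a union bound over the column sets
  give all of them. The sharp constant in \<open>eta\<close> survives the crude net because, for deviations as small
  as the assumption on \<open>c0\<close> makes them, the chi-square exponent is twice the one
  that Gaussian concentration of the largest singular value would give.

  On this event the true support (padded to \<open>k\<close> elements) belongs to \<open>BB\<close>, so some \<open>B\<close> in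
  \<open>BB\<close> is selected. Vectors supported on \<open>B\<close> and orthogonal to the spike see only noise, which bounds the
  singular values after the \<open>r\<close>-th. Coordinates of the support outside \<open>B\<close> carry little of the
  spike because \<open>S\<close> is close to the identity there, so the rows in \<open>B\<close> retain an \<open>r\<close>-dimensional
  space on which \<open>S\<close> is of size at least \<open>lam / \<tau>\<close>.
\<close>

no_notation Finite_Cartesian_Product.vec_nth (infixl \<open>$\<close> 90)
unbundle no fps_syntax
no_notation inner (infix \<open>\<bullet>\<close> 70)

section \<open>The real spectral theorem and singular values\<close>

text \<open>The obstacle is that \<open>BB\<close> compares with \<open>eta\<close> itself and not
  with a constant multiple of it, so the covering argument must not lose a constant when the true
  support is shown to belong to \<open>BB\<close>. Passing from a net of radius 1/10 to all vectors
  costs the factor 5/4, so net points are tested at \<open>8 / 5 * eta_root\<close>. With R the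
  square root of the covariance and J the padded true support, R fixes every vector orthogonal to
  the columns of V. Hence it moves vectors supported on B only inside the union of J and B, which is
  why column sets of size up to 2 k enter. From k to 2 k \<open>eta_root\<close> grows by at most
  sqrt 2, whence the recurring 3/2 of \<open>eta k\<close>. \<open>psd_sqrt\<close> is a choice, so
  R is known only through symmetry, positivity and its square; facts about it are derived from
  these. The two singular value bounds are the two halves of the Courant-Fischer principle. Each
  asks only for a subspace of the right dimension with control of the quadratic form, so no
  perturbation theory of eigenvectors occurs, and any B in \<open>BB\<close> can be treated
  alike.\<close>

lemma underdetermined_nonzero:
  fixes W :: "'a :: field Matrix.vec set"
  assumes W: "finite W" "W \<subseteq> carrier_vec m" "card W < m"
  shows "\<exists>x\<in>carrier_vec m. x \<noteq> 0\<^sub>v m \<and> (\<forall>w\<in>W. w \<bullet> x = 0)"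
proof -
  obtain ws where ws: "set ws = W" "distinct ws"
    using finite_distinct_list[OF W(1)] by blast
  have len: "length ws < m" using ws W(3) distinct_card by fastforce
  \<comment> \<open>Padding with zero rows makes the system square. At least the last row is zero,
    so the determinant vanishes.\<close>
  define A where "A = Matrix.mat m m (\<lambda>(i, j). if i < length ws then ws ! i $ j else 0)"
  have A: "A \<in> carrier_mat m m" by (simp add: A_def)
  have "A\<^sup>T *\<^sub>v unit_vec m (m - 1) = 0\<^sub>v m"
    using len by (intro eq_vecI) (auto simp: A_def scalar_prod_right_unit)
  moreover have "unit_vec m (m - 1) \<noteq> (0\<^sub>v m :: 'a Matrix.vec)"
    using len by (intro unit_vec_nonzero) simp
  ultimately have "Determinant.det A\<^sup>T = 0"
    using det_0_iff_vec_prod_zero_field[of "A\<^sup>T" m] A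
    by (metis transpose_carrier_mat unit_vec_carrier)
  then have "Determinant.det A = 0" using det_transpose[OF A] by simp
  then obtain x where x: "x \<in> carrier_vec m" "x \<noteq> 0\<^sub>v m" "A *\<^sub>v x = 0\<^sub>v m"
    using det_0_iff_vec_prod_zero_field[OF A] by blast
  have "w \<bullet> x = 0" if w: "w \<in> W" for w
  proof -
    obtain i where i: "i < length ws" "ws ! i = w" using w ws by (metis in_set_conv_nth)
    have "Matrix.row A i = w"
      using i len w W(2) by (intro eq_vecI) (auto simp: A_def)
    moreover have "(A *\<^sub>v x) $ i = 0" using x(3) i len by simp
    ultimately show ?thesis using i len A by simp
  qed
  then show ?thesis using x by blast
qed

lemma scalar_prod_mult_mat_vec:
  fixes A :: "'a :: comm_semiring_0 mat"
  assumes "A \<in> carrier_mat m n" "u \<in> carrier_vec m" "v \<in> carrier_vec n"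
  shows "u \<bullet> (A *\<^sub>v v) = (A\<^sup>T *\<^sub>v u) \<bullet> v"
  using assms by (metis transpose_vec_mult_scalar transpose_carrier_mat transpose_transpose
      comm_scalar_prod mult_mat_vec_carrier)

text \<open>Over the complex numbers the characteristic polynomial splits, so an eigenvalue exists;
  symmetry makes it equal to its conjugate, so it is already a root of the real polynomial.\<close>

lemma real_symmetric_eigenvalue:
  fixes A :: "real mat"
  assumes A: "A \<in> carrier_mat n n" "A\<^sup>T = A" and n: "n > 0"
  shows "\<exists>e. eigenvalue A e"
proof -
  define C where "C = map_mat complex_of_real A"
  have C: "C \<in> carrier_mat n n" using A by (simp add: C_def)
  have CT: "C\<^sup>T = C" using A by (metis C_def map_mat_transpose)
  obtain zs where zs: "char_poly C = (\<Prod>a\<leftarrow>zs. [:- a, 1:])" "length zs = n"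
    using char_poly_factorized[OF C] by blast
  then obtain z where "z \<in> set zs" using n by (metis length_greater_0_conv list.set_sel(1))
  then have "poly (char_poly C) z = 0" unfolding zs by (force simp: poly_prod_list prod_list_zero_iff)
  then have "eigenvalue C z" using eigenvalue_root_char_poly[OF C] by simp
  then obtain v where v: "v \<in> carrier_vec n" "v \<noteq> 0\<^sub>v n" "C *\<^sub>v v = z \<cdot>\<^sub>v v"
    using C unfolding eigenvalue_def eigenvector_def by auto
  have conjC: "C *\<^sub>v conjugate v = conjugate (C *\<^sub>v v)"
  proof (rule eq_vecI)
    fix i assume "i < dim_vec (conjugate (C *\<^sub>v v))"
    then have i: "i < n" using C by simp
    show "(C *\<^sub>v conjugate v) $ i = conjugate (C *\<^sub>v v) $ i"
      using i C v(1) A(1) by (simp add: scalar_prod_def C_def)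
  qed (use C in simp)
  have "z * (v \<bullet> conjugate v) = (C *\<^sub>v v) \<bullet> conjugate v"
    using v by simp
  also have "\<dots> = v \<bullet> (C *\<^sub>v conjugate v)"
    using scalar_prod_mult_mat_vec[of C n n v "conjugate v"] C CT v by simp
  also have "\<dots> = cnj z * (v \<bullet> conjugate v)"
    unfolding conjC v(3) using v(1) by (simp add: conjugate_smult_vec)
  finally have "z = cnj z" using v by (simp add: conjugate_square_eq_0_vec)
  then obtain e where e: "z = complex_of_real e" by (metis Reals_cnj_iff Reals_cases)
  have "char_poly C = map_poly complex_of_real (char_poly A)"
    unfolding C_def using of_real_hom.char_poly_hom[OF A(1)] by simp
  then have "poly (char_poly A) e = 0"
    using \<open>poly (char_poly C) z = 0\<close> e by (simp add: of_real_hom.poly_map_poly)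
  then show ?thesis using eigenvalue_root_char_poly[OF A(1)] by blast
qed

text \<open>The Householder reflection along \<open>q - unit_vec n 0\<close>, which is undefined
  exactly when q is that unit vector. It serves to move an eigenvector to the first coordinate
  axis.\<close>

lemma reflection_exists:
  fixes q :: "real Matrix.vec"
  assumes q: "q \<in> carrier_vec n" "q \<bullet> q = 1" and n: "n > 0"
  shows "\<exists>H. H \<in> carrier_mat n n \<and> H\<^sup>T = H \<and> H * H = 1\<^sub>m n \<and> H *\<^sub>v unit_vec n 0 = q"
proof (cases "q = unit_vec n 0")
  case True
  then show ?thesis by (intro exI[of _ "1\<^sub>m n"]) auto
next
  case False
  define w where "w = q - unit_vec n 0"
  have w: "w \<in> carrier_vec n" using q by (simp add: w_def)
  have w0: "w \<noteq> 0\<^sub>v n"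
  proof
    assume "w = 0\<^sub>v n"
    then have "q $ i = unit_vec n 0 $ i" if "i < n" for i
      using that q(1) unfolding w_def by (metis carrier_vecD eq_iff_diff_eq_0 index_minus_vec(1) index_unit_vec(3) index_zero_vec(1))
    then show False using False q by (auto intro: eq_vecI)
  qed
  have ww: "w \<bullet> w = 2 - 2 * q $ 0"
    using q n unfolding w_def
    by (simp add: minus_scalar_prod_distrib[of _ n] scalar_prod_minus_distrib[of _ n] algebra_simps)
  have ww0: "w \<bullet> w > 0" using w w0 conjugate_square_greater_0_vec[of w n] by simp
  define c where "c = 2 / (w \<bullet> w)"
  have cw: "c * (w \<bullet> w) = 2" using ww0 by (simp add: c_def)
  define H where "H = Matrix.mat n n (\<lambda>(i, j). (if i = j then 1 else 0) - c * w $ i * w $ j)"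
  have H: "H \<in> carrier_mat n n" by (simp add: H_def)
  have "H\<^sup>T = H" by (rule eq_matI) (auto simp: H_def)
  moreover have "H * H = 1\<^sub>m n"
  proof (rule eq_matI)
    fix i j assume "i < dim_row (1\<^sub>m n :: real mat)" "j < dim_col (1\<^sub>m n :: real mat)"
    then have ij: "i < n" "j < n" by auto
    have "(H * H) $$ (i, j) = (\<Sum>k<n. ((if i = k then 1 else 0) - c * w $ i * w $ k)
        * ((if k = j then 1 else 0) - c * w $ k * w $ j))"
      using ij by (simp add: H_def scalar_prod_def lessThan_atLeast0)
    also have "\<dots> = (\<Sum>k<n. (if i = k then (if k = j then 1 else 0) else 0)
        - (if i = k then c * w $ k * w $ j else 0) - (if k = j then c * w $ i * w $ k else 0)
        + c * w $ i * w $ j * c * (w $ k * w $ k))"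
      by (intro sum.cong) (auto simp: algebra_simps)
    also have "\<dots> = (if i = j then 1 else 0) - c * w $ i * w $ j - c * w $ i * w $ j
        + c * w $ i * w $ j * c * (\<Sum>k<n. w $ k * w $ k)"
      using ij by (simp add: sum.distrib sum_subtractf sum_distrib_left)
    also have "(\<Sum>k<n. w $ k * w $ k) = w \<bullet> w"
      using w by (simp add: scalar_prod_def lessThan_atLeast0)
    also have "(if i = j then 1 else 0) - c * w $ i * w $ j - c * w $ i * w $ j
        + c * w $ i * w $ j * c * (w \<bullet> w) = (if i = j then 1 else 0)"
      using cw by (simp add: algebra_simps)
    finally show "(H * H) $$ (i, j) = 1\<^sub>m n $$ (i, j)" using ij by simp
  qed (auto simp: H_def)
  moreover have "H *\<^sub>v unit_vec n 0 = q"
  proof (rule eq_vecI)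
    fix i assume "i < dim_vec q"
    then have i: "i < n" using q by simp
    have "c * w $ 0 = - 1" 
    proof -
      have w0: "w $ 0 = q $ 0 - 1" using q n by (simp add: w_def)
      have "c * (2 - 2 * q $ 0) = 2" using cw ww by simp
      then show ?thesis unfolding w0 by (simp add: algebra_simps)
    qed
    then have "c * w $ i * w $ 0 = - w $ i" by (metis mult.commute mult.assoc mult_minus1)
    then show "(H *\<^sub>v unit_vec n 0) $ i = q $ i"
      using i n q by (simp add: H_def) (simp add: w_def)
  qed (use H q in simp)
  ultimately show ?thesis using H by blast
qed

text \<open>Deflation. Conjugating by the reflection that exchanges a unit eigenvector with the
  first axis clears the first column; symmetry clears the first row, and the remaining block is a
  smaller symmetric matrix.\<close>

theorem real_spectral:
  fixes A :: "real mat"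
  assumes "A \<in> carrier_mat n n" "A\<^sup>T = A"
  shows "\<exists>Q d. Q \<in> carrier_mat n n \<and> Q\<^sup>T * Q = 1\<^sub>m n \<and> Q * Q\<^sup>T = 1\<^sub>m n \<and> A = Q * mat_diag n d * Q\<^sup>T"
  using assms
proof (induction n arbitrary: A)
  case 0
  then show ?case by (intro exI[of _ "1\<^sub>m 0"] exI[of _ "\<lambda>_. 0"]) auto
next
  case (Suc m)
  let ?n = "Suc m"
  obtain e where "eigenvalue A e" using real_symmetric_eigenvalue[OF Suc.prems] by auto
  then obtain v where v: "v \<in> carrier_vec ?n" "v \<noteq> 0\<^sub>v ?n" "A *\<^sub>v v = e \<cdot>\<^sub>v v"
    using Suc.prems unfolding eigenvalue_def eigenvector_def by auto
  have vv: "v \<bullet> v > 0" using v conjugate_square_greater_0_vec[of v ?n] by simp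
  define q where "q = (1 / sqrt (v \<bullet> v)) \<cdot>\<^sub>v v"
  have q: "q \<in> carrier_vec ?n" "q \<bullet> q = 1" "A *\<^sub>v q = e \<cdot>\<^sub>v q"
    using v vv Suc.prems by (auto simp: q_def mult_mat_vec smult_smult_assoc mult.commute)
  obtain H where H: "H \<in> carrier_mat ?n ?n" "H\<^sup>T = H" "H * H = 1\<^sub>m ?n" "H *\<^sub>v unit_vec ?n 0 = q"
    using reflection_exists[OF q(1,2)] by auto
  have Hq: "H *\<^sub>v q = unit_vec ?n 0"
    using H assoc_mult_mat_vec[of H ?n ?n H ?n "unit_vec ?n 0"] by simp
  define B where "B = H * A * H"
  have B: "B \<in> carrier_mat ?n ?n" using H Suc.prems by (simp add: B_def)
  have BT: "B\<^sup>T = B"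
  proof -
    have "B\<^sup>T = H\<^sup>T * (H * A)\<^sup>T" unfolding B_def
      using H(1) Suc.prems(1) by (intro transpose_mult) auto
    also have "(H * A)\<^sup>T = A\<^sup>T * H\<^sup>T" using H(1) Suc.prems(1) by (intro transpose_mult) auto
    finally show ?thesis using H Suc.prems by (simp add: B_def)
  qed
  have "B *\<^sub>v unit_vec ?n 0 = e \<cdot>\<^sub>v unit_vec ?n 0"
    using H Suc.prems q Hq by (simp add: B_def assoc_mult_mat_vec[of _ ?n ?n _ ?n] mult_mat_vec)
  then have "B $$ (i, 0) = (if i = 0 then e else 0)" if "i < ?n" for i
    using that B by (metis (no_types, lifting) carrier_matD(1) carrier_matD(2) index_mult_mat_vec index_row(1) index_smult_vec(1) index_unit_vec(1) index_unit_vec(3) mult.right_neutral mult_zero_right row_carrier scalar_prod_right_unit zero_less_Suc)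
  then have col0: "B $$ (i, 0) = (if i = 0 then e else 0)" "B $$ (0, i) = (if i = 0 then e else 0)"
    if "i < ?n" for i
    using that B BT by (metis, metis carrier_matD index_transpose_mat(1) zero_less_Suc)
  define A1 where "A1 = Matrix.mat m m (\<lambda>(i, j). B $$ (Suc i, Suc j))"
  define E where "E = Matrix.mat 1 1 (\<lambda>_. e)"
  have A1: "A1 \<in> carrier_mat m m" by (simp add: A1_def)
  have "A1\<^sup>T = A1"
    using B BT by (intro eq_matI) (auto simp: A1_def, metis Suc_less_eq carrier_matD index_transpose_mat(1))
  from Suc.IH[OF A1 this] obtain Q1 d1 where Q1: "Q1 \<in> carrier_mat m m" "Q1\<^sup>T * Q1 = 1\<^sub>m m"
    "Q1 * Q1\<^sup>T = 1\<^sub>m m" "A1 = Q1 * mat_diag m d1 * Q1\<^sup>T" by blast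
  have Beq: "B = four_block_mat E (0\<^sub>m 1 m) (0\<^sub>m m 1) A1"
    using B col0 by (intro eq_matI) (auto simp: E_def A1_def)
  define P where "P = four_block_mat (1\<^sub>m 1) (0\<^sub>m 1 m) (0\<^sub>m m 1) Q1"
  define d where "d i = (case i of 0 \<Rightarrow> e | Suc j \<Rightarrow> d1 j)" for i
  have P: "P \<in> carrier_mat ?n ?n"
    using four_block_carrier_mat[of "1\<^sub>m 1" 1 1 Q1 m m] Q1 by (simp add: P_def)
  have PT: "P\<^sup>T = four_block_mat (1\<^sub>m 1) (0\<^sub>m 1 m) (0\<^sub>m m 1) Q1\<^sup>T"
    using Q1 by (simp add: P_def transpose_four_block_mat[of _ 1 1 _ m _ m])
  have D: "mat_diag ?n d = four_block_mat E (0\<^sub>m 1 m) (0\<^sub>m m 1) (mat_diag m d1)"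
    by (intro eq_matI) (auto simp: mat_diag_def E_def d_def split: nat.split)
  have one: "four_block_mat (1\<^sub>m 1) (0\<^sub>m 1 m) (0\<^sub>m m 1) (1\<^sub>m m) = (1\<^sub>m ?n :: real mat)"
    by simp
  have E: "E \<in> carrier_mat 1 1" by (simp add: E_def)
  have PP: "P\<^sup>T * P = 1\<^sub>m ?n" "P * P\<^sup>T = 1\<^sub>m ?n"
    unfolding PT unfolding P_def using Q1 one
    by (simp_all add: mult_four_block_mat[of _ 1 1 _ m _ m _ _ 1 _ m] del: four_block_one_mat)
  have QDQ: "Q1 * mat_diag m d1 * Q1\<^sup>T \<in> carrier_mat m m"
    using A1 Q1(4) by simp
  have PDP: "P * mat_diag ?n d * P\<^sup>T = B"
    unfolding PT unfolding P_def D Beq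
    using Q1 E left_mult_zero_mat[of "mat_diag m d1" m m "Suc 0"]
      right_mult_zero_mat[of "Q1 * mat_diag m d1" m m "Suc 0"]
      left_add_zero_mat[OF QDQ]
    by (simp add: mult_four_block_mat[of _ 1 1 _ m _ m _ _ 1 _ m])
  define Q where "Q = H * P"
  have Q: "Q \<in> carrier_mat ?n ?n" using H P by (simp add: Q_def)
  have QT: "Q\<^sup>T = P\<^sup>T * H" using H P by (simp add: Q_def transpose_mult[of _ ?n ?n])
  have "Q\<^sup>T * Q = (P\<^sup>T * H) * (H * P)" unfolding QT[symmetric] Q_def[symmetric] ..
  also have "\<dots> = P\<^sup>T * ((H * H) * P)" using H(1) P
    by (simp add: assoc_mult_mat[of _ ?n ?n _ ?n _ ?n] mult_carrier_mat[of _ ?n ?n _ ?n])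
  finally have "Q\<^sup>T * Q = P\<^sup>T * ((H * H) * P)" .
  then have QQ: "Q\<^sup>T * Q = 1\<^sub>m ?n" using H P PP by simp
  then have "Q * Q\<^sup>T = 1\<^sub>m ?n" using Q by (metis mat_mult_left_right_inverse transpose_carrier_mat)
  moreover have "Q * mat_diag ?n d * Q\<^sup>T = H * B * H" unfolding QT PDP[symmetric] unfolding Q_def
    using H(1) P by (simp add: assoc_mult_mat[of _ ?n ?n _ ?n _ ?n] mult_carrier_mat[of _ ?n ?n _ ?n])
  moreover have "H * B * H = (H * H) * A * (H * H)" unfolding B_def using H(1) Suc.prems
    by (simp add: assoc_mult_mat[of _ ?n ?n _ ?n _ ?n] mult_carrier_mat[of _ ?n ?n _ ?n])
  ultimately show ?case using H Q QQ Suc.prems by (intro exI[of _ Q] exI[of _ d]) simp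
qed

lemma proots_char_poly_orthogonal_diag:
  fixes Q :: "real mat"
  assumes Q: "Q \<in> carrier_mat n n" "Q\<^sup>T * Q = 1\<^sub>m n" "Q * Q\<^sup>T = 1\<^sub>m n"
  shows "proots (char_poly (Q * mat_diag n d * Q\<^sup>T)) = mset (map d [0..<n])"
proof -
  have "similar_mat (Q * mat_diag n d * Q\<^sup>T) (mat_diag n d)"
    using Q by (intro similar_matI[of _ _ Q "Q\<^sup>T" n]) (auto simp: mult_carrier_mat[of _ n n _ n])
  then have "char_poly (Q * mat_diag n d * Q\<^sup>T) = char_poly (mat_diag n d)"
    by (rule char_poly_similar)
  also have "\<dots> = (\<Prod>a\<leftarrow>diag_mat (mat_diag n d). [:- a, 1:])"
    by (rule char_poly_upper_triangular[of _ n]) (auto simp: mat_diag_def)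
  also have "diag_mat (mat_diag n d) = map d [0..<n]"
    by (auto simp: diag_mat_def mat_diag_def)
  finally have *: "char_poly (Q * mat_diag n d * Q\<^sup>T) = (\<Prod>a\<leftarrow>map d [0..<n]. [:- a, 1:])" .
  have "proots (\<Prod>a\<leftarrow>xs. [:- a, 1:]) = mset xs" for xs :: "real list"
  proof (induction xs)
    case (Cons x xs)
    have "proots [:- x, 1:] = {#x#}" using proots_linear_factor[of x] by simp
    moreover have "(\<Prod>a\<leftarrow>xs. [:- a, 1:]) \<noteq> 0" by (auto simp: prod_list_zero_iff)
    ultimately have "proots ([:- x, 1:] * (\<Prod>a\<leftarrow>xs. [:- a, 1:])) = {#x#} + mset xs"
      using Cons by (subst proots_mult) auto
    then show ?case by (simp only: list.map prod_list.Cons mset.simps(2) union_mset_add_mset_left empty_neutral)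
  qed simp
  then show ?thesis unfolding * .
qed

lemma scalar_prod_mat_diag:
  fixes y :: "real Matrix.vec"
  assumes "y \<in> carrier_vec n"
  shows "y \<bullet> (mat_diag n d *\<^sub>v y) = (\<Sum>i<n. d i * (y $ i)\<^sup>2)"
proof -
  have "(mat_diag n d *\<^sub>v y) $ i = d i * y $ i" if i: "i < n" for i
  proof -
    have "(mat_diag n d *\<^sub>v y) $ i = (\<Sum>j<n. (if i = j then d j else 0) * y $ j)"
      using i assms by (simp add: mat_diag_def scalar_prod_def lessThan_atLeast0)
    also have "\<dots> = (\<Sum>j<n. if i = j then d j * y $ j else 0)" by (intro sum.cong) auto
    finally show ?thesis using i by simp
  qed
  then show ?thesis using assms
    by (auto simp: scalar_prod_def[of y] lessThan_atLeast0 power2_eq_square mat_diag_def intro!: sum.cong)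
qed

lemma quadratic_form_diag:
  fixes Q :: "real mat"
  assumes Q: "Q \<in> carrier_mat n n" "Q * Q\<^sup>T = 1\<^sub>m n" and v: "v \<in> carrier_vec n"
  shows "v \<bullet> (Q * mat_diag n d * Q\<^sup>T *\<^sub>v v) = (\<Sum>i<n. d i * ((Q\<^sup>T *\<^sub>v v) $ i)\<^sup>2)"
    and "v \<bullet> v = (\<Sum>i<n. ((Q\<^sup>T *\<^sub>v v) $ i)\<^sup>2)"
proof -
  let ?y = "Q\<^sup>T *\<^sub>v v"
  have y: "?y \<in> carrier_vec n" using Q v by simp
  have eq: "v \<bullet> (Q * mat_diag n d * Q\<^sup>T *\<^sub>v v) = (\<Sum>i<n. d i * (?y $ i)\<^sup>2)" for d
  proof -
    have "Q * mat_diag n d * Q\<^sup>T *\<^sub>v v = Q *\<^sub>v (mat_diag n d *\<^sub>v ?y)"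
      using Q v y by (simp add: assoc_mult_mat_vec[of _ n n _ n])
    then have "v \<bullet> (Q * mat_diag n d * Q\<^sup>T *\<^sub>v v) = ?y \<bullet> (mat_diag n d *\<^sub>v ?y)"
      using scalar_prod_mult_mat_vec[OF Q(1) v, OF mult_mat_vec_carrier[OF mat_diag_dim y, of d]] by (simp only:)
    then show ?thesis using scalar_prod_mat_diag[OF y] by simp
  qed
  show "v \<bullet> (Q * mat_diag n d * Q\<^sup>T *\<^sub>v v) = (\<Sum>i<n. d i * (?y $ i)\<^sup>2)" by (rule eq)
  show "v \<bullet> v = (\<Sum>i<n. (?y $ i)\<^sup>2)"
    using eq[of "\<lambda>_. 1"] Q v by simp
qed

lemma quadratic_form_diag_shift:
  fixes Q :: "real mat"
  assumes Q: "Q \<in> carrier_mat n n" "Q * Q\<^sup>T = 1\<^sub>m n" and v: "v \<in> carrier_vec n"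
  shows "v \<bullet> (Q * mat_diag n d * Q\<^sup>T *\<^sub>v v) - c * (v \<bullet> v) = (\<Sum>i<n. (d i - c) * ((Q\<^sup>T *\<^sub>v v) $ i)\<^sup>2)"
    and "v \<bullet> v \<noteq> 0 \<Longrightarrow> \<exists>i<n. (Q\<^sup>T *\<^sub>v v) $ i \<noteq> 0"
  unfolding quadratic_form_diag[OF Q v]
  by (auto simp: sum_subtractf sum_distrib_left left_diff_distrib simp del: index_mult_mat_vec intro: sum.neutral)

section \<open>Singular values of positive semidefinite matrices and the Courant-Fischer
  bounds\<close>

lemma sing_vals_psd:
  assumes Q: "Q \<in> carrier_mat n n" "Q\<^sup>T * Q = 1\<^sub>m n" "Q * Q\<^sup>T = 1\<^sub>m n"
    and d: "\<And>i. i < n \<Longrightarrow> d i \<ge> 0"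
  shows "mset (sing_vals (Q * mat_diag n d * Q\<^sup>T)) = mset (map d [0..<n])"
    and "sorted (rev (sing_vals (Q * mat_diag n d * Q\<^sup>T)))"
proof -
  let ?A = "Q * mat_diag n d * Q\<^sup>T"
  let ?D = "mat_diag n d"
  have D: "?D \<in> carrier_mat n n" "?D\<^sup>T = ?D" by (auto simp: mat_diag_def)
  have A: "?A \<in> carrier_mat n n" using Q(1) by auto
  have QT: "Q\<^sup>T \<in> carrier_mat n n" using Q(1) by simp
  have QD: "Q * ?D \<in> carrier_mat n n" using Q(1) D(1) by (rule mult_carrier_mat)
  have "?A\<^sup>T = Q * (Q * ?D)\<^sup>T" using transpose_mult[OF QD QT] by simp
  also have "(Q * ?D)\<^sup>T = ?D * Q\<^sup>T" using transpose_mult[OF Q(1) D(1)] D(2) by simp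
  finally have AT: "?A\<^sup>T = ?A" using Q(1) D QT by (simp add: assoc_mult_mat[of _ n n _ n _ n])
  have "?A\<^sup>T * ?A = (Q * ?D * Q\<^sup>T) * (Q * (?D * Q\<^sup>T))"
    unfolding AT using Q(1) D QT by (simp add: assoc_mult_mat[of _ n n _ n _ n])
  also have "\<dots> = Q * ?D * (Q\<^sup>T * Q) * (?D * Q\<^sup>T)"
    using Q(1) D(1) QT QD
    by (simp add: assoc_mult_mat[of _ n n _ n _ n] mult_carrier_mat[of _ n n _ n])
  also have "\<dots> = Q * (?D * ?D) * Q\<^sup>T"
    unfolding Q(2) using Q(1) D(1) QT QD left_mult_one_mat[OF mult_carrier_mat[OF D(1) QT]]
    by (simp add: assoc_mult_mat[of _ n n _ n _ n] mult_carrier_mat[of _ n n _ n] del: mat_diag_diag)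
  also have "?D * ?D = mat_diag n (\<lambda>i. d i * d i)" by simp
  finally have "?A\<^sup>T * ?A = Q * mat_diag n (\<lambda>i. d i * d i) * Q\<^sup>T" .
  then have P: "proots (char_poly (?A\<^sup>T * ?A)) = mset (map (\<lambda>i. d i * d i) [0..<n])"
    using proots_char_poly_orthogonal_diag[OF Q] by simp
  define ys where "ys = map (\<lambda>i. d i * d i) [0..<n]"
  have sv: "sing_vals ?A = rev (map sqrt (sort ys))"
    unfolding sing_vals_def P ys_def[symmetric] by simp
  \<comment> \<open>Nonnegativity of \<open>d\<close> enters here: in general the square roots would
    be the absolute values of the eigenvalues.\<close>
  have "map sqrt ys = map d [0..<n]"
    using d by (auto simp: ys_def real_sqrt_mult_self)
  then show "mset (sing_vals ?A) = mset (map d [0..<n])"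
    unfolding sv by (metis mset_map mset_rev mset_sort)
  have "sorted_wrt (\<lambda>x y. sqrt x \<le> sqrt y) (sort ys)"
    by (rule sorted_wrt_mono_rel[OF _ sorted_sort]) auto
  then show "sorted (rev (sing_vals ?A))"
    unfolding sv by (simp add: sorted_wrt_map)
qed

text \<open>Sortedness turns a statement about one position of the list into a count of eigenvalues,
  the form in which a dimension count can use it.\<close>

lemma sing_val_index_card:
  assumes Q: "Q \<in> carrier_mat n n" "Q\<^sup>T * Q = 1\<^sub>m n" "Q * Q\<^sup>T = 1\<^sub>m n"
    and d: "\<And>i. i < n \<Longrightarrow> d i \<ge> 0" and l: "1 \<le> l" "l \<le> n"
  shows "sing_val l (Q * mat_diag n d * Q\<^sup>T) < c \<Longrightarrow> card {i\<in>{..<n}. c \<le> d i} < l"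
    and "c < sing_val l (Q * mat_diag n d * Q\<^sup>T) \<Longrightarrow> l \<le> card {i\<in>{..<n}. c < d i}"
proof -
  let ?xs = "sing_vals (Q * mat_diag n d * Q\<^sup>T)"
  have ms: "mset ?xs = mset (map d [0..<n])" by (rule sing_vals_psd(1)[OF Q]) (rule d)
  have so: "sorted (rev ?xs)" by (rule sing_vals_psd(2)[OF Q]) (rule d)
  have len: "length ?xs = n" using arg_cong[OF ms, of size] by simp
  have cnt: "card {i. i < n \<and> P (?xs ! i)} = card {i\<in>{..<n}. P (d i)}" for P
  proof -
    have "card {i. i < n \<and> P (?xs ! i)} = size (filter_mset P (mset ?xs))"
      using length_filter_conv_card[of P ?xs] len by (metis mset_filter size_mset)
    also have "\<dots> = length (filter P (map d [0..<n]))" unfolding ms by (metis mset_filter size_mset)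
    also have "\<dots> = card {i. i < n \<and> P (map d [0..<n] ! i)}"
      using length_filter_conv_card[of P "map d [0..<n]"] by simp
    also have "{i. i < n \<and> P (map d [0..<n] ! i)} = {i\<in>{..<n}. P (d i)}" by auto
    finally show ?thesis .
  qed
  have mono: "?xs ! j \<le> ?xs ! i" if "i \<le> j" "j < n" for i j
    using sorted_rev_nth_mono[OF so] that len by simp
  {
    assume "sing_val l (Q * mat_diag n d * Q\<^sup>T) < c"
    then have *: "?xs ! (l - 1) < c" by (simp add: sing_val_def)
    \<comment> \<open>List positions start at 0, so \<open>sing_val l\<close> sits at position l - 1
      and all later entries are below c too.\<close>
    have "{i. i < n \<and> c \<le> ?xs ! i} \<subseteq> {..<l - 1}"
    proof (intro subsetI)
      fix i assume "i \<in> {i. i < n \<and> c \<le> ?xs ! i}"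
      then show "i \<in> {..<l - 1}"
        using mono[of "l - 1" i] * by (cases "l - 1 \<le> i") auto
    qed
    then have "card {i. i < n \<and> c \<le> ?xs ! i} \<le> card {..<l - 1}" by (intro card_mono) auto
    then show "card {i\<in>{..<n}. c \<le> d i} < l" unfolding cnt[of "\<lambda>x. c \<le> x"] using l by simp
  }
  {
    assume "c < sing_val l (Q * mat_diag n d * Q\<^sup>T)"
    then have *: "c < ?xs ! (l - 1)" by (simp add: sing_val_def)
    have "{..<l} \<subseteq> {i. i < n \<and> c < ?xs ! i}"
    proof
      fix i assume "i \<in> {..<l}"
      then show "i \<in> {i. i < n \<and> c < ?xs ! i}"
        using mono[of i "l - 1"] l * by (auto intro: order.strict_trans2)
    qed
    then have "card {..<l} \<le> card {i. i < n \<and> c < ?xs ! i}" by (intro card_mono) auto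
    then show "l \<le> card {i\<in>{..<n}. c < d i}" unfolding cnt[of "\<lambda>x. c < x"] by simp
  }
qed

lemma psd_spectral:
  fixes A :: "real mat"
  assumes A: "A \<in> carrier_mat n n" "A\<^sup>T = A" and psd: "\<And>v. v \<in> carrier_vec n \<Longrightarrow> v \<bullet> (A *\<^sub>v v) \<ge> 0"
  obtains Q d where "Q \<in> carrier_mat n n" "Q\<^sup>T * Q = 1\<^sub>m n" "Q * Q\<^sup>T = 1\<^sub>m n"
    "A = Q * mat_diag n d * Q\<^sup>T" "\<And>i. i < n \<Longrightarrow> d i \<ge> 0"
proof -
  obtain Q d where Q: "Q \<in> carrier_mat n n" "Q\<^sup>T * Q = 1\<^sub>m n" "Q * Q\<^sup>T = 1\<^sub>m n"
    "A = Q * mat_diag n d * Q\<^sup>T" using real_spectral[OF A] by blast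
  have "d i \<ge> 0" if i: "i < n" for i
  proof -
    let ?v = "Q *\<^sub>v unit_vec n i"
    have v: "?v \<in> carrier_vec n" using Q by simp
    have "Q\<^sup>T *\<^sub>v ?v = unit_vec n i"
      using assoc_mult_mat_vec[of "Q\<^sup>T" n n Q n "unit_vec n i"] Q by simp
    then have "?v \<bullet> (A *\<^sub>v ?v) = (\<Sum>j<n. d j * (unit_vec n i $ j)\<^sup>2)"
      using quadratic_form_diag(1)[OF Q(1,3) v] Q(4) by simp
    also have "\<dots> = (\<Sum>j<n. if j = i then d i else 0)" using i by (intro sum.cong) auto
    also have "\<dots> = d i" using i by simp
    finally show ?thesis using psd[OF v] by simp
  qed
  then show ?thesis using that Q by blast
qed

text \<open>If fewer than r eigenvalues reached c, a dimension count would give a nonzero a with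
  \<open>F a\<close> orthogonal to their eigenvectors, and there the form stays strictly below c.
  The subspace is given by an injective F instead of an orthonormal basis, because restricting V to
  some of its rows destroys orthonormality.\<close>

lemma sing_val_ge:
  fixes A :: "real mat"
  assumes A: "A \<in> carrier_mat n n" "A\<^sup>T = A" and psd: "\<And>v. v \<in> carrier_vec n \<Longrightarrow> v \<bullet> (A *\<^sub>v v) \<ge> 0"
    and r: "1 \<le> r" "r \<le> n" and F: "F \<in> carrier_mat n r"
    and inj: "\<And>a. a \<in> carrier_vec r \<Longrightarrow> a \<noteq> 0\<^sub>v r \<Longrightarrow> F *\<^sub>v a \<noteq> 0\<^sub>v n"
    and ge: "\<And>a. a \<in> carrier_vec r \<Longrightarrow> c * ((F *\<^sub>v a) \<bullet> (F *\<^sub>v a)) \<le> (F *\<^sub>v a) \<bullet> (A *\<^sub>v (F *\<^sub>v a))"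
  shows "c \<le> sing_val r A"
proof (rule ccontr)
  assume "\<not> c \<le> sing_val r A"
  then have less: "sing_val r A < c" by simp
  obtain Q d where Q: "Q \<in> carrier_mat n n" "Q\<^sup>T * Q = 1\<^sub>m n" "Q * Q\<^sup>T = 1\<^sub>m n"
    "A = Q * mat_diag n d * Q\<^sup>T" "\<And>i. i < n \<Longrightarrow> d i \<ge> 0" using psd_spectral[OF A psd] by blast
  define I where "I = {i\<in>{..<n}. c \<le> d i}"
  have cardI: "card I < r"
    using sing_val_index_card(1)[where d = d, OF Q(1-3,5) r] less unfolding Q(4) I_def by blast
  define G where "G = Q\<^sup>T * F"
  have G: "G \<in> carrier_mat n r" using Q F by (simp add: G_def)
  have "finite I" by (simp add: I_def)
  then have "card (Matrix.row G ` I) < r" using cardI card_image_le le_less_trans by blast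
  then obtain a where a: "a \<in> carrier_vec r" "a \<noteq> 0\<^sub>v r" "\<And>i. i \<in> I \<Longrightarrow> Matrix.row G i \<bullet> a = 0"
  proof -
    have "Matrix.row G ` I \<subseteq> carrier_vec r" using G row_carrier[of G] by auto
    from underdetermined_nonzero[OF _ this] show ?thesis
      using that \<open>finite I\<close> \<open>card (Matrix.row G ` I) < r\<close> by auto
  qed
  let ?v = "F *\<^sub>v a"
  have v: "?v \<in> carrier_vec n" using F a by simp
  have y: "Q\<^sup>T *\<^sub>v ?v = G *\<^sub>v a" unfolding G_def using Q F a by (simp add: assoc_mult_mat_vec[of _ n n _ r])
  have z: "(Q\<^sup>T *\<^sub>v ?v) $ i = 0" if "i \<in> I" for i
    unfolding y using a(3)[OF that] that G by (auto simp: I_def)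
  have nz: "?v \<bullet> ?v \<noteq> 0" using inj[OF a(1,2)] v conjugate_square_eq_0_vec[of ?v n] by simp
  note eq = quadratic_form_diag_shift(1)[OF Q(1,3) v, of d c, folded Q(4)]
  obtain i where i: "i < n" "(Q\<^sup>T *\<^sub>v ?v) $ i \<noteq> 0"
    using quadratic_form_diag_shift(2)[OF Q(1,3) v nz] by blast
  have "(\<Sum>i<n. (d i - c) * ((Q\<^sup>T *\<^sub>v ?v) $ i)\<^sup>2) < (\<Sum>i<n. 0)"
  proof (rule sum_strict_mono_ex1)
    show "\<forall>j\<in>{..<n}. (d j - c) * ((Q\<^sup>T *\<^sub>v ?v) $ j)\<^sup>2 \<le> 0"
    proof
      fix j assume j: "j \<in> {..<n}"
      show "(d j - c) * ((Q\<^sup>T *\<^sub>v ?v) $ j)\<^sup>2 \<le> 0"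
      proof (cases "j \<in> I")
        case True
        then show ?thesis using z by simp
      next
        case False
        then have "d j - c \<le> 0" using j by (auto simp: I_def)
        then show ?thesis by (simp add: mult_nonpos_nonneg)
      qed
    qed
    have "i \<notin> I" using i z by blast
    then have "d i - c < 0" using i by (auto simp: I_def)
    then show "\<exists>j\<in>{..<n}. (d j - c) * ((Q\<^sup>T *\<^sub>v ?v) $ j)\<^sup>2 < 0"
      using i by (intro bexI[of _ i]) (auto simp: mult_neg_pos)
  qed simp
  then show False using ge[OF a(1)] eq by simp
qed

text \<open>If l eigenvalues exceeded c, the remaining eigenvectors together with W would be fewer
  than n constraints. A nonzero vector orthogonal to all of them lies in the span of the large
  eigenvectors and contradicts the bound on the form.\<close>

lemma sing_val_le:
  fixes A :: "real mat"
  assumes A: "A \<in> carrier_mat n n" "A\<^sup>T = A" and psd: "\<And>v. v \<in> carrier_vec n \<Longrightarrow> v \<bullet> (A *\<^sub>v v) \<ge> 0"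
    and l: "card W < l" "l \<le> n" and W: "finite W" "W \<subseteq> carrier_vec n"
    and le: "\<And>v. v \<in> carrier_vec n \<Longrightarrow> (\<And>w. w \<in> W \<Longrightarrow> w \<bullet> v = 0) \<Longrightarrow> v \<bullet> (A *\<^sub>v v) \<le> c * (v \<bullet> v)"
  shows "sing_val l A \<le> c"
proof (rule ccontr)
  assume "\<not> sing_val l A \<le> c"
  then have less: "c < sing_val l A" by simp
  obtain Q d where Q: "Q \<in> carrier_mat n n" "Q\<^sup>T * Q = 1\<^sub>m n" "Q * Q\<^sup>T = 1\<^sub>m n"
    "A = Q * mat_diag n d * Q\<^sup>T" "\<And>i. i < n \<Longrightarrow> d i \<ge> 0" using psd_spectral[OF A psd] by blast
  have QT: "Q\<^sup>T \<in> carrier_mat n n" using Q by simp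
  define I where "I = {i\<in>{..<n}. c < d i}"
  have I: "I \<subseteq> {..<n}" "finite I" by (auto simp: I_def)
  have "1 \<le> l" using l by simp
  then have cardI: "l \<le> card I"
    using sing_val_index_card(2)[where d = d, OF Q(1-3,5) _ l(2)] less unfolding Q(4) I_def by blast
  define W' where "W' = W \<union> Matrix.row Q\<^sup>T ` ({..<n} - I)"
  have W': "finite W'" "W' \<subseteq> carrier_vec n" using W QT by (auto simp: W'_def)
  have "card W' \<le> card W + card ({..<n} - I)"
    unfolding W'_def by (meson card_Un_le card_image_le add_left_mono finite_Diff finite_lessThan order_trans)
  also have "card ({..<n} - I) = n - card I" using I by (simp add: card_Diff_subset)
  also have "card W + (n - card I) < n" using cardI l by linarith
  finally obtain v where v: "v \<in> carrier_vec n" "v \<noteq> 0\<^sub>v n" "\<And>w. w \<in> W' \<Longrightarrow> w \<bullet> v = 0"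
    using underdetermined_nonzero[OF W'] by auto
  have z: "(Q\<^sup>T *\<^sub>v v) $ i = 0" if "i < n" "i \<notin> I" for i
    using v(3)[of "Matrix.row Q\<^sup>T i"] that QT by (auto simp: W'_def)
  have nz: "v \<bullet> v \<noteq> 0" using v conjugate_square_eq_0_vec[of v n] by simp
  note eq = quadratic_form_diag_shift(1)[OF Q(1,3) v(1), of d c, folded Q(4)]
  obtain i where i: "i < n" "(Q\<^sup>T *\<^sub>v v) $ i \<noteq> 0"
    using quadratic_form_diag_shift(2)[OF Q(1,3) v(1) nz] by blast
  have "0 < (\<Sum>i<n. (d i - c) * ((Q\<^sup>T *\<^sub>v v) $ i)\<^sup>2)"
  proof (rule sum_pos2[of _ i])
    have "i \<in> I" using i z by blast
    then show "0 < (d i - c) * ((Q\<^sup>T *\<^sub>v v) $ i)\<^sup>2" using i by (simp add: I_def)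
  next
    fix j assume "j \<in> {..<n}"
    then show "0 \<le> (d j - c) * ((Q\<^sup>T *\<^sub>v v) $ j)\<^sup>2"
      using z[of j] by (cases "j \<in> I") (auto simp: I_def)
  qed (use i in auto)
  then show False using le[OF v(1)] v(3) eq by (auto simp: W'_def)
qed

section \<open>Rank of a matrix product\<close>

lemma (in vec_space) mult_mat_vec_in_span_cols:
  assumes A: "A \<in> carrier_mat n m" and v: "v \<in> carrier_vec m"
  shows "A *\<^sub>v v \<in> span (set (cols A))"
proof -
  have cA: "set (cols A) \<subseteq> carrier_vec n" using A cols_dim by (metis carrier_matD(1))
  have "lincomb_list (\<lambda>i. v $ i) (cols A) = mat_of_cols n (cols A) *\<^sub>v Matrix.vec (length (cols A)) (\<lambda>i. v $ i)"
    using cA by (intro lincomb_list_as_mat_mult) auto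
  also have "mat_of_cols n (cols A) = A" using mat_of_cols_cols[of A] A by auto
  also have "Matrix.vec (length (cols A)) (\<lambda>i. v $ i) = v" using A v by auto
  finally have "A *\<^sub>v v \<in> span_list (cols A)" by (metis in_span_listI)
  then show ?thesis using cA by (simp add: span_list_as_span)
qed

lemma (in vec_space) rank_mult_le:
  assumes A: "A \<in> carrier_mat n m" and B: "B \<in> carrier_mat m k"
  shows "rank (A * B) \<le> rank A"
proof -
  have AB: "A * B \<in> carrier_mat n k" using A B by simp
  have cA: "set (cols A) \<subseteq> carrier_vec n" and cAB: "set (cols (A * B)) \<subseteq> carrier_vec n"
    using A AB cols_dim by (metis carrier_matD(1))+
  have "set (cols (A * B)) \<subseteq> span (set (cols A))"
  proof
    fix x assume "x \<in> set (cols (A * B))"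
    then obtain j where j: "j < k" "x = col (A * B) j"
      using AB by (metis carrier_matD(2) cols_length cols_nth in_set_conv_nth)
    have "col (A * B) j = A *\<^sub>v col B j" by (rule col_mult2[OF A B j(1)])
    moreover have "col B j \<in> carrier_vec m" using B j by (metis carrier_matD(1) col_carrier_vec col_dim)
    ultimately show "x \<in> span (set (cols A))"
      using j A mult_mat_vec_in_span_cols[OF A] by simp
  qed
  then have sub: "span (set (cols (A * B))) \<subseteq> span (set (cols A))"
    by (simp add: cA span_is_submodule span_is_subset)
  have "subspace class_ring (span (set (cols A))) V" "subspace class_ring (span (set (cols (A * B)))) V"
    using cA cAB span_is_subspace by auto
  then have "subspace class_ring (span (set (cols (A * B)))) (vs (span (set (cols A))))"
    using nested_subspaces sub by blast
  moreover have "vectorspace.fin_dim class_ring (vs (span (set (cols A))))"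
    using fin_dim_span_cols A by blast
  moreover have "vectorspace class_ring (vs (span (set (cols A))))"
    using \<open>subspace class_ring (span (set (cols A))) V\<close> subspace_is_vs by blast
  moreover have "vectorspace.fin_dim class_ring (vs (span (set (cols (A * B)))))"
    using fin_dim_span_cols AB by blast
  ultimately show ?thesis unfolding rank_def
    using vectorspace.subspace_dim[of class_ring "vs (span (set (cols A)))" "span (set (cols (A * B)))"] by simp
qed

section \<open>Lattice nets\<close>

lemma sum_power_abs_symmetric_interval:
  "(\<Sum>i\<in>{- int N..int N}. (9 / 10 :: real) ^ nat \<bar>i\<bar>) = 19 - 18 * (9 / 10) ^ N"
proof (induction N)
  case (Suc N)
  have "{- int (Suc N)..int (Suc N)} = insert (int (Suc N)) (insert (- int (Suc N)) {- int N..int N})"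
    by auto
  then show ?case using Suc by (simp add: nat_add_distrib)
qed simp

text \<open>Integer points of the ball of radius 10 sqrt m, with m the size of D. The surrounding
  box makes the set finite, and its product shape lets a sum of product weights factor over the
  coordinates.\<close>

definition lattice_points :: "nat set \<Rightarrow> (nat \<Rightarrow> int) set" where
  "lattice_points D = {z \<in> Pi\<^sub>E D (\<lambda>_. {- int (10 * card D)..int (10 * card D)}).
     (\<Sum>j\<in>D. (z j)\<^sup>2) \<le> 100 * int (card D)}"

lemma finite_lattice_points: "finite D \<Longrightarrow> finite (lattice_points D)"
  unfolding lattice_points_def by (intro finite_Collect_conjI disjI1) (auto intro: finite_PiE)

text \<open>
  A lattice point of squared length at most 100 m has weight \<open>\<Prod> 0.9^\<bar>z j\<bar> \<ge> 0.9^(10 m)\<close>, while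
  all weights add up to at most \<open>19^m\<close>.
\<close>

lemma card_lattice_points:
  assumes "finite D"
  shows "real (card (lattice_points D)) \<le> 57 ^ card D"
proof -
  let ?m = "card D" and ?q = "9 / 10 :: real"
  let ?P = "Pi\<^sub>E D (\<lambda>_. {- int (10 * card D)..int (10 * card D)})"
  have fin: "finite (lattice_points D)" by (rule finite_lattice_points[OF assms])
  have weight: "?q ^ (10 * ?m) \<le> (\<Prod>j\<in>D. ?q ^ nat \<bar>z j\<bar>)" if z: "z \<in> lattice_points D" for z
  proof -
    \<comment> \<open>Cauchy-Schwarz against the all-ones vector: squared length at most 100 m gives
      a sum of absolute values at most 10 m.\<close>
    have "(\<Sum>j\<in>D. real_of_int \<bar>z j\<bar> * 1)\<^sup>2 \<le> (\<Sum>j\<in>D. (real_of_int \<bar>z j\<bar>)\<^sup>2) * (\<Sum>j\<in>D. 1\<^sup>2)"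
      by (rule Cauchy_Schwarz_ineq_sum)
    also have "\<dots> = real_of_int (\<Sum>j\<in>D. (z j)\<^sup>2) * real ?m" by simp
    also have "\<dots> \<le> real_of_int (100 * int ?m) * real ?m"
      using z by (intro mult_right_mono of_int_le_iff[THEN iffD2]) (auto simp: lattice_points_def simp del: of_int_sum)
    also have "\<dots> = (10 * real ?m)\<^sup>2" by (simp add: power2_eq_square)
    finally have "(\<Sum>j\<in>D. real_of_int \<bar>z j\<bar>)\<^sup>2 \<le> (10 * real ?m)\<^sup>2" by (simp only: mult_1_right)
    then have "(\<Sum>j\<in>D. real_of_int \<bar>z j\<bar>) \<le> 10 * real ?m" by (rule power2_le_imp_le) simp
    moreover have "real (\<Sum>j\<in>D. nat \<bar>z j\<bar>) = (\<Sum>j\<in>D. real_of_int \<bar>z j\<bar>)" by simp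
    ultimately have "(\<Sum>j\<in>D. nat \<bar>z j\<bar>) \<le> 10 * ?m" by linarith
    then have "?q ^ (10 * ?m) \<le> ?q ^ (\<Sum>j\<in>D. nat \<bar>z j\<bar>)" by (intro power_decreasing) auto
    then show ?thesis by (simp add: power_sum)
  qed
  have "real (card (lattice_points D)) * ?q ^ (10 * ?m) = (\<Sum>z\<in>lattice_points D. ?q ^ (10 * ?m))" by simp
  also have "\<dots> \<le> (\<Sum>z\<in>lattice_points D. \<Prod>j\<in>D. ?q ^ nat \<bar>z j\<bar>)" by (intro sum_mono weight)
  also have "\<dots> \<le> (\<Sum>z\<in>?P. \<Prod>j\<in>D. ?q ^ nat \<bar>z j\<bar>)"
    using assms by (intro sum_mono2 prod_nonneg) (auto simp: lattice_points_def intro: finite_PiE)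
  also have "\<dots> = (\<Prod>j\<in>D. \<Sum>i\<in>{- int (10 * card D)..int (10 * card D)}. ?q ^ nat \<bar>i\<bar>)"
    using assms by (subst prod_sum_PiE) auto
  also have "\<dots> = (19 - 18 * ?q ^ (10 * card D)) ^ ?m"
    unfolding sum_power_abs_symmetric_interval by simp
  also have "\<dots> \<le> 19 ^ ?m"
    using power_le_one[of ?q "10 * card D"] by (intro power_mono) auto
  finally have *: "real (card (lattice_points D)) * (?q ^ 10) ^ ?m \<le> 19 ^ ?m" unfolding power_mult .
  have "c \<le> a / b" if "c * b \<le> a" "b > 0" for a b c :: real
    using that by (simp add: field_simps)
  from this[OF *] have "real (card (lattice_points D)) \<le> 19 ^ ?m / (?q ^ 10) ^ ?m" by simp
  also have "\<dots> = (19 / ?q ^ 10) ^ ?m" by (simp only: power_divide)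
  \<comment> \<open>Numerically 19 / 0.9^10 is about 54.5; the bound 57 is chosen to lie below exp
    5.\<close>
  also have "\<dots> \<le> 57 ^ ?m" by (intro power_mono) (auto simp: eval_nat_numeral)
  finally show ?thesis .
qed

text \<open>Vectors keep dimension p, so that different column sets and their unions live in one
  space and no reindexing occurs.\<close>

definition supp_in :: "nat \<Rightarrow> nat set \<Rightarrow> real Matrix.vec set" where
  "supp_in p D = {v \<in> carrier_vec p. \<forall>i<p. i \<notin> D \<longrightarrow> v $ i = 0}"

text \<open>The grid spacing 1 / (10 sqrt m) makes the rounding error at most 1 / (100 m) in each
  squared coordinate, hence at most 1/100 in total.\<close>

definition net :: "nat \<Rightarrow> nat set \<Rightarrow> real Matrix.vec set" where
  "net p D = (\<lambda>z. Matrix.vec p (\<lambda>i. if i \<in> D then real_of_int (z i) / (10 * sqrt (real (card D))) else 0))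
     ` lattice_points D"

lemma supp_inD: "v \<in> supp_in p D \<Longrightarrow> v \<in> carrier_vec p"
  by (simp add: supp_in_def)

lemma supp_in_mono: "v \<in> supp_in p D \<Longrightarrow> D \<subseteq> E \<Longrightarrow> v \<in> supp_in p E"
  by (auto simp: supp_in_def)

lemma supp_in_full: "v \<in> carrier_vec p \<Longrightarrow> v \<in> supp_in p {..<p}"
  by (simp add: supp_in_def)

lemma supp_in_add: "u \<in> supp_in p D \<Longrightarrow> v \<in> supp_in p D \<Longrightarrow> u + v \<in> supp_in p D"
  and supp_in_diff: "u \<in> supp_in p D \<Longrightarrow> v \<in> supp_in p D \<Longrightarrow> u - v \<in> supp_in p D"
  and supp_in_smult: "u \<in> supp_in p D \<Longrightarrow> c \<cdot>\<^sub>v u \<in> supp_in p D"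
  by (auto simp: supp_in_def)

lemma scalar_prod_supp_in:
  assumes "u \<in> supp_in p D" "D \<subseteq> {..<p}" "w \<in> carrier_vec p"
  shows "u \<bullet> w = (\<Sum>i\<in>D. u $ i * w $ i)" "w \<bullet> u = (\<Sum>i\<in>D. w $ i * u $ i)"
proof -
  have "u \<bullet> w = (\<Sum>i<p. u $ i * w $ i)" "w \<bullet> u = (\<Sum>i<p. w $ i * u $ i)"
    using assms by (auto simp: scalar_prod_def lessThan_atLeast0 supp_in_def)
  moreover have "(\<Sum>i<p. u $ i * w $ i) = (\<Sum>i\<in>D. u $ i * w $ i)" "(\<Sum>i<p. w $ i * u $ i) = (\<Sum>i\<in>D. w $ i * u $ i)"
    using assms by (auto intro!: sum.mono_neutral_right simp: supp_in_def)
  ultimately show "u \<bullet> w = (\<Sum>i\<in>D. u $ i * w $ i)" "w \<bullet> u = (\<Sum>i\<in>D. w $ i * u $ i)" by auto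
qed

lemma scalar_prod_self_nonneg: "(v :: real Matrix.vec) \<bullet> v \<ge> 0"
  by (auto simp: scalar_prod_def intro: sum_nonneg)

lemma scalar_prod_self_eq_0:
  "(v :: real Matrix.vec) \<in> carrier_vec n \<Longrightarrow> v \<bullet> v = 0 \<longleftrightarrow> v = 0\<^sub>v n"
  using conjugate_square_eq_0_vec[of v n] by simp

lemma finite_net: "finite D \<Longrightarrow> finite (net p D)"
  unfolding net_def by (intro finite_imageI finite_lattice_points)

lemma card_net: "finite D \<Longrightarrow> real (card (net p D)) \<le> 57 ^ card D"
  unfolding net_def using card_lattice_points[of D] card_image_le[OF finite_lattice_points[of D]]
  by (meson of_nat_mono order_trans)

lemma net_supp_in: "x \<in> net p D \<Longrightarrow> x \<in> supp_in p D"
  by (auto simp: net_def supp_in_def)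

lemma net_norm_le_1:
  assumes x: "x \<in> net p D" and D: "D \<subseteq> {..<p}"
  shows "x \<bullet> x \<le> 1"
proof -
  obtain z where z: "z \<in> lattice_points D"
    "x = Matrix.vec p (\<lambda>i. if i \<in> D then real_of_int (z i) / (10 * sqrt (real (card D))) else 0)"
    using x by (auto simp: net_def)
  have "x \<bullet> x = (\<Sum>i\<in>D. x $ i * x $ i)"
    using scalar_prod_supp_in[OF net_supp_in[OF x] D] supp_inD[OF net_supp_in[OF x]] by blast
  also have "\<dots> = (\<Sum>i\<in>D. (real_of_int (z i))\<^sup>2 / (100 * real (card D)))"
    using D by (intro sum.cong) (auto simp: z(2) power2_eq_square subset_iff)
  also have "\<dots> = real_of_int (\<Sum>i\<in>D. (z i)\<^sup>2) / (100 * real (card D))"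
    by (simp add: sum_divide_distrib)
  also have "\<dots> \<le> real_of_int (100 * int (card D)) / (100 * real (card D))"
    using z(1) by (intro divide_right_mono of_int_le_iff[THEN iffD2]) (auto simp: lattice_points_def simp del: of_int_sum)
  also have "\<dots> \<le> 1" by simp
  finally show ?thesis .
qed

lemma net_approx:
  assumes v: "v \<in> supp_in p D" "v \<bullet> v \<le> 1" and D: "D \<subseteq> {..<p}" "D \<noteq> {}"
  shows "\<exists>x\<in>net p D. (v - x) \<bullet> (v - x) \<le> 1 / 100"
proof -
  let ?m = "card D"
  have fin: "finite D" using D finite_subset by blast
  then have m: "?m \<ge> 1" using D by (simp add: Suc_le_eq card_gt_0_iff)
  define s where "s = 10 * sqrt (real ?m)"
  have s: "s > 0" "s\<^sup>2 = 100 * real ?m" using m by (auto simp: s_def power_mult_distrib)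
  \<comment> \<open>Rounding towards zero never increases a coordinate in absolute value, so the
    rounded point stays in the ball and thus in the net.\<close>
  define r where "r y = (if y \<ge> 0 then \<lfloor>y\<rfloor> else \<lceil>y\<rceil>)" for y :: real
  have r: "\<bar>real_of_int (r y)\<bar> \<le> \<bar>y\<bar> \<and> \<bar>y - real_of_int (r y)\<bar> \<le> 1" for y
  proof (cases "y \<ge> 0")
    case True
    then have "0 \<le> \<lfloor>y\<rfloor>" by simp
    then have "0 \<le> real_of_int \<lfloor>y\<rfloor>" by (simp only: of_int_0_le_iff)
    moreover have "r y = \<lfloor>y\<rfloor>" using True by (simp add: r_def)
    moreover have "real_of_int \<lfloor>y\<rfloor> \<le> y" "y - real_of_int \<lfloor>y\<rfloor> \<le> 1" by linarith+
    ultimately show ?thesis using True by (simp add: abs_of_nonneg)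
  next
    case False
    then have "\<lceil>y\<rceil> \<le> 0" by simp
    then have "real_of_int \<lceil>y\<rceil> \<le> 0" by (simp only: of_int_le_0_iff)
    moreover have "r y = \<lceil>y\<rceil>" using False by (simp add: r_def)
    moreover have "y \<le> real_of_int \<lceil>y\<rceil>" "real_of_int \<lceil>y\<rceil> \<le> y + 1" by linarith+
    ultimately show ?thesis using False by (simp only: not_le abs_of_neg) (intro conjI abs_leI; linarith)
  qed
  note r1 = r[THEN conjunct1] and r2 = r[THEN conjunct2]
  define z where "z = (\<lambda>i\<in>D. r (s * v $ i))"
  have vv: "v \<bullet> v = (\<Sum>i\<in>D. (v $ i)\<^sup>2)"
    using scalar_prod_supp_in(1)[OF v(1) D(1) supp_inD[OF v(1)]] by (simp add: power2_eq_square)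
  have "real_of_int (\<Sum>i\<in>D. (z i)\<^sup>2) = (\<Sum>i\<in>D. \<bar>real_of_int (r (s * v $ i))\<bar>\<^sup>2)" by (simp add: z_def)
  also have "\<dots> \<le> (\<Sum>i\<in>D. \<bar>s * v $ i\<bar>\<^sup>2)" by (intro sum_mono power_mono r1) simp
  also have "\<dots> = s\<^sup>2 * (v \<bullet> v)" unfolding vv by (simp add: power_mult_distrib sum_distrib_left)
  also have "\<dots> \<le> s\<^sup>2 * 1" using v(2) by (intro mult_left_mono) auto
  finally have sz: "(\<Sum>i\<in>D. (z i)\<^sup>2) \<le> 100 * int ?m" using s(2) by linarith
  have "\<bar>z i\<bar> \<le> int (10 * ?m)" if i: "i \<in> D" for i
  proof -
    have "(z i)\<^sup>2 \<le> (\<Sum>i\<in>D. (z i)\<^sup>2)" using fin i by (intro member_le_sum) auto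
    also have "\<dots> \<le> 100 * (int ?m * int ?m)"
    proof -
      have "int ?m * 1 \<le> int ?m * int ?m" using m by (intro mult_left_mono) auto
      then show ?thesis using sz by linarith
    qed
    finally have "\<bar>z i\<bar>\<^sup>2 \<le> (int (10 * ?m))\<^sup>2" by (simp add: power2_eq_square)
    then show ?thesis by (rule power2_le_imp_le) simp
  qed
  then have "z \<in> Pi\<^sub>E D (\<lambda>_. {- int (10 * card D)..int (10 * card D)})"
    by (force simp: z_def PiE_def abs_le_iff Pi_def)
  then have zL: "z \<in> lattice_points D" using sz by (simp add: lattice_points_def)
  define x where "x = Matrix.vec p (\<lambda>i. if i \<in> D then real_of_int (z i) / (10 * sqrt (real ?m)) else 0)"
  have x: "x \<in> net p D" unfolding net_def x_def using zL by (rule imageI)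
  have vx: "v - x \<in> supp_in p D" by (rule supp_in_diff[OF v(1) net_supp_in[OF x]])
  have "(v - x) \<bullet> (v - x) = (\<Sum>i\<in>D. (v $ i - real_of_int (r (s * v $ i)) / s)\<^sup>2)"
    unfolding scalar_prod_supp_in(1)[OF vx D(1) supp_inD[OF vx]] using D v(1)
    by (intro sum.cong) (auto simp: x_def z_def power2_eq_square s_def subset_iff supp_in_def)
  also have "\<dots> \<le> (\<Sum>i\<in>D. (1 / s)\<^sup>2)"
  proof (intro sum_mono)
    fix i
    have "v $ i - real_of_int (r (s * v $ i)) / s = (s * v $ i - real_of_int (r (s * v $ i))) / s"
      using s by (simp add: field_simps)
    then have "\<bar>v $ i - real_of_int (r (s * v $ i)) / s\<bar> \<le> 1 / s"
      using r2[of "s * v $ i"] s by (simp add: divide_right_mono)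
    then show "(v $ i - real_of_int (r (s * v $ i)) / s)\<^sup>2 \<le> (1 / s)\<^sup>2"
      by (metis abs_ge_zero power2_abs power_mono)
  qed
  also have "\<dots> = 1 / 100" using s(2) m by (simp add: power_divide)
  finally show ?thesis using x by blast
qed

section \<open>From a net to quadratic and bilinear forms\<close>

lemma vnorm_sq: "(vnorm v)\<^sup>2 = v \<bullet> v"
  unfolding vnorm_def by (simp add: scalar_prod_self_nonneg)

lemma vnorm_nonneg: "vnorm v \<ge> 0"
  by (simp add: vnorm_def scalar_prod_self_nonneg)

lemma vnorm_smult: "vnorm (c \<cdot>\<^sub>v v) = \<bar>c\<bar> * vnorm v"
proof -
  have "(c \<cdot>\<^sub>v v) \<bullet> (c \<cdot>\<^sub>v v) = c\<^sup>2 * (v \<bullet> v)" by (simp add: power2_eq_square)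
  then show ?thesis by (simp add: vnorm_def real_sqrt_mult)
qed

text \<open>Polarization on unit vectors: the forms at x + y and x - y differ by four times the
  bilinear value, while the squared norms of x + y and x - y add up to 4. Hence the constant of the
  quadratic bound is kept.\<close>

lemma bilinear_bound_from_quadratic:
  fixes M :: "real mat"
  assumes M: "M \<in> carrier_mat p p" "M\<^sup>T = M"
    and q: "\<And>v. v \<in> supp_in p D \<Longrightarrow> \<bar>v \<bullet> (M *\<^sub>v v)\<bar> \<le> q * (v \<bullet> v)"
    and u: "u \<in> supp_in p D" and v: "v \<in> supp_in p D"
  shows "\<bar>u \<bullet> (M *\<^sub>v v)\<bar> \<le> q * vnorm u * vnorm v"
proof -
  note c = supp_inD[OF u] supp_inD[OF v]
  have sym: "y \<bullet> (M *\<^sub>v x) = x \<bullet> (M *\<^sub>v y)" if "x \<in> carrier_vec p" "y \<in> carrier_vec p" for x y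
    using scalar_prod_mult_mat_vec[OF M(1) that(2,1)] M(2) that M(1)
    by (metis comm_scalar_prod mult_mat_vec_carrier)
  have unit: "\<bar>x \<bullet> (M *\<^sub>v y)\<bar> \<le> q"
    if x: "x \<in> supp_in p D" "x \<bullet> x = 1" and y: "y \<in> supp_in p D" "y \<bullet> y = 1" for x y
  proof -
    note xy = supp_inD[OF x(1)] supp_inD[OF y(1)]
    have Mx: "M *\<^sub>v x \<in> carrier_vec p" "M *\<^sub>v y \<in> carrier_vec p"
      by (intro mult_mat_vec_carrier[OF M(1)] xy)+
    have 1: "(x + y) \<bullet> (M *\<^sub>v (x + y)) = x \<bullet> (M *\<^sub>v x) + 2 * (x \<bullet> (M *\<^sub>v y)) + y \<bullet> (M *\<^sub>v y)"
      using xy Mx M sym[OF xy] by (simp add: mult_add_distrib_mat_vec[of _ p p] add_scalar_prod_distrib[of _ p] scalar_prod_add_distrib[of _ p])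
    have 2: "(x - y) \<bullet> (M *\<^sub>v (x - y)) = x \<bullet> (M *\<^sub>v x) - 2 * (x \<bullet> (M *\<^sub>v y)) + y \<bullet> (M *\<^sub>v y)"
      using xy Mx M sym[OF xy] by (simp add: mult_minus_distrib_mat_vec[of _ p p] minus_scalar_prod_distrib[of _ p] scalar_prod_minus_distrib[of _ p])
    have 3: "(x + y) \<bullet> (x + y) = 2 + 2 * (x \<bullet> y)" "(x - y) \<bullet> (x - y) = 2 - 2 * (x \<bullet> y)"
      using xy x y comm_scalar_prod[OF xy]
      by (simp_all add: add_scalar_prod_distrib[of _ p] scalar_prod_add_distrib[of _ p] minus_scalar_prod_distrib[of _ p] scalar_prod_minus_distrib[of _ p])
    have "\<bar>(x + y) \<bullet> (M *\<^sub>v (x + y))\<bar> \<le> q * (2 + 2 * (x \<bullet> y))"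
      using q[OF supp_in_add[OF x(1) y(1)]] by (simp add: 3)
    moreover have "\<bar>(x - y) \<bullet> (M *\<^sub>v (x - y))\<bar> \<le> q * (2 - 2 * (x \<bullet> y))"
      using q[OF supp_in_diff[OF x(1) y(1)]] by (simp add: 3)
    ultimately show ?thesis unfolding 1 2 by (simp add: algebra_simps abs_if split: if_splits)
  qed
  show ?thesis
  proof (cases "u \<bullet> u = 0 \<or> v \<bullet> v = 0")
    case True
    then have "u = 0\<^sub>v p \<or> v = 0\<^sub>v p" using scalar_prod_self_eq_0 c by blast
    then have "u \<bullet> (M *\<^sub>v v) = 0" using c M
      by (metis scalar_prod_left_zero scalar_prod_right_zero mult_mat_vec_carrier sym)
    moreover have "q * vnorm u * vnorm v = 0" using True by (auto simp: vnorm_def)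
    ultimately show ?thesis by linarith
  next
    case False
    then have pos: "vnorm u > 0" "vnorm v > 0"
      using scalar_prod_self_nonneg[of u] scalar_prod_self_nonneg[of v] by (auto simp: vnorm_def)
    let ?x = "(1 / vnorm u) \<cdot>\<^sub>v u" and ?y = "(1 / vnorm v) \<cdot>\<^sub>v v"
    have "?x \<bullet> ?x = 1" "?y \<bullet> ?y = 1"
      using pos by (simp_all add: vnorm_sq[symmetric] vnorm_smult power2_eq_square)
    then have "\<bar>?x \<bullet> (M *\<^sub>v ?y)\<bar> \<le> q" by (intro unit supp_in_smult u v)
    also have "?x \<bullet> (M *\<^sub>v ?y) = u \<bullet> (M *\<^sub>v v) / (vnorm u * vnorm v)"
      using c M by (simp add: mult_mat_vec[of _ p p])
    finally show ?thesis using pos by (simp add: abs_mult field_simps)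
  qed
qed

text \<open>A crude bound whose purpose is the existence of suprema over the unit ball.\<close>

lemma quadratic_form_bounded:
  fixes M :: "real mat"
  assumes M: "M \<in> carrier_mat p p" and v: "v \<in> carrier_vec p" "v \<bullet> v \<le> 1"
  shows "\<bar>v \<bullet> (M *\<^sub>v v)\<bar> \<le> (\<Sum>i<p. \<Sum>j<p. \<bar>M $$ (i, j)\<bar>)"
proof -
  have le1: "\<bar>v $ i\<bar> \<le> 1" if "i < p" for i
  proof -
    have "(v $ i)\<^sup>2 \<le> (\<Sum>i<p. (v $ i)\<^sup>2)" using that by (intro member_le_sum) auto
    also have "\<dots> = v \<bullet> v" using v by (simp add: scalar_prod_def lessThan_atLeast0 power2_eq_square)
    finally have "(v $ i)\<^sup>2 \<le> 1" using v by linarith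
    then show ?thesis by (simp add: abs_square_le_1)
  qed
  have "v \<bullet> (M *\<^sub>v v) = (\<Sum>i<p. \<Sum>j<p. v $ i * (M $$ (i, j) * v $ j))"
    using M v by (simp add: scalar_prod_def lessThan_atLeast0 sum_distrib_left)
  also have "\<bar>\<dots>\<bar> \<le> (\<Sum>i<p. \<Sum>j<p. \<bar>v $ i * (M $$ (i, j) * v $ j)\<bar>)"
    by (intro order_trans[OF sum_abs] sum_mono sum_abs)
  also have "\<dots> \<le> (\<Sum>i<p. \<Sum>j<p. \<bar>M $$ (i, j)\<bar>)"
  proof (intro sum_mono)
    fix i j assume ij: "i \<in> {..<p}" "j \<in> {..<p}"
    have "\<bar>v $ i\<bar> * (\<bar>M $$ (i, j)\<bar> * \<bar>v $ j\<bar>) \<le> 1 * (\<bar>M $$ (i, j)\<bar> * 1)"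
      using le1 ij by (intro mult_mono) auto
    then show "\<bar>v $ i * (M $$ (i, j) * v $ j)\<bar> \<le> \<bar>M $$ (i, j)\<bar>" by (simp add: abs_mult)
  qed
  finally show ?thesis .
qed

text \<open>By symmetry the forms at v and at a net point x differ by the bilinear value at v - x
  and v + x, of norms at most 1/10 and 2. The supremum q therefore satisfies q \<le> K + q / 5, and
  since q is finite this can be solved for q.\<close>

lemma quadratic_bound_from_net:
  fixes M :: "real mat"
  assumes M: "M \<in> carrier_mat p p" "M\<^sup>T = M" and D: "D \<subseteq> {..<p}" "D \<noteq> {}"
    and K: "\<And>x. x \<in> net p D \<Longrightarrow> \<bar>x \<bullet> (M *\<^sub>v x)\<bar> \<le> K"
    and v: "v \<in> supp_in p D"
  shows "\<bar>v \<bullet> (M *\<^sub>v v)\<bar> \<le> K / (4 / 5) * (v \<bullet> v)"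
proof -
  let ?X = "{v \<in> supp_in p D. v \<bullet> v \<le> 1}"
  define q where "q = (SUP v\<in>?X. \<bar>v \<bullet> (M *\<^sub>v v)\<bar>)"
  have bdd: "bdd_above ((\<lambda>v. \<bar>v \<bullet> (M *\<^sub>v v)\<bar>) ` ?X)"
    using quadratic_form_bounded[OF M(1)] by (intro bdd_aboveI2) (auto dest: supp_inD)
  have q1: "\<bar>v \<bullet> (M *\<^sub>v v)\<bar> \<le> q" if "v \<in> supp_in p D" "v \<bullet> v \<le> 1" for v
    unfolding q_def using that by (intro cSUP_upper[OF _ bdd]) auto
  have q2: "\<bar>v \<bullet> (M *\<^sub>v v)\<bar> \<le> q * (v \<bullet> v)" if v: "v \<in> supp_in p D" for v
  proof (cases "v \<bullet> v = 0")
    case True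
    then have "v = 0\<^sub>v p" using supp_inD[OF v] scalar_prod_self_eq_0 by blast
    then show ?thesis using M by simp
  next
    case False
    then have pos: "vnorm v > 0" using scalar_prod_self_nonneg[of v] by (auto simp: vnorm_def)
    let ?y = "(1 / vnorm v) \<cdot>\<^sub>v v"
    have "?y \<bullet> ?y = 1" using pos by (simp add: vnorm_sq[symmetric] vnorm_smult power2_eq_square)
    then have "\<bar>?y \<bullet> (M *\<^sub>v ?y)\<bar> \<le> q" by (intro q1 supp_in_smult v) simp
    also have "?y \<bullet> (M *\<^sub>v ?y) = v \<bullet> (M *\<^sub>v v) / (v \<bullet> v)"
      using supp_inD[OF v] M by (simp add: mult_mat_vec[of _ p p] vnorm_sq[symmetric] power2_eq_square)
    finally show ?thesis using pos by (simp add: abs_mult field_simps vnorm_sq[symmetric])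
  qed
  have "0\<^sub>v p \<in> ?X" by (simp add: supp_in_def)
  then have ne: "?X \<noteq> {}" and q0: "q \<ge> 0" using q1[of "0\<^sub>v p"] M by auto
  have "q \<le> K + q / 5"
    unfolding q_def
  proof (rule cSUP_least[OF ne])
    fix v assume "v \<in> ?X"
    then have v: "v \<in> supp_in p D" "v \<bullet> v \<le> 1" by auto
    obtain x where x: "x \<in> net p D" "(v - x) \<bullet> (v - x) \<le> 1 / 100"
      using net_approx[OF v D] by blast
    have xs: "x \<in> supp_in p D" by (rule net_supp_in[OF x(1)])
    note c = supp_inD[OF v(1)] supp_inD[OF xs]
    have Mc: "M *\<^sub>v x \<in> carrier_vec p" "M *\<^sub>v v \<in> carrier_vec p"
      by (intro mult_mat_vec_carrier[OF M(1)] c)+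
    have sym: "x \<bullet> (M *\<^sub>v v) = v \<bullet> (M *\<^sub>v x)"
      using scalar_prod_mult_mat_vec[OF M(1) c(2,1)] M(2) comm_scalar_prod[OF c(1) Mc(1)] by simp
    have "vnorm (v - x) \<le> sqrt (1 / 100)" unfolding vnorm_def using x(2) by (rule real_sqrt_le_mono)
    then have n1: "vnorm (v - x) \<le> 1 / 10" by (simp add: real_sqrt_divide)
    have "(v + x) \<bullet> (v + x) + (v - x) \<bullet> (v - x) = 2 * (v \<bullet> v) + 2 * (x \<bullet> x)"
      using c comm_scalar_prod[OF c]
      by (simp add: add_scalar_prod_distrib[of _ p] scalar_prod_add_distrib[of _ p] minus_scalar_prod_distrib[of _ p] scalar_prod_minus_distrib[of _ p])
    then have "(v + x) \<bullet> (v + x) \<le> 4"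
      using v(2) net_norm_le_1[OF x(1) D(1)] scalar_prod_self_nonneg[of "v - x"] by linarith
    then have "vnorm (v + x) \<le> sqrt 4" unfolding vnorm_def by (rule real_sqrt_le_mono)
    then have n2: "vnorm (v + x) \<le> 2" by simp
    have "v \<bullet> (M *\<^sub>v v) = x \<bullet> (M *\<^sub>v x) + (v - x) \<bullet> (M *\<^sub>v (v + x))"
      using c Mc M sym by (simp add: mult_add_distrib_mat_vec[of _ p p] minus_scalar_prod_distrib[of _ p] scalar_prod_add_distrib[of _ p])
    then have "\<bar>v \<bullet> (M *\<^sub>v v)\<bar> \<le> \<bar>x \<bullet> (M *\<^sub>v x)\<bar> + \<bar>(v - x) \<bullet> (M *\<^sub>v (v + x))\<bar>" by linarith
    also have "\<bar>(v - x) \<bullet> (M *\<^sub>v (v + x))\<bar> \<le> q * vnorm (v - x) * vnorm (v + x)"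
      by (rule bilinear_bound_from_quadratic[OF M q2 supp_in_diff[OF v(1) xs] supp_in_add[OF v(1) xs]])
    also have "\<dots> \<le> q * (1 / 10) * 2"
      using n1 n2 q0 vnorm_nonneg by (intro mult_mono) auto
    finally show "\<bar>v \<bullet> (M *\<^sub>v v)\<bar> \<le> K + (SUP v\<in>?X. \<bar>v \<bullet> (M *\<^sub>v v)\<bar>) / 5"
      using K[OF x(1)] unfolding q_def by linarith
  qed
  then have "q \<le> K / (4 / 5)" by simp
  then have "q * (v \<bullet> v) \<le> K / (4 / 5) * (v \<bullet> v)" by (intro mult_right_mono scalar_prod_self_nonneg)
  then show ?thesis using q2[OF v] by linarith
qed

section \<open>Gaussian quadratic forms\<close>

abbreviation gauss :: "real measure" where
  "gauss \<equiv> density lborel (\<lambda>x. ennreal (std_normal_density x))"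

lemma prob_space_gauss: "prob_space gauss"
  by (rule prob_space_normal_density) simp

lemma distributed_gauss_component:
  assumes "j \<in> I"
  shows "distributed (\<Pi>\<^sub>M i\<in>I. gauss) lborel (\<lambda>z. z j) std_normal_density"
proof -
  have "distr (\<Pi>\<^sub>M i\<in>I. gauss) lborel (\<lambda>z. z j) = distr (\<Pi>\<^sub>M i\<in>I. gauss) gauss (\<lambda>z. z j)"
    by (intro distr_cong) auto
  also have "\<dots> = gauss"
    by (rule distr_PiM_component[OF prob_space_gauss assms])
  finally show ?thesis using assms by (auto simp: distributed_def)
qed

lemma distributed_gauss_linear_form:
  fixes v :: "nat \<Rightarrow> real"
  assumes v: "(\<Sum>j<p. (v j)\<^sup>2) = 1"
  shows "distributed (\<Pi>\<^sub>M i\<in>{..<p}. gauss) lborel (\<lambda>z. \<Sum>j<p. v j * z j) std_normal_density"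
proof -
  let ?M = "\<Pi>\<^sub>M i\<in>{..<p}. gauss"
  interpret M: prob_space ?M by (rule prob_space_PiM) (rule prob_space_gauss)
  \<comment> \<open>Zero coefficients are dropped because a normal density requires a positive
    standard deviation.\<close>
  define J where "J = {j\<in>{..<p}. v j \<noteq> 0}"
  have J: "finite J" "J \<subseteq> {..<p}" by (auto simp: J_def)
  have "J \<noteq> {}"
  proof
    assume "J = {}"
    then have "(\<Sum>j<p. (v j)\<^sup>2) = 0" by (intro sum.neutral) (auto simp: J_def)
    then show False using v by simp
  qed
  have "M.indep_vars (\<lambda>_. gauss) (\<lambda>i z. z i) {..<p}"
  proof (subst M.indep_vars_iff_distr_eq_PiM')
    show "{..<p} \<noteq> {}" using \<open>J \<noteq> {}\<close> J(2) by auto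
    have "distr ?M ?M (\<lambda>x. \<lambda>i\<in>{..<p}. x i) = distr ?M ?M (\<lambda>x. x)"
      by (intro distr_cong) (auto simp: space_PiM PiE_def extensional_restrict)
    also have "\<dots> = ?M" by (rule distr_id)
    also have "\<dots> = (\<Pi>\<^sub>M i\<in>{..<p}. distr ?M gauss (\<lambda>x. x i))"
      by (intro PiM_cong) (auto simp: distr_PiM_component[OF prob_space_gauss])
    finally show "distr ?M ?M (\<lambda>x. \<lambda>i\<in>{..<p}. x i) = (\<Pi>\<^sub>M i\<in>{..<p}. distr ?M gauss (\<lambda>x. x i))" .
  qed (auto intro!: measurable_component_singleton)
  then have "M.indep_vars (\<lambda>_. gauss) (\<lambda>i z. z i) J" using J(2) by (rule M.indep_vars_subset)
  then have ind: "M.indep_vars (\<lambda>_. borel) (\<lambda>i z. v i * z i) J"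
    by (rule M.indep_vars_compose2) simp
  have dist: "distributed ?M lborel (\<lambda>z. v i * z i) (normal_density 0 \<bar>v i\<bar>)" if "i \<in> J" for i
    using M.normal_density_affine[OF distributed_gauss_component[of i "{..<p}"], of "v i" 0] that
    by (simp add: J_def)
  have "distributed ?M lborel (\<lambda>z. \<Sum>i\<in>J. v i * z i)
     (normal_density (\<Sum>i\<in>J. 0) (sqrt (\<Sum>i\<in>J. (\<bar>v i\<bar>)\<^sup>2)))"
    using J \<open>J \<noteq> {}\<close> ind dist by (intro M.sum_indep_normal) (auto simp: J_def)
  moreover have "(\<Sum>i\<in>J. v i * z i) = (\<Sum>j<p. v j * z j)" for z :: "nat \<Rightarrow> real"
    by (intro sum.mono_neutral_left) (auto simp: J_def)
  moreover have "(\<Sum>i\<in>J. (\<bar>v i\<bar>)\<^sup>2) = (\<Sum>j<p. (v j)\<^sup>2)"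
    by (simp, intro sum.mono_neutral_left) (auto simp: J_def)
  ultimately show ?thesis using v by simp
qed

text \<open>The tilted Gaussian density is a multiple of the centred normal density with variance 1
  / (1 - 2 l). This is the moment generating function of a chi-square variable with one degree of
  freedom.\<close>

lemma nn_integral_exp_square_std_normal:
  fixes l :: real
  assumes l: "l < 1 / 2"
  shows "(\<integral>\<^sup>+y. ennreal (std_normal_density y) * ennreal (exp (l * y\<^sup>2)) \<partial>lborel) = ennreal (1 / sqrt (1 - 2 * l))"
proof -
  define s where "s = 1 / sqrt (1 - 2 * l)"
  have pos: "1 - 2 * l > 0" using l by simp
  have s: "s > 0" using pos by (simp add: s_def)
  have s2: "s\<^sup>2 = 1 / (1 - 2 * l)" using pos by (simp add: s_def power_divide)
  have "std_normal_density y * exp (l * y\<^sup>2) = s * normal_density 0 s y" for y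
  proof -
    have "normal_density 0 s y = exp (- y\<^sup>2 * (1 - 2 * l) / 2) / (sqrt (2 * pi) * s)"
      using s pos by (simp add: normal_density_def real_sqrt_mult s2 real_sqrt_divide) (simp add: s_def)
    moreover have "exp (- y\<^sup>2 * (1 - 2 * l) / 2) = exp (- y\<^sup>2 / 2) * exp (l * y\<^sup>2)"
      by (simp flip: exp_add add: field_simps)
    ultimately show ?thesis using s by (simp add: std_normal_density_def)
  qed
  then have "(\<integral>\<^sup>+y. ennreal (std_normal_density y) * ennreal (exp (l * y\<^sup>2)) \<partial>lborel)
      = (\<integral>\<^sup>+y. ennreal s * ennreal (normal_density 0 s y) \<partial>lborel)"
    using s by (intro nn_integral_cong) (simp flip: ennreal_mult)
  also have "\<dots> = ennreal s * (\<integral>\<^sup>+y. ennreal (normal_density 0 s y) \<partial>lborel)"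
    by (rule nn_integral_cmult) simp
  also have "(\<integral>\<^sup>+y. ennreal (normal_density 0 s y) \<partial>lborel) = 1"
    using prob_space.emeasure_space_1[OF prob_space_normal_density[OF s, of 0]]
    by (simp add: emeasure_density)
  finally show ?thesis by (simp add: s_def)
qed

section \<open>Sums of squares of linear forms under the data law\<close>

lemma measurable_mvn_map:
  "(\<lambda>z. \<lambda>i\<in>{..<p}. \<Sum>j<p. R $$ (i, j) * z j)
     \<in> measurable (\<Pi>\<^sub>M i\<in>{..<p}. gauss) (\<Pi>\<^sub>M i\<in>{..<p}. (borel :: real measure))"
  by (intro measurable_restrict borel_measurable_sum borel_measurable_times) auto

lemma sets_mvn [measurable_cong]: "sets (mvn p Sig) = sets (\<Pi>\<^sub>M i\<in>{..<p}. borel)"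
  by (simp add: mvn_def)

lemma prob_space_mvn: "prob_space (mvn p Sig)"
  unfolding mvn_def
  by (rule prob_space.prob_space_distr[OF prob_space_PiM measurable_mvn_map]) (rule prob_space_gauss)

lemma sets_data_law: "sets (data_law n p Sig) = sets (data_space n p)"
  unfolding data_law_def data_space_def by (intro sets_PiM_cong sets_mvn) simp

lemma space_data_law: "space (data_law n p Sig) = space (data_space n p)"
  by (rule sets_eq_imp_space_eq[OF sets_data_law])

lemma prob_space_data_law: "prob_space (data_law n p Sig)"
  unfolding data_law_def by (rule prob_space_PiM) (rule prob_space_mvn)

text \<open>Equal to w' Sigma w for positive semidefinite Sigma. Stated through
  \<open>psd_sqrt\<close>, it is the variance of the linear form under \<open>mvn\<close> for any
  matrix \<open>Sig\<close>, so the tail bounds below can be proved without reference to the spiked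
  model.\<close>

abbreviation pop_variance :: "nat \<Rightarrow> real mat \<Rightarrow> (nat \<Rightarrow> real) \<Rightarrow> real" where
  "pop_variance p Sig w \<equiv> \<Sum>j<p. (\<Sum>i<p. w i * psd_sqrt p Sig $$ (i, j))\<^sup>2"

abbreviation sum_squares :: "nat \<Rightarrow> nat \<Rightarrow> (nat \<Rightarrow> real) \<Rightarrow> (nat \<Rightarrow> nat \<Rightarrow> real) \<Rightarrow> real" where
  "sum_squares n p w x \<equiv> \<Sum>t<n. (\<Sum>i<p. w i * x t i)\<^sup>2"

lemma nn_integral_mvn_exp_square:
  assumes w: "pop_variance p Sig w = 1" and l: "l < 1 / 2"
  shows "(\<integral>\<^sup>+x. ennreal (exp (l * (\<Sum>i<p. w i * x i)\<^sup>2)) \<partial>mvn p Sig) = ennreal (1 / sqrt (1 - 2 * l))"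
proof -
  let ?M = "\<Pi>\<^sub>M i\<in>{..<p}. gauss"
  let ?R = "psd_sqrt p Sig"
  let ?v = "\<lambda>j. \<Sum>i<p. w i * ?R $$ (i, j)"
  have "(\<integral>\<^sup>+x. ennreal (exp (l * (\<Sum>i<p. w i * x i)\<^sup>2)) \<partial>mvn p Sig)
      = (\<integral>\<^sup>+z. ennreal (exp (l * (\<Sum>i<p. w i * (\<lambda>i\<in>{..<p}. \<Sum>j<p. ?R $$ (i, j) * z j) i)\<^sup>2)) \<partial>?M)"
    unfolding mvn_def by (rule nn_integral_distr[OF measurable_mvn_map]) measurable
  also have "\<dots> = (\<integral>\<^sup>+z. ennreal (exp (l * (\<Sum>j<p. ?v j * z j)\<^sup>2)) \<partial>?M)"
  proof (intro nn_integral_cong)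
    fix z :: "nat \<Rightarrow> real"
    have "(\<Sum>i<p. w i * (\<lambda>i\<in>{..<p}. \<Sum>j<p. ?R $$ (i, j) * z j) i) = (\<Sum>i<p. \<Sum>j<p. w i * ?R $$ (i, j) * z j)"
      by (intro sum.cong) (auto simp: sum_distrib_left mult.assoc)
    also have "\<dots> = (\<Sum>j<p. ?v j * z j)"
      by (subst sum.swap) (simp add: sum_distrib_right)
    finally show "ennreal (exp (l * (\<Sum>i<p. w i * (\<lambda>i\<in>{..<p}. \<Sum>j<p. ?R $$ (i, j) * z j) i)\<^sup>2))
      = ennreal (exp (l * (\<Sum>j<p. ?v j * z j)\<^sup>2))" by simp
  qed
  also have "\<dots> = (\<integral>\<^sup>+y. ennreal (std_normal_density y) * ennreal (exp (l * y\<^sup>2)) \<partial>lborel)"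
    by (rule distributed_nn_integral[OF distributed_gauss_linear_form[OF w], symmetric]) measurable
  finally show ?thesis using nn_integral_exp_square_std_normal[OF l] by simp
qed

lemma nn_integral_data_law_exp_sum_squares:
  assumes w: "pop_variance p Sig w = 1" and l: "l < 1 / 2"
  shows "(\<integral>\<^sup>+x. ennreal (exp (l * sum_squares n p w x)) \<partial>data_law n p Sig)
     = ennreal ((1 / sqrt (1 - 2 * l)) ^ n)"
proof -
  interpret P: product_sigma_finite "\<lambda>_. mvn p Sig"
    using prob_space_mvn by (simp add: product_sigma_finite_def prob_space_imp_sigma_finite)
  have "(\<integral>\<^sup>+x. ennreal (exp (l * sum_squares n p w x)) \<partial>data_law n p Sig)
     = (\<integral>\<^sup>+x. (\<Prod>t\<in>{..<n}. ennreal (exp (l * (\<Sum>i<p. w i * x t i)\<^sup>2))) \<partial>data_law n p Sig)"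
    by (simp add: exp_sum sum_distrib_left prod_ennreal)
  also have "\<dots> = (\<Prod>t\<in>{..<n}. \<integral>\<^sup>+x. ennreal (exp (l * (\<Sum>i<p. w i * x i)\<^sup>2)) \<partial>mvn p Sig)"
    unfolding data_law_def by (rule P.product_nn_integral_prod) measurable
  also have "\<dots> = ennreal ((1 / sqrt (1 - 2 * l)) ^ n)"
    using l by (simp add: nn_integral_mvn_exp_square[OF w l] ennreal_power)
  finally show ?thesis .
qed

section \<open>Chi-square tails\<close>

lemma ln_one_plus_cubic_bound:
  fixes x :: real
  assumes "0 \<le> x"
  shows "ln (1 + x) \<le> x - x\<^sup>2 / 2 + x ^ 3 / 3"
proof -
  let ?f = "\<lambda>x::real. x - x\<^sup>2 / 2 + x ^ 3 / 3 - ln (1 + x)"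
  have "?f 0 \<le> ?f x"
  proof (rule DERIV_nonneg_imp_nondecreasing[OF assms])
    fix y :: real assume y: "0 \<le> y" "y \<le> x"
    have "(?f has_real_derivative (1 - y + y\<^sup>2 - 1 / (1 + y))) (at y)"
      using y by (auto intro!: derivative_eq_intros simp: field_simps power2_eq_square)
    moreover have "1 - y + y\<^sup>2 - 1 / (1 + y) = y ^ 3 / (1 + y)"
      using y by (simp add: field_simps power2_eq_square power3_eq_cube)
    ultimately show "\<exists>z. (?f has_real_derivative z) (at y) \<and> 0 \<le> z" using y by auto
  qed
  then show ?thesis by simp
qed

lemma ln_one_minus_quadratic_bound:
  fixes x :: real
  assumes "0 \<le> x" "x < 1"
  shows "ln (1 - x) \<le> - x - x\<^sup>2 / 2"
proof -
  let ?f = "\<lambda>x::real. - x - x\<^sup>2 / 2 - ln (1 - x)"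
  have "?f 0 \<le> ?f x"
  proof (rule DERIV_nonneg_imp_nondecreasing[OF assms(1)])
    fix y :: real assume y: "0 \<le> y" "y \<le> x"
    have "(?f has_real_derivative (- 1 - y + 1 / (1 - y))) (at y)"
      using y assms by (auto intro!: derivative_eq_intros simp: field_simps)
    moreover have "- 1 - y + 1 / (1 - y) = y\<^sup>2 / (1 - y)"
      using y assms by (simp add: field_simps power2_eq_square)
    ultimately show "\<exists>z. (?f has_real_derivative z) (at y) \<and> 0 \<le> z" using y assms by auto
  qed
  then show ?thesis by simp
qed

lemma inverse_sqrt_power_eq_exp:
  fixes a :: real assumes "a > 0"
  shows "(1 / sqrt a) ^ n = exp (- real n * ln a / 2)"
proof -
  have "1 / sqrt a = exp (- ln a / 2)"
    using assms by (simp add: exp_minus ln_sqrt[symmetric] inverse_eq_divide)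
  then show ?thesis by (simp flip: exp_of_nat_mult)
qed

lemma measurable_linear_form_data [measurable]:
  assumes "t < n"
  shows "(\<lambda>x. \<Sum>i<p. w i * x t i) \<in> borel_measurable (data_space n p)"
proof -
  have [measurable]: "(\<lambda>x. x t) \<in> measurable (data_space n p) (\<Pi>\<^sub>M j\<in>{..<p}. (borel :: real measure))"
    unfolding data_space_def using assms by (intro measurable_component_singleton) simp
  show ?thesis by measurable
qed

lemma measurable_sum_squares_data [measurable]:
  "(\<lambda>x. sum_squares n p w x) \<in> borel_measurable (data_space n p)"
  by (intro borel_measurable_sum borel_measurable_power measurable_linear_form_data) auto

text \<open>Here s is the optimal Chernoff parameter, with 1 - 2 s = 1 / c. Its sign is that of c -
  1, and keeping the factor s in the event lets one statement cover the upper tail (c > 1) and the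
  lower tail (c < 1).\<close>

lemma chi_square_chernoff:
  assumes w: "pop_variance p Sig w = 1" and c: "c > 0"
  defines "s \<equiv> (c - 1) / (2 * c)"
  shows "measure (data_law n p Sig) {x \<in> space (data_space n p).
      s * sum_squares n p w x \<ge> s * (real n * c)} \<le> exp (- (real n / 2) * (c - 1 - ln c))"
proof -
  let ?M = "data_law n p Sig"
  let ?Q = "\<lambda>x. sum_squares n p w x"
  interpret prob_space ?M by (rule prob_space_data_law)
  have [measurable_cong]: "sets ?M = sets (data_space n p)" by (rule sets_data_law)
  have meas [measurable]: "?Q \<in> borel_measurable ?M"
    using measurable_sum_squares_data[of w p n] by (simp cong: measurable_cong_sets)
  have s: "s < 1 / 2" "1 - 2 * s = 1 / c" using c by (auto simp: s_def field_simps)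
  have "emeasure ?M {x \<in> space ?M. s * ?Q x \<ge> s * (real n * c)}
      \<le> ennreal (exp (- 1 * (s * (real n * c)))) * (\<integral>\<^sup>+x. ennreal (exp (1 * (s * ?Q x))) * indicator (space ?M) x \<partial>?M)"
    by (intro Chernoff_ineq_nn_integral_ge) auto
  also have "(\<integral>\<^sup>+x. ennreal (exp (1 * (s * ?Q x))) * indicator (space ?M) x \<partial>?M) = (\<integral>\<^sup>+x. ennreal (exp (s * ?Q x)) \<partial>?M)"
    by (intro nn_integral_cong) simp
  also have "\<dots> = ennreal (exp (- real n * ln (1 / c) / 2))"
    using nn_integral_data_law_exp_sum_squares[OF w s(1)] c unfolding s(2)
    by (simp add: inverse_sqrt_power_eq_exp del: real_sqrt_divide)
  also have "ennreal (exp (- 1 * (s * (real n * c)))) * \<dots> = ennreal (exp (- (real n / 2) * (c - 1 - ln c)))"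
    using c by (simp flip: ennreal_mult exp_add add: s_def ln_div field_simps)
  finally show ?thesis by (simp add: emeasure_eq_measure space_data_law)
qed

lemma chi_square_concentration_unit:
  assumes w: "pop_variance p Sig w = 1"
    and x: "0 < y" "y < 1" and n: "n \<ge> 1"
  shows "measure (data_law n p Sig) {x \<in> space (data_space n p).
      \<bar>sum_squares n p w x / real n - 1\<bar> \<ge> y} \<le> 2 * exp (- real n * y\<^sup>2 / 4 * (1 - 2 * y / 3))"
proof -
  let ?M = "data_law n p Sig"
  let ?Q = "\<lambda>x. sum_squares n p w x"
  let ?b = "exp (- real n * y\<^sup>2 / 4 * (1 - 2 * y / 3))"
  have beq: "- real n * y\<^sup>2 / 4 * (1 - 2 * y / 3) = - ((real n / 2) * (y\<^sup>2 / 2 * (1 - 2 * y / 3)))"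
    by simp
  interpret prob_space ?M by (rule prob_space_data_law)
  have [measurable_cong]: "sets ?M = sets (data_space n p)" by (rule sets_data_law)
  have sp: "space ?M = space (data_space n p)" by (rule space_data_law)
  have meas [measurable]: "?Q \<in> borel_measurable ?M"
    using measurable_sum_squares_data[of w p n] by (simp cong: measurable_cong_sets)
  have up: "prob {x \<in> space ?M. ?Q x \<ge> real n * (1 + y)} \<le> ?b"
  proof -
    have "(1 + y - 1) / (2 * (1 + y)) > 0" and c: "1 + y > 0" using x by auto
    then have "prob {x \<in> space ?M. ?Q x \<ge> real n * (1 + y)} \<le> exp (- (real n / 2) * (1 + y - 1 - ln (1 + y)))"
      using chi_square_chernoff[OF w c, of n] by (simp only: sp mult_le_cancel_left_pos)
    then have "prob {x \<in> space ?M. ?Q x \<ge> real n * (1 + y)} \<le> exp (- (real n / 2) * (y - ln (1 + y)))" by simp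
    \<comment> \<open>The cubic term of the logarithm bound is the source of the factor 1 - 2 y / 3
      in the exponent.\<close>
    moreover have "y - ln (1 + y) \<ge> y\<^sup>2 / 2 * (1 - 2 * y / 3)"
      using ln_one_plus_cubic_bound[of y] x by (simp add: field_simps power2_eq_square power3_eq_cube)
    then have "(real n / 2) * (y - ln (1 + y)) \<ge> (real n / 2) * (y\<^sup>2 / 2 * (1 - 2 * y / 3))"
      by (rule mult_left_mono) simp
    then have "exp (- (real n / 2) * (y - ln (1 + y))) \<le> ?b" unfolding beq by simp
    ultimately show ?thesis by linarith
  qed
  have lo: "prob {x \<in> space ?M. ?Q x \<le> real n * (1 - y)} \<le> ?b"
  proof -
    have "(1 - y - 1) / (2 * (1 - y)) < 0" using x by (simp add: divide_neg_pos)
    then have "prob {x \<in> space ?M. ?Q x \<le> real n * (1 - y)} \<le> exp (- (real n / 2) * (1 - y - 1 - ln (1 - y)))"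
      using chi_square_chernoff[OF w, of "1 - y" n] x by (simp only: sp mult_le_cancel_left_neg diff_gt_0_iff_gt)
    \<comment> \<open>The lower tail has the full exponent y^2 / 2; it is weakened to share one
      bound with the upper tail.\<close>
    moreover have "y\<^sup>2 / 2 * (1 - 2 * y / 3) \<le> y\<^sup>2 / 2 * 1" using x by (intro mult_left_mono) auto
    then have "1 - y - 1 - ln (1 - y) \<ge> y\<^sup>2 / 2 * (1 - 2 * y / 3)"
      using ln_one_minus_quadratic_bound[of y] x by linarith
    then have "(real n / 2) * (1 - y - 1 - ln (1 - y)) \<ge> (real n / 2) * (y\<^sup>2 / 2 * (1 - 2 * y / 3))"
      by (rule mult_left_mono) simp
    then have "exp (- (real n / 2) * (1 - y - 1 - ln (1 - y))) \<le> ?b" unfolding beq by simp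
    ultimately show ?thesis by linarith
  qed
  have "{x \<in> space (data_space n p). \<bar>?Q x / real n - 1\<bar> \<ge> y}
      = {x \<in> space ?M. ?Q x \<ge> real n * (1 + y)} \<union> {x \<in> space ?M. ?Q x \<le> real n * (1 - y)}"
    using n unfolding sp by (auto simp: abs_if field_simps)
  moreover have "prob ({x \<in> space ?M. ?Q x \<ge> real n * (1 + y)} \<union> {x \<in> space ?M. ?Q x \<le> real n * (1 - y)}) \<le>
     prob {x \<in> space ?M. ?Q x \<ge> real n * (1 + y)} + prob {x \<in> space ?M. ?Q x \<le> real n * (1 - y)}"
    by (intro measure_Un_le) measurable
  ultimately show ?thesis using up lo by simp
qed

text \<open>Net points lie in the ball and not on the sphere. For variance s \<le> 1 an absolute
  deviation above y is a relative deviation above y as well, so normalizing reduces to unit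
  variance.\<close>

lemma chi_square_concentration:
  assumes w: "pop_variance p Sig w = s" and s: "0 < s" "s \<le> 1"
    and x: "0 < y" "y < 1" and n: "n \<ge> 1"
  shows "measure (data_law n p Sig) {x \<in> space (data_space n p).
      \<bar>sum_squares n p w x / real n - s\<bar> > y} \<le> 2 * exp (- real n * y\<^sup>2 / 4 * (1 - 2 * y / 3))"
proof -
  let ?M = "data_law n p Sig"
  let ?E = "\<lambda>w s. {x \<in> space (data_space n p). \<bar>sum_squares n p w x / real n - s\<bar> \<ge> y}"
  let ?F = "{x \<in> space (data_space n p). \<bar>sum_squares n p w x / real n - s\<bar> > y}"
  interpret prob_space ?M by (rule prob_space_data_law)
  have [measurable_cong]: "sets ?M = sets (data_space n p)" by (rule sets_data_law)
  have meas [measurable]: "(\<lambda>x. sum_squares n p w x) \<in> borel_measurable ?M" for w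
    using measurable_sum_squares_data[of w p n] by (simp cong: measurable_cong_sets)
  show ?thesis
  proof -
    define u where "u i = w i / sqrt s" for i
    have "(\<Sum>i<p. u i * psd_sqrt p Sig $$ (i, j)) = (\<Sum>i<p. w i * psd_sqrt p Sig $$ (i, j)) / sqrt s" for j
      by (simp add: u_def sum_divide_distrib)
    then have "pop_variance p Sig u = s / s"
      using s by (simp add: power_divide w flip: sum_divide_distrib)
    then have u1: "pop_variance p Sig u = 1" using s by simp
    have ui: "(\<Sum>i<p. u i * x i) = (\<Sum>i<p. w i * x i) / sqrt s" for x
      by (simp add: u_def sum_divide_distrib)
    have uq: "sum_squares n p u x = sum_squares n p w x / s" for x
      using s by (simp add: ui power_divide flip: sum_divide_distrib)
    have "?F \<subseteq> ?E u 1"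
    proof safe
      fix x assume "\<bar>sum_squares n p w x / real n - s\<bar> > y"
      also have "sum_squares n p w x / real n - s
          = s * (sum_squares n p u x / real n - 1)"
        unfolding uq using s by (simp add: field_simps)
      also have "\<bar>\<dots>\<bar> = s * \<bar>sum_squares n p u x / real n - 1\<bar>"
        using s by (simp add: abs_mult)
      also have "\<dots> \<le> 1 * \<bar>sum_squares n p u x / real n - 1\<bar>"
        using s(2) by (intro mult_right_mono) auto
      finally show "y \<le> \<bar>sum_squares n p u x / real n - 1\<bar>" by simp
    qed
    moreover have "?E u 1 \<in> sets ?M"
      unfolding space_data_law[of n p Sig, symmetric] by measurable
    ultimately have "prob ?F \<le> prob (?E u 1)" by (intro finite_measure_mono)
    also have "\<dots> \<le> 2 * exp (- real n * y\<^sup>2 / 4 * (1 - 2 * y / 3))"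
      by (rule chi_square_concentration_unit[OF u1 x n])
    finally show ?thesis .
  qed
qed

section \<open>Spectral norms and submatrices\<close>

lemma Cauchy_Schwarz_vec:
  fixes u v :: "real Matrix.vec"
  assumes "u \<in> carrier_vec n" "v \<in> carrier_vec n"
  shows "\<bar>u \<bullet> v\<bar> \<le> vnorm u * vnorm v"
proof -
  have "(u \<bullet> v)\<^sup>2 \<le> (u \<bullet> u) * (v \<bullet> v)"
    using Cauchy_Schwarz_ineq_sum[of "\<lambda>i. u $ i" "\<lambda>i. v $ i" "{0..<n}"] assms
    by (simp add: scalar_prod_def power2_eq_square)
  then have "sqrt ((u \<bullet> v)\<^sup>2) \<le> sqrt ((u \<bullet> u) * (v \<bullet> v))" by (rule real_sqrt_le_mono)
  then show ?thesis by (simp add: vnorm_def real_sqrt_mult)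
qed

text \<open>The squared length of A v is the quadratic form of A'A, which the entries bound.
  Boundedness is what gives the real supremum in \<open>spectral_norm\<close> its meaning.\<close>

lemma bdd_above_spectral_norm:
  fixes A :: "real mat"
  shows "bdd_above ((\<lambda>v. vnorm (A *\<^sub>v v)) ` {v \<in> carrier_vec (dim_col A). vnorm v \<le> 1})"
proof (rule bdd_aboveI2)
  fix v assume "v \<in> {v \<in> carrier_vec (dim_col A). vnorm v \<le> 1}"
  then have v: "v \<in> carrier_vec (dim_col A)" "vnorm v \<le> 1" by auto
  let ?q = "\<Sum>i<dim_col A. \<Sum>j<dim_col A. \<bar>(A\<^sup>T * A) $$ (i, j)\<bar>"
  have A: "A \<in> carrier_mat (dim_row A) (dim_col A)" by simp
  have "(A *\<^sub>v v) \<bullet> (A *\<^sub>v v) = (A\<^sup>T *\<^sub>v (A *\<^sub>v v)) \<bullet> v"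
    using scalar_prod_mult_mat_vec[OF A mult_mat_vec_carrier[OF A v(1)] v(1)] .
  also have "A\<^sup>T *\<^sub>v (A *\<^sub>v v) = (A\<^sup>T * A) *\<^sub>v v"
    by (rule assoc_mult_mat_vec[symmetric, of _ "dim_col A" "dim_row A" _ "dim_col A"]) (use v in auto)
  also have "\<dots> \<bullet> v = v \<bullet> \<dots>"
    by (rule comm_scalar_prod[of _ "dim_col A"]) (use v in \<open>auto intro!: mult_mat_vec_carrier[of _ "dim_col A" "dim_col A"]\<close>)
  also have "\<dots> \<le> ?q"
  proof (rule abs_le_D1, rule quadratic_form_bounded)
    show "v \<bullet> v \<le> 1" using power_le_one[OF vnorm_nonneg v(2), of 2] by (simp add: vnorm_sq)
  qed (use v in auto)
  finally show "vnorm (A *\<^sub>v v) \<le> sqrt ?q"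
    unfolding vnorm_def by (rule real_sqrt_le_mono)
qed

lemma vnorm_mult_le_spectral_norm:
  assumes "v \<in> carrier_vec (dim_col A)"
  shows "vnorm (A *\<^sub>v v) \<le> spectral_norm A * vnorm v"
proof (cases "vnorm v = 0")
  case True
  then have "v = 0\<^sub>v (dim_col A)" using assms scalar_prod_self_eq_0 by (simp add: vnorm_def)
  then have "A *\<^sub>v v = 0\<^sub>v (dim_row A)" by (intro eq_vecI) auto
  then show ?thesis using True by (simp add: vnorm_def)
next
  case False
  then have pos: "vnorm v > 0" using vnorm_nonneg[of v] by simp
  let ?y = "(1 / vnorm v) \<cdot>\<^sub>v v"
  have "vnorm (A *\<^sub>v ?y) \<le> spectral_norm A"
    unfolding spectral_norm_def using assms pos
    by (intro cSUP_upper bdd_above_spectral_norm) (auto simp: vnorm_smult)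
  also have "A *\<^sub>v ?y = (1 / vnorm v) \<cdot>\<^sub>v (A *\<^sub>v v)"
    using assms by (simp add: mult_mat_vec[of _ "dim_row A" "dim_col A"])
  finally show ?thesis using pos by (simp add: vnorm_smult field_simps)
qed

lemma quadratic_le_spectral_norm:
  fixes A :: "real mat"
  assumes A: "A \<in> carrier_mat n n" and v: "v \<in> carrier_vec n"
  shows "\<bar>v \<bullet> (A *\<^sub>v v)\<bar> \<le> spectral_norm A * (v \<bullet> v)"
proof -
  have "\<bar>v \<bullet> (A *\<^sub>v v)\<bar> \<le> vnorm v * vnorm (A *\<^sub>v v)"
    by (rule Cauchy_Schwarz_vec[OF v mult_mat_vec_carrier[OF A v]])
  also have "\<dots> \<le> vnorm v * (spectral_norm A * vnorm v)"
    using vnorm_mult_le_spectral_norm[of v A] A v by (intro mult_left_mono vnorm_nonneg) auto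
  also have "\<dots> = spectral_norm A * (v \<bullet> v)" by (simp flip: vnorm_sq add: power2_eq_square)
  finally show ?thesis .
qed

text \<open>Testing with u = A v yields the squared norm of A v on the left, and one factor
  cancels.\<close>

lemma spectral_norm_le_bilinear:
  fixes A :: "real mat"
  assumes A: "A \<in> carrier_mat m n" and K: "K \<ge> 0"
    and le: "\<And>u v. u \<in> carrier_vec m \<Longrightarrow> v \<in> carrier_vec n \<Longrightarrow> \<bar>u \<bullet> (A *\<^sub>v v)\<bar> \<le> K * vnorm u * vnorm v"
  shows "spectral_norm A \<le> K"
  unfolding spectral_norm_def
proof (rule cSUP_least)
  have "0\<^sub>v n \<in> {v \<in> carrier_vec (dim_col A). vnorm v \<le> 1}" using A by (simp add: vnorm_def)
  then show "{v \<in> carrier_vec (dim_col A). vnorm v \<le> 1} \<noteq> {}" by blast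
  fix v assume "v \<in> {v \<in> carrier_vec (dim_col A). vnorm v \<le> 1}"
  then have v: "v \<in> carrier_vec n" "vnorm v \<le> 1" using A by auto
  let ?u = "A *\<^sub>v v"
  have u: "?u \<in> carrier_vec m" by (rule mult_mat_vec_carrier[OF A v(1)])
  have "(vnorm ?u)\<^sup>2 \<le> K * vnorm ?u * vnorm v" using le[OF u v(1)] unfolding vnorm_sq by linarith
  also have "\<dots> \<le> K * vnorm ?u * 1"
    using v(2) K vnorm_nonneg by (intro mult_left_mono mult_nonneg_nonneg) auto
  finally have "vnorm ?u * vnorm ?u \<le> K * vnorm ?u" by (simp add: power2_eq_square)
  then show "vnorm ?u \<le> K" using vnorm_nonneg[of ?u] K
    by (cases "vnorm ?u = 0") auto
qed

lemma spectral_norm_symmetric_le: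
  fixes A :: "real mat"
  assumes A: "A \<in> carrier_mat n n" "A\<^sup>T = A" and K: "K \<ge> 0"
    and le: "\<And>v. v \<in> carrier_vec n \<Longrightarrow> \<bar>v \<bullet> (A *\<^sub>v v)\<bar> \<le> K * (v \<bullet> v)"
  shows "spectral_norm A \<le> K"
proof (rule spectral_norm_le_bilinear[OF A(1) K])
  fix u v :: "real Matrix.vec" assume "u \<in> carrier_vec n" "v \<in> carrier_vec n"
  then show "\<bar>u \<bullet> (A *\<^sub>v v)\<bar> \<le> K * vnorm u * vnorm v"
    by (intro bilinear_bound_from_quadratic[OF A, of "{..<n}"] le supp_in_full) (auto dest: supp_inD)
qed

section \<open>Submatrices and padded matrices as coordinate restrictions\<close>

definition sel :: "nat \<Rightarrow> nat set \<Rightarrow> real mat" where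
  "sel p D = Matrix.mat p (card D) (\<lambda>(i, j). if i = pick D j then 1 else 0)"

definition restr :: "nat \<Rightarrow> nat set \<Rightarrow> real Matrix.vec \<Rightarrow> real Matrix.vec" where
  "restr p D v = Matrix.vec p (\<lambda>i. if i \<in> D then v $ i else 0)"

lemma sel_carrier [simp]: "sel p D \<in> carrier_mat p (card D)"
  by (simp add: sel_def)

lemma bij_betw_pick:
  assumes "finite D"
  shows "bij_betw (pick D) {..<card D} D"
proof -
  have inj: "inj_on (pick D) {..<card D}"
    by (rule inj_on_inverseI[of _ "\<lambda>i. card {a \<in> D. a < i}"]) (simp add: card_pick_le)
  moreover have "pick D ` {..<card D} \<subseteq> D" using pick_in_set_le by blast
  ultimately have "pick D ` {..<card D} = D"
    using assms by (intro card_subset_eq) (auto simp: card_image)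
  then show ?thesis using inj by (simp add: bij_betw_def)
qed

lemma mult_sel_index:
  assumes D: "D \<subseteq> {..<p}" and u: "u \<in> carrier_vec (card D)"
  shows "i < p \<Longrightarrow> i \<notin> D \<Longrightarrow> (sel p D *\<^sub>v u) $ i = 0"
    and "j < card D \<Longrightarrow> (sel p D *\<^sub>v u) $ (pick D j) = u $ j"
proof -
  have fin: "finite D" using D finite_subset by blast
  note bij = bij_betw_pick[OF fin]
  have eq: "(sel p D *\<^sub>v u) $ i = (\<Sum>l<card D. (if i = pick D l then u $ l else 0))" if "i < p" for i
    using that u by (auto simp: sel_def scalar_prod_def lessThan_atLeast0 intro!: sum.cong)
  {
    assume i: "i < p" "i \<notin> D"
    have "pick D l \<noteq> i" if "l < card D" for l
      using bij that i by (metis bij_betw_apply lessThan_iff)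
    then show "(sel p D *\<^sub>v u) $ i = 0" unfolding eq[OF i(1)] by (intro sum.neutral) auto
  }
  {
    assume j: "j < card D"
    then have "pick D j < p" using bij D by (meson bij_betw_apply lessThan_iff subset_iff)
    then have "(sel p D *\<^sub>v u) $ pick D j = (\<Sum>l<card D. (if pick D j = pick D l then u $ l else 0))" by (rule eq)
    also have "\<dots> = (\<Sum>l<card D. if l = j then u $ j else 0)"
      using bij j by (intro sum.cong) (auto simp: bij_betw_def inj_on_def)
    finally show "(sel p D *\<^sub>v u) $ (pick D j) = u $ j" using j by simp
  }
qed

lemma sel_supp_in:
  assumes D: "D \<subseteq> {..<p}" and u: "u \<in> carrier_vec (card D)"
  shows "sel p D *\<^sub>v u \<in> supp_in p D"
  using mult_sel_index(1)[OF D u] mult_mat_vec_carrier[OF sel_carrier u] by (simp add: supp_in_def)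

lemma sel_isometry:
  assumes D: "D \<subseteq> {..<p}" and u: "u \<in> carrier_vec (card D)"
  shows "(sel p D *\<^sub>v u) \<bullet> (sel p D *\<^sub>v u) = u \<bullet> u"
proof -
  have fin: "finite D" using D finite_subset by blast
  let ?w = "sel p D *\<^sub>v u"
  have "?w \<bullet> ?w = (\<Sum>i\<in>D. ?w $ i * ?w $ i)"
    by (rule scalar_prod_supp_in(1)[OF sel_supp_in[OF D u] D supp_inD[OF sel_supp_in[OF D u]]])
  also have "\<dots> = (\<Sum>j<card D. ?w $ pick D j * ?w $ pick D j)"
    using sum.reindex_bij_betw[OF bij_betw_pick[OF fin], of "\<lambda>i. ?w $ i * ?w $ i"] by simp
  also have "\<dots> = u \<bullet> u"
    using u mult_sel_index(2)[OF D u] by (simp add: scalar_prod_def lessThan_atLeast0)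
  finally show ?thesis .
qed

lemma sel_mult_transpose:
  assumes D: "D \<subseteq> {..<p}" and v: "v \<in> carrier_vec p"
  shows "sel p D *\<^sub>v ((sel p D)\<^sup>T *\<^sub>v v) = restr p D v"
proof (rule eq_vecI)
  have fin: "finite D" using D finite_subset by blast
  note bij = bij_betw_pick[OF fin]
  have c: "(sel p D)\<^sup>T *\<^sub>v v \<in> carrier_vec (card D)"
    using v by (intro mult_mat_vec_carrier[of _ _ p]) (auto simp: sel_def)
  fix i assume "i < dim_vec (restr p D v)"
  then have i: "i < p" by (simp add: restr_def)
  show "(sel p D *\<^sub>v ((sel p D)\<^sup>T *\<^sub>v v)) $ i = restr p D v $ i"
  proof (cases "i \<in> D")
    case False
    then show ?thesis using mult_sel_index(1)[OF D c i] i by (simp add: restr_def)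
  next
    case True
    then obtain j where j: "j < card D" "i = pick D j" using bij by (metis bij_betw_iff_bijections lessThan_iff)
    have "((sel p D)\<^sup>T *\<^sub>v v) $ j = (\<Sum>l<p. (if l = i then 1 else 0) * v $ l)"
      using j v by (simp add: sel_def scalar_prod_def lessThan_atLeast0)
    also have "\<dots> = (\<Sum>l<p. if l = i then v $ l else 0)" by (intro sum.cong) auto
    also have "\<dots> = v $ i" using i by simp
    finally show ?thesis using mult_sel_index(2)[OF D c j(1)] j True i by (simp add: restr_def)
  qed
qed (auto simp: restr_def sel_def)

text \<open>\<open>sel p D\<close> embeds vectors indexed by D into dimension p by zero padding.
  Through this product every form of a submatrix becomes a form of S on padded vectors.\<close>

lemma submatrix_eq_sel:
  assumes S: "S \<in> carrier_mat p p" and D: "D \<subseteq> {..<p}" "B \<subseteq> {..<p}"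
  shows "submatrix S D B = (sel p D)\<^sup>T * (S * sel p B)"
proof (rule eq_matI)
  have fin: "finite D" "finite B" using D finite_subset by blast+
  have e: "{i. i < p \<and> i \<in> D} = D" "{i. i < p \<and> i \<in> B} = B" using D by auto
  fix i j assume "i < dim_row ((sel p D)\<^sup>T * (S * sel p B))" "j < dim_col ((sel p D)\<^sup>T * (S * sel p B))"
  then have ij: "i < card D" "j < card B" by (auto simp: sel_def)
  then have pk: "pick D i < p" "pick B j < p"
    using bij_betw_pick[OF fin(1)] bij_betw_pick[OF fin(2)] D by (meson bij_betw_apply lessThan_iff subset_iff)+
  have SB: "(S * sel p B) $$ (l, j) = S $$ (l, pick B j)" if "l < p" for l
  proof -
    have "(S * sel p B) $$ (l, j) = (\<Sum>t<p. S $$ (l, t) * (if t = pick B j then 1 else 0))"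
      using that ij S by (simp add: sel_def scalar_prod_def lessThan_atLeast0)
    also have "\<dots> = (\<Sum>t<p. if t = pick B j then S $$ (l, t) else 0)" by (intro sum.cong) auto
    finally show ?thesis using pk by simp
  qed
  have "((sel p D)\<^sup>T * (S * sel p B)) $$ (i, j) = (\<Sum>l<p. sel p D $$ (l, i) * (S * sel p B) $$ (l, j))"
    using ij S by (simp add: scalar_prod_def lessThan_atLeast0 sel_def)
  also have "\<dots> = (\<Sum>l<p. if l = pick D i then S $$ (l, pick B j) else 0)"
    using SB ij by (intro sum.cong) (auto simp: sel_def)
  also have "\<dots> = S $$ (pick D i, pick B j)" using pk by simp
  also have "\<dots> = submatrix S D B $$ (i, j)"
    using ij S e by (subst submatrix_index) auto
  finally show "submatrix S D B $$ (i, j) = ((sel p D)\<^sup>T * (S * sel p B)) $$ (i, j)" ..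
qed (use S D in \<open>auto simp: dim_submatrix sel_def intro!: arg_cong[of _ _ card]\<close>)

lemma submatrix_bilinear:
  fixes S :: "real mat"
  assumes S: "S \<in> carrier_mat p p" and D: "D \<subseteq> {..<p}" "B \<subseteq> {..<p}"
    and u: "u \<in> carrier_vec (card D)" and v: "v \<in> carrier_vec (card B)"
  shows "u \<bullet> (submatrix S D B *\<^sub>v v) = (sel p D *\<^sub>v u) \<bullet> (S *\<^sub>v (sel p B *\<^sub>v v))"
proof -
  have w: "sel p B *\<^sub>v v \<in> carrier_vec p" "S *\<^sub>v (sel p B *\<^sub>v v) \<in> carrier_vec p"
    using S v by (auto intro!: mult_mat_vec_carrier[of _ p p] mult_mat_vec_carrier[OF sel_carrier])
  have T: "(sel p D)\<^sup>T \<in> carrier_mat (card D) p" by simp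
  have "submatrix S D B *\<^sub>v v = (sel p D)\<^sup>T *\<^sub>v (S *\<^sub>v (sel p B *\<^sub>v v))"
    unfolding submatrix_eq_sel[OF S D] using S v T
    by (simp add: assoc_mult_mat_vec[OF T mult_carrier_mat[OF S sel_carrier] v] assoc_mult_mat_vec[OF S sel_carrier v])
  then show ?thesis
    using scalar_prod_mult_mat_vec[OF T u w(2)] by simp
qed

lemma restr_supp_in: "D \<subseteq> {..<p} \<Longrightarrow> restr p D v \<in> supp_in p D"
  by (auto simp: restr_def supp_in_def)

lemma pad_id_carrier [simp]: "pad_id p S D \<in> carrier_mat p p"
  by (simp add: pad_id_def)

lemma pad_id_transpose:
  assumes "S \<in> carrier_mat p p" "S\<^sup>T = S"
  shows "(pad_id p S D)\<^sup>T = pad_id p S D"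
proof (rule eq_matI)
  fix i j assume "i < dim_row (pad_id p S D)" "j < dim_col (pad_id p S D)"
  then have ij: "i < p" "j < p" by (auto simp: pad_id_def)
  then have "S $$ (j, i) = S $$ (i, j)" using assms by (metis carrier_matD index_transpose_mat(1))
  then show "(pad_id p S D)\<^sup>T $$ (i, j) = pad_id p S D $$ (i, j)" using ij by (auto simp: pad_id_def)
qed (auto simp: pad_id_def)

lemma pad_id_mult:
  assumes S: "S \<in> carrier_mat p p" and D: "D \<subseteq> {..<p}" and v: "v \<in> carrier_vec p"
  shows "pad_id p S D *\<^sub>v v = restr p D (S *\<^sub>v restr p D v) + restr p ({..<p} - D) v"
proof (rule eq_vecI)
  fix i assume "i < dim_vec (restr p D (S *\<^sub>v restr p D v) + restr p ({..<p} - D) v)"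
  then have i: "i < p" by (simp add: restr_def)
  have "(pad_id p S D *\<^sub>v v) $ i = (\<Sum>j<p. ((if i \<in> D \<and> j \<in> D then S $$ (i, j) else 0) + (if i = j \<and> i \<notin> D then 1 else 0)) * v $ j)"
    using i v by (simp add: pad_id_def scalar_prod_def lessThan_atLeast0)
  also have "\<dots> = (\<Sum>j<p. (if i \<in> D then S $$ (i, j) * (if j \<in> D then v $ j else 0) else 0) + (if i = j then (if i \<notin> D then v $ j else 0) else 0))"
    by (intro sum.cong) auto
  also have "\<dots> = (if i \<in> D then \<Sum>j<p. S $$ (i, j) * (if j \<in> D then v $ j else 0) else 0) + (if i \<notin> D then v $ i else 0)"
    using i by (simp add: sum.distrib)
  also have "\<dots> = (restr p D (S *\<^sub>v restr p D v) + restr p ({..<p} - D) v) $ i"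
    using i S by (simp add: restr_def scalar_prod_def lessThan_atLeast0)
  finally show "(pad_id p S D *\<^sub>v v) $ i = (restr p D (S *\<^sub>v restr p D v) + restr p ({..<p} - D) v) $ i" .
qed (simp add: pad_id_def restr_def)

lemma scalar_prod_restr:
  assumes "u \<in> carrier_vec p" "w \<in> carrier_vec p"
  shows "u \<bullet> restr p D w = restr p D u \<bullet> restr p D w" "restr p D u \<bullet> restr p D w = restr p D u \<bullet> w"
  using assms by (auto simp: restr_def scalar_prod_def intro!: sum.cong)

lemma restr_norm_split:
  assumes "v \<in> carrier_vec p" "D \<subseteq> {..<p}"
  shows "v \<bullet> v = restr p D v \<bullet> restr p D v + restr p ({..<p} - D) v \<bullet> restr p ({..<p} - D) v"
proof -
  have "v \<bullet> v = (\<Sum>i<p. v $ i * v $ i)" using assms by (simp add: scalar_prod_def lessThan_atLeast0)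
  also have "\<dots> = (\<Sum>i<p. restr p D v $ i * restr p D v $ i + restr p ({..<p} - D) v $ i * restr p ({..<p} - D) v $ i)"
    by (intro sum.cong) (auto simp: restr_def)
  finally show ?thesis by (simp add: scalar_prod_def restr_def lessThan_atLeast0 sum.distrib)
qed

text \<open>The identity block contributes the squared length of the part outside D, exactly what
  subtracting the identity removes.\<close>

lemma pad_id_quadratic:
  fixes S :: "real mat"
  assumes S: "S \<in> carrier_mat p p" and D: "D \<subseteq> {..<p}" and v: "v \<in> carrier_vec p"
  shows "v \<bullet> (pad_id p S D *\<^sub>v v) = restr p D v \<bullet> (S *\<^sub>v restr p D v)
    + restr p ({..<p} - D) v \<bullet> restr p ({..<p} - D) v"
    and "v \<bullet> ((pad_id p S D - 1\<^sub>m p) *\<^sub>v v) = restr p D v \<bullet> (S *\<^sub>v restr p D v) - restr p D v \<bullet> restr p D v"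
proof -
  let ?r = "restr p D v"
  have c: "?r \<in> carrier_vec p" "restr p D (S *\<^sub>v ?r) \<in> carrier_vec p" "restr p ({..<p} - D) v \<in> carrier_vec p"
    by (auto simp: restr_def)
  have Sr: "S *\<^sub>v ?r \<in> carrier_vec p" by (rule mult_mat_vec_carrier[OF S c(1)])
  show 1: "v \<bullet> (pad_id p S D *\<^sub>v v) = ?r \<bullet> (S *\<^sub>v ?r) + restr p ({..<p} - D) v \<bullet> restr p ({..<p} - D) v"
    unfolding pad_id_mult[OF S D v] using c Sr v
    by (simp add: scalar_prod_add_distrib[of _ p] scalar_prod_restr(1)[OF v Sr] scalar_prod_restr(2)[OF v Sr] scalar_prod_restr(1)[OF v v])
  have "(pad_id p S D - 1\<^sub>m p) *\<^sub>v v = pad_id p S D *\<^sub>v v - v"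
    using v by (simp add: minus_mult_distrib_mat_vec[OF pad_id_carrier one_carrier_mat v])
  then show "v \<bullet> ((pad_id p S D - 1\<^sub>m p) *\<^sub>v v) = ?r \<bullet> (S *\<^sub>v ?r) - ?r \<bullet> ?r"
    using 1 restr_norm_split[OF v D] v
    by (simp add: scalar_prod_minus_distrib[OF v mult_mat_vec_carrier[OF pad_id_carrier v] v])
qed

lemma restr_id: "v \<in> supp_in p D \<Longrightarrow> restr p D v = v"
  by (intro eq_vecI) (auto simp: restr_def supp_in_def)

lemma restr_compl_0: "v \<in> supp_in p D \<Longrightarrow> restr p ({..<p} - D) v = 0\<^sub>v p"
  by (intro eq_vecI) (auto simp: restr_def supp_in_def)

lemma pad_id_quadratic_supp:
  fixes S :: "real mat"
  assumes S: "S \<in> carrier_mat p p" and D: "D \<subseteq> {..<p}" and v: "v \<in> supp_in p D"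
  shows "v \<bullet> (pad_id p S D *\<^sub>v v) = v \<bullet> (S *\<^sub>v v)"
    and "v \<bullet> ((pad_id p S D - 1\<^sub>m p) *\<^sub>v v) = v \<bullet> (S *\<^sub>v v) - v \<bullet> v"
  unfolding pad_id_quadratic[OF S D supp_inD[OF v]] restr_id[OF v] restr_compl_0[OF v] by simp_all

section \<open>The spiked covariance matrix\<close>

locale spiked_covariance =
  fixes p r :: nat and V :: "real mat" and ls :: "nat \<Rightarrow> real"
  assumes V_orthonormal: "V \<in> orthonormal_mats p r"
    and ls_pos: "\<And>i. i < r \<Longrightarrow> ls i > 0"
begin

lemma V: "V \<in> carrier_mat p r" "V\<^sup>T \<in> carrier_mat r p" and VTV: "V\<^sup>T * V = 1\<^sub>m r"
  using V_orthonormal by (auto simp: orthonormal_mats_def)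

definition core :: "(nat \<Rightarrow> real) \<Rightarrow> real mat" where
  "core f = V * mat_diag r f * V\<^sup>T"

text \<open>Because V'V is the identity, these matrices multiply like the numbers 1 + f i. The
  square root and the inverse of the covariance are then found by choosing f.\<close>

definition spike :: "(nat \<Rightarrow> real) \<Rightarrow> real mat" where
  "spike f = core f + 1\<^sub>m p"

lemma core_carrier [simp]: "core f \<in> carrier_mat p p"
  using V unfolding core_def by (intro mult_carrier_mat[of _ p r] mult_carrier_mat[of _ p r _ r] mat_diag_dim)

lemma spike_carrier [simp]: "spike f \<in> carrier_mat p p"
  by (simp add: spike_def)

lemma core_add: "core f + core g = core (\<lambda>i. f i + g i)"
proof -
  have VD: "V * mat_diag r f \<in> carrier_mat p r" for f by (rule mult_carrier_mat[OF V(1) mat_diag_dim])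
  have "core f + core g = (V * mat_diag r f + V * mat_diag r g) * V\<^sup>T"
    unfolding core_def by (rule add_mult_distrib_mat[OF VD VD V(2), symmetric])
  also have "V * mat_diag r f + V * mat_diag r g = V * (mat_diag r f + mat_diag r g)"
    by (rule mult_add_distrib_mat[OF V(1) mat_diag_dim mat_diag_dim, symmetric])
  also have "mat_diag r f + mat_diag r g = mat_diag r (\<lambda>i. f i + g i)"
    by (rule eq_matI) (auto simp: mat_diag_def)
  finally show ?thesis by (simp add: core_def)
qed

lemma core_mult: "core f * core g = core (\<lambda>i. f i * g i)"
proof -
  have D: "mat_diag r f \<in> carrier_mat r r" for f by simp
  have VD: "V * mat_diag r f \<in> carrier_mat p r" for f by (rule mult_carrier_mat[OF V(1) D])
  have DV: "mat_diag r f * V\<^sup>T \<in> carrier_mat r p" for f by (rule mult_carrier_mat[OF D V(2)])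
  have "core f * core g = (V * mat_diag r f * V\<^sup>T) * (V * (mat_diag r g * V\<^sup>T))"
    unfolding core_def assoc_mult_mat[OF V(1) D V(2)] ..
  also have "\<dots> = V * mat_diag r f * (V\<^sup>T * (V * (mat_diag r g * V\<^sup>T)))"
    by (rule assoc_mult_mat[OF VD V(2) mult_carrier_mat[OF V(1) DV]])
  also have "V\<^sup>T * (V * (mat_diag r g * V\<^sup>T)) = (V\<^sup>T * V) * (mat_diag r g * V\<^sup>T)"
    by (rule assoc_mult_mat[OF V(2,1) DV, symmetric])
  also have "\<dots> = mat_diag r g * V\<^sup>T" unfolding VTV by (rule left_mult_one_mat[OF DV])
  also have "V * mat_diag r f * \<dots> = V * mat_diag r f * mat_diag r g * V\<^sup>T"
    by (rule assoc_mult_mat[OF VD D V(2), symmetric])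
  also have "V * mat_diag r f * mat_diag r g = V * (mat_diag r f * mat_diag r g)"
    by (rule assoc_mult_mat[OF V(1) D D])
  finally show ?thesis by (simp add: core_def)
qed

lemma core_zero: "core (\<lambda>_. 0) = 0\<^sub>m p p"
proof -
  have "mat_diag r (\<lambda>_. 0 :: real) = 0\<^sub>m r r" by (rule eq_matI) (auto simp: mat_diag_def)
  then show ?thesis unfolding core_def using V
    by (simp add: right_mult_zero_mat[OF V(1)] left_mult_zero_mat[OF V(2)])
qed

lemma spike_mult: "spike f * spike g = spike (\<lambda>i. f i * g i + f i + g i)"
proof -
  have "spike f * spike g = core f * (core g + 1\<^sub>m p) + 1\<^sub>m p * (core g + 1\<^sub>m p)"
    unfolding spike_def by (rule add_mult_distrib_mat[of _ p p _ _ p]) auto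
  also have "core f * (core g + 1\<^sub>m p) = core f * core g + core f * 1\<^sub>m p"
    by (rule mult_add_distrib_mat[of _ p p _ p]) auto
  also have "core f * 1\<^sub>m p = core f" by (rule right_mult_one_mat[OF core_carrier])
  also have "1\<^sub>m p * (core g + 1\<^sub>m p) = core g + 1\<^sub>m p" by (rule left_mult_one_mat[of _ p p]) auto
  also have "core f * core g + core f + (core g + 1\<^sub>m p) = (core f * core g + core f) + core g + 1\<^sub>m p"
    by (rule assoc_add_mat[of _ p p, symmetric]) (auto intro: mult_carrier_mat[OF core_carrier core_carrier])
  finally show ?thesis by (simp add: core_mult core_add spike_def)
qed

lemma core_transpose: "(core f)\<^sup>T = core f"
proof -
  have D: "mat_diag r f \<in> carrier_mat r r" "(mat_diag r f)\<^sup>T = mat_diag r f"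
    by (auto simp: mat_diag_def)
  have "(core f)\<^sup>T = (V\<^sup>T)\<^sup>T * (V * mat_diag r f)\<^sup>T"
    unfolding core_def by (rule transpose_mult[OF mult_carrier_mat[OF V(1) D(1)] V(2)])
  also have "(V * mat_diag r f)\<^sup>T = mat_diag r f * V\<^sup>T"
    using transpose_mult[OF V(1) D(1)] D(2) by simp
  finally show ?thesis by (simp add: core_def assoc_mult_mat[OF V(1) D(1) V(2)])
qed

lemma spike_transpose: "(spike f)\<^sup>T = spike f"
  unfolding spike_def using core_transpose[of f] transpose_add[OF core_carrier[of f] one_carrier_mat] by simp

lemma core_mult_vec:
  assumes v: "v \<in> carrier_vec p"
  shows "core f *\<^sub>v v = V *\<^sub>v (mat_diag r f *\<^sub>v (V\<^sup>T *\<^sub>v v))"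
proof -
  have D: "mat_diag r f \<in> carrier_mat r r" by simp
  have Vv: "V\<^sup>T *\<^sub>v v \<in> carrier_vec r" by (rule mult_mat_vec_carrier[OF V(2) v])
  show ?thesis unfolding core_def
      assoc_mult_mat_vec[OF mult_carrier_mat[OF V(1) D] V(2) v] assoc_mult_mat_vec[OF V(1) D Vv] ..
qed

lemma spike_mult_vec:
  assumes v: "v \<in> carrier_vec p"
  shows "spike f *\<^sub>v v = core f *\<^sub>v v + v"
  unfolding spike_def using add_mult_distrib_mat_vec[OF core_carrier one_carrier_mat v] v by simp

lemma spike_quadratic:
  assumes v: "v \<in> carrier_vec p"
  shows "v \<bullet> (spike f *\<^sub>v v) = v \<bullet> v + (\<Sum>i<r. f i * ((V\<^sup>T *\<^sub>v v) $ i)\<^sup>2)"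
proof -
  have D: "mat_diag r f \<in> carrier_mat r r" by simp
  have Vv: "V\<^sup>T *\<^sub>v v \<in> carrier_vec r" by (rule mult_mat_vec_carrier[OF V(2) v])
  have "v \<bullet> (core f *\<^sub>v v) = (V\<^sup>T *\<^sub>v v) \<bullet> (mat_diag r f *\<^sub>v (V\<^sup>T *\<^sub>v v))"
    unfolding core_mult_vec[OF v]
    by (rule scalar_prod_mult_mat_vec[OF V(1) v mult_mat_vec_carrier[OF D Vv]])
  then show ?thesis unfolding spike_mult_vec[OF v] scalar_prod_mat_diag[OF Vv]
    using v by (simp add: scalar_prod_add_distrib[OF v mult_mat_vec_carrier[OF core_carrier v] v])
qed

section \<open>Square root, inverse and whitening of the covariance\<close>

abbreviation Sig :: "real mat" where "Sig \<equiv> spike ls"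
abbreviation R :: "real mat" where "R \<equiv> psd_sqrt p Sig"

text \<open>One square root is exhibited so that the choice in \<open>psd_sqrt\<close> is
  meaningful. The chosen R is not identified with it; the rest works from these four
  properties.\<close>

lemma psd_sqrt_spec:
  "R \<in> carrier_mat p p" "R\<^sup>T = R" "\<And>v. v \<in> carrier_vec p \<Longrightarrow> v \<bullet> (R *\<^sub>v v) \<ge> 0" "R * R = Sig"
proof -
  \<comment> \<open>1 + \<open>?g i\<close> is the square root of 1 + \<open>ls i\<close>; the
    \<open>max\<close> changes nothing below r and keeps the function nonnegative at every
    index.\<close>
  let ?g = "\<lambda>i. sqrt (1 + max 0 (ls i)) - 1"
  let ?P = "\<lambda>R. R \<in> carrier_mat p p \<and> R\<^sup>T = R \<and> (\<forall>v\<in>carrier_vec p. v \<bullet> (R *\<^sub>v v) \<ge> 0) \<and> R * R = Sig"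
  have "core (\<lambda>i. ?g i * ?g i + ?g i + ?g i) = core ls"
  proof -
    have "mat_diag r (\<lambda>i. ?g i * ?g i + ?g i + ?g i) = mat_diag r ls"
      using ls_pos by (intro eq_matI) (auto simp: mat_diag_def algebra_simps less_imp_le)
    then show ?thesis by (simp add: core_def)
  qed
  then have "spike ?g * spike ?g = Sig"
    unfolding spike_mult unfolding spike_def by (simp only:)
  moreover have "v \<bullet> (spike ?g *\<^sub>v v) \<ge> 0" if "v \<in> carrier_vec p" for v
    unfolding spike_quadratic[OF that] by (intro add_nonneg_nonneg scalar_prod_self_nonneg sum_nonneg) auto
  ultimately have "?P (spike ?g)" by (simp add: spike_transpose)
  then have "?P R" unfolding psd_sqrt_def by (rule someI[of ?P])
  then show "R \<in> carrier_mat p p" "R\<^sup>T = R" "\<And>v. v \<in> carrier_vec p \<Longrightarrow> v \<bullet> (R *\<^sub>v v) \<ge> 0" "R * R = Sig"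
    by auto
qed

lemma R_mult_carrier [simp]: "v \<in> carrier_vec p \<Longrightarrow> R *\<^sub>v v \<in> carrier_vec p"
  by (rule mult_mat_vec_carrier[OF psd_sqrt_spec(1)])

lemma R_adjoint: "u \<in> carrier_vec p \<Longrightarrow> v \<in> carrier_vec p \<Longrightarrow> u \<bullet> (R *\<^sub>v v) = (R *\<^sub>v u) \<bullet> v"
  using scalar_prod_mult_mat_vec[OF psd_sqrt_spec(1)] psd_sqrt_spec(2) by metis

lemma R_R_mult: "v \<in> carrier_vec p \<Longrightarrow> R *\<^sub>v (R *\<^sub>v v) = Sig *\<^sub>v v"
  using assoc_mult_mat_vec[OF psd_sqrt_spec(1) psd_sqrt_spec(1)] psd_sqrt_spec(4) by metis

lemma R_norm: "v \<in> carrier_vec p \<Longrightarrow> (R *\<^sub>v v) \<bullet> (R *\<^sub>v v) = v \<bullet> (Sig *\<^sub>v v)"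
  using R_adjoint[of v "R *\<^sub>v v"] R_R_mult[of v] by simp

text \<open>The covariance fixes v, so w = R v - v satisfies R w = - w, and positivity of R forces w
  = 0. This takes the place of uniqueness of the square root.\<close>

lemma R_fixes_orthogonal:
  assumes v: "v \<in> carrier_vec p" "V\<^sup>T *\<^sub>v v = 0\<^sub>v r"
  shows "R *\<^sub>v v = v"
proof -
  have D: "mat_diag r ls *\<^sub>v 0\<^sub>v r = 0\<^sub>v r" by (intro eq_vecI) (auto simp: mat_diag_def)
  have "core ls *\<^sub>v v = 0\<^sub>v p" unfolding core_mult_vec[OF v(1)] v(2) D
    using V by (intro eq_vecI) auto
  then have Sv: "Sig *\<^sub>v v = v" using spike_mult_vec[OF v(1)] v(1) by simp
  let ?w = "R *\<^sub>v v - v"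
  have w: "?w \<in> carrier_vec p" using v by simp
  have "R *\<^sub>v ?w = R *\<^sub>v (R *\<^sub>v v) - R *\<^sub>v v"
    using v by (intro mult_minus_distrib_mat_vec[OF psd_sqrt_spec(1)]) auto
  also have "\<dots> = v - R *\<^sub>v v" using R_R_mult[OF v(1)] Sv by simp
  finally have Rw: "R *\<^sub>v ?w = v - R *\<^sub>v v" .
  have "?w \<bullet> (v - R *\<^sub>v v) = - (?w \<bullet> ?w)"
  proof -
    have "v - R *\<^sub>v v = - ?w" using v(1) psd_sqrt_spec(1) by (intro eq_vecI) (auto simp del: index_mult_mat_vec)
    then show ?thesis using w by simp
  qed
  then have "?w \<bullet> ?w \<le> 0" using psd_sqrt_spec(3)[OF w] Rw by simp
  then have "?w \<bullet> ?w = 0" using scalar_prod_self_nonneg[of ?w] by linarith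
  then have w0: "?w = 0\<^sub>v p" using scalar_prod_self_eq_0[OF w] by simp
  show ?thesis
  proof (rule eq_vecI)
    fix i assume "i < dim_vec v"
    then have "?w $ i = (R *\<^sub>v v) $ i - v $ i" by (rule index_minus_vec(1))
    moreover have "?w $ i = 0" unfolding w0 using v(1) \<open>i < dim_vec v\<close> by simp
    ultimately show "(R *\<^sub>v v) $ i = v $ i" by simp
  qed (use v psd_sqrt_spec(1) in auto)
qed

text \<open>R times the inverse of the covariance, which is the spike with entries - l / (1 + l). So
  R is inverted without knowing its form.\<close>

definition Rinv :: "real mat" where
  "Rinv = R * spike (\<lambda>i. - ls i / (1 + ls i))"

lemma Rinv: "Rinv \<in> carrier_mat p p" "R * Rinv = 1\<^sub>m p" "Rinv * R = 1\<^sub>m p"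
proof -
  let ?h = "\<lambda>i. - ls i / (1 + ls i)"
  show c: "Rinv \<in> carrier_mat p p" unfolding Rinv_def by (rule mult_carrier_mat[OF psd_sqrt_spec(1) spike_carrier])
  have "core (\<lambda>i. ls i * ?h i + ls i + ?h i) = core (\<lambda>_. 0)"
  proof -
    have z: "ls i * ?h i + ls i + ?h i = 0" if "i < r" for i
    proof -
      have "1 + ls i > 0" using ls_pos[OF that] by simp
      then show ?thesis by (simp add: field_simps)
    qed
    then have "mat_diag r (\<lambda>i. ls i * ?h i + ls i + ?h i) = mat_diag r (\<lambda>_. 0)"
      by (intro eq_matI) (auto simp: mat_diag_def)
    then show ?thesis by (simp add: core_def)
  qed
  then have "Sig * spike ?h = 1\<^sub>m p"
    unfolding spike_mult unfolding spike_def by (simp add: core_zero)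
  moreover have "R * Rinv = (R * R) * spike ?h"
    unfolding Rinv_def by (rule assoc_mult_mat[OF psd_sqrt_spec(1) psd_sqrt_spec(1) spike_carrier, symmetric])
  ultimately show 1: "R * Rinv = 1\<^sub>m p" using psd_sqrt_spec(4) by simp
  show "Rinv * R = 1\<^sub>m p" by (rule mat_mult_left_right_inverse[OF psd_sqrt_spec(1) c 1])
qed

lemma R_Rinv_mult: "v \<in> carrier_vec p \<Longrightarrow> R *\<^sub>v (Rinv *\<^sub>v v) = v"
  and Rinv_R_mult: "v \<in> carrier_vec p \<Longrightarrow> Rinv *\<^sub>v (R *\<^sub>v v) = v"
  using assoc_mult_mat_vec[OF psd_sqrt_spec(1) Rinv(1)] assoc_mult_mat_vec[OF Rinv(1) psd_sqrt_spec(1)] Rinv(2,3)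
  by (metis one_mult_mat_vec)+

definition whiten :: "real mat \<Rightarrow> real mat" where
  "whiten S = Rinv\<^sup>T * S * Rinv"

lemma whiten_bilinear:
  assumes S: "S \<in> carrier_mat p p" and u: "u \<in> carrier_vec p" and v: "v \<in> carrier_vec p"
  shows "u \<bullet> (whiten S *\<^sub>v v) = (Rinv *\<^sub>v u) \<bullet> (S *\<^sub>v (Rinv *\<^sub>v v))"
proof -
  have T: "Rinv\<^sup>T \<in> carrier_mat p p" using Rinv(1) by simp
  have w: "Rinv *\<^sub>v v \<in> carrier_vec p" by (rule mult_mat_vec_carrier[OF Rinv(1) v])
  have "whiten S *\<^sub>v v = Rinv\<^sup>T *\<^sub>v (S *\<^sub>v (Rinv *\<^sub>v v))"
    unfolding whiten_def assoc_mult_mat_vec[OF mult_carrier_mat[OF T S] Rinv(1) v]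
    by (rule assoc_mult_mat_vec[OF T S w])
  then show ?thesis using scalar_prod_mult_mat_vec[OF T u mult_mat_vec_carrier[OF S w]] by simp
qed

lemma whiten_minus:
  assumes S: "S \<in> carrier_mat p p" "S\<^sup>T = S"
  shows "whiten S - 1\<^sub>m p \<in> carrier_mat p p" "(whiten S - 1\<^sub>m p)\<^sup>T = whiten S - 1\<^sub>m p"
proof -
  have T: "Rinv\<^sup>T \<in> carrier_mat p p" using Rinv(1) by simp
  have TS: "Rinv\<^sup>T * S \<in> carrier_mat p p" by (rule mult_carrier_mat[OF T S(1)])
  have "(whiten S)\<^sup>T = Rinv\<^sup>T * (Rinv\<^sup>T * S)\<^sup>T" unfolding whiten_def by (rule transpose_mult[OF TS Rinv(1)])
  also have "(Rinv\<^sup>T * S)\<^sup>T = S * Rinv" using transpose_mult[OF T S(1)] S(2) by simp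
  finally have "(whiten S)\<^sup>T = whiten S" by (simp add: whiten_def assoc_mult_mat[OF T S(1) Rinv(1)])
  then show "(whiten S - 1\<^sub>m p)\<^sup>T = whiten S - 1\<^sub>m p"
    using transpose_minus[OF mult_carrier_mat[OF TS Rinv(1), folded whiten_def] one_carrier_mat] by simp
qed (rule minus_carrier_mat[OF one_carrier_mat])

lemma whiten_minus_bilinear:
  assumes S: "S \<in> carrier_mat p p" and u: "u \<in> carrier_vec p" and v: "v \<in> carrier_vec p"
  shows "u \<bullet> ((whiten S - 1\<^sub>m p) *\<^sub>v v) = u \<bullet> (whiten S *\<^sub>v v) - u \<bullet> v"
proof -
  have W: "whiten S \<in> carrier_mat p p" unfolding whiten_def
    using S Rinv(1) by (auto intro!: mult_carrier_mat[of _ p p])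
  have "(whiten S - 1\<^sub>m p) *\<^sub>v v = whiten S *\<^sub>v v - v"
    using minus_mult_distrib_mat_vec[OF W one_carrier_mat v] v by simp
  then show ?thesis using scalar_prod_minus_distrib[OF u mult_mat_vec_carrier[OF W v] v] by simp
qed

lemma V_adjoint: "u \<in> carrier_vec p \<Longrightarrow> a \<in> carrier_vec r \<Longrightarrow> u \<bullet> (V *\<^sub>v a) = (V\<^sup>T *\<^sub>v u) \<bullet> a"
  by (rule scalar_prod_mult_mat_vec[OF V(1)])

lemma V_isometry:
  assumes "a \<in> carrier_vec r"
  shows "(V *\<^sub>v a) \<bullet> (V *\<^sub>v a) = a \<bullet> a"
proof -
  have "V\<^sup>T *\<^sub>v (V *\<^sub>v a) = a" using assoc_mult_mat_vec[OF V(2,1) assms] VTV assms by simp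
  then show ?thesis using V_adjoint[OF mult_mat_vec_carrier[OF V(1) assms] assms] by simp
qed

lemma VT_outside_supp:
  assumes v: "v \<in> supp_in p D" and D: "D \<inter> row_supp V = {}"
  shows "V\<^sup>T *\<^sub>v v = 0\<^sub>v r"
proof (rule eq_vecI)
  fix l assume "l < dim_vec (0\<^sub>v r)"
  then have l: "l < r" by simp
  have z: "V $$ (i, l) * v $ i = 0" if i: "i < p" for i
  proof (cases "i \<in> D")
    case True
    then have "i \<notin> row_supp V" using D by blast
    then have "Matrix.row V i = 0\<^sub>v r" using V(1) i by (auto simp: row_supp_def)
    then have "Matrix.row V i $ l = 0" using l by simp
    then show ?thesis using V(1) i l by simp
  next
    case False
    then show ?thesis using v i by (simp add: supp_in_def)
  qed
  have "(V\<^sup>T *\<^sub>v v) $ l = (\<Sum>i<p. V $$ (i, l) * v $ i)"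
    using V(1) l supp_inD[OF v] by (simp add: scalar_prod_def lessThan_atLeast0)
  also have "\<dots> = 0" using z by (intro sum.neutral) auto
  finally show "(V\<^sup>T *\<^sub>v v) $ l = 0\<^sub>v r $ l" using l by simp
qed (use V in simp)

lemma V_mult_supp_in:
  assumes a: "a \<in> carrier_vec r" and J: "row_supp V \<subseteq> J"
  shows "V *\<^sub>v a \<in> supp_in p J"
proof -
  have "(V *\<^sub>v a) $ i = 0" if i: "i < p" "i \<notin> J" for i
  proof -
    have "Matrix.row V i = 0\<^sub>v r" using V(1) i J by (auto simp: row_supp_def)
    then show ?thesis using i V(1) a by simp
  qed
  then show ?thesis using mult_mat_vec_carrier[OF V(1) a] by (simp add: supp_in_def)
qed

text \<open>A unit vector at a coordinate outside J is fixed by R, so by self-adjointness R v and v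
  agree at that coordinate. This keeps supports small enough for the Gram bounds.\<close>

lemma R_supp_in:
  assumes v: "v \<in> supp_in p B" and J: "row_supp V \<subseteq> J"
  shows "R *\<^sub>v v \<in> supp_in p (J \<union> B)"
proof -
  have "(R *\<^sub>v v) $ i = 0" if i: "i < p" "i \<notin> J \<union> B" for i
  proof -
    have e: "unit_vec p i \<in> supp_in p {i}" using i by (auto simp: supp_in_def)
    have "R *\<^sub>v unit_vec p i = unit_vec p i"
      using VT_outside_supp[OF e] i J by (intro R_fixes_orthogonal) auto
    then have "unit_vec p i \<bullet> (R *\<^sub>v v) = unit_vec p i \<bullet> v"
      using R_adjoint[of "unit_vec p i" v] supp_inD[OF v] by simp
    then have "(R *\<^sub>v v) $ i = v $ i"
      using i supp_inD[OF v] scalar_prod_left_unit[OF R_mult_carrier[OF supp_inD[OF v]] i(1)] by simp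
    then show ?thesis using v i by (simp add: supp_in_def)
  qed
  then show ?thesis using R_mult_carrier[OF supp_inD[OF v]] by (simp add: supp_in_def)
qed

text \<open>The spike factors through V, and conversely V is the spike times V diag(1 / ls), so the
  two have equal rank. V has full column rank because it is an isometry.\<close>

lemma rank_core: "vec_space.rank p (Sig - 1\<^sub>m p) = r"
proof -
  interpret vec_space "TYPE(real)" p .
  let ?h = "\<lambda>i. 1 / ls i"
  have D: "mat_diag r f \<in> carrier_mat r r" for f :: "nat \<Rightarrow> real" by simp
  have VD: "V * mat_diag r ls \<in> carrier_mat p r" by (rule mult_carrier_mat[OF V(1) D])
  have "Sig - 1\<^sub>m p = core ls" unfolding spike_def using carrier_matD[OF core_carrier[of ls]] by (intro eq_matI) auto
  moreover have "rank (core ls) \<le> rank V"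
  proof -
    have "core ls = V * (mat_diag r ls * V\<^sup>T)" unfolding core_def by (rule assoc_mult_mat[OF V(1) D V(2)])
    then show ?thesis using rank_mult_le[OF V(1) mult_carrier_mat[OF D V(2)]] by simp
  qed
  moreover have "rank V \<le> rank (core ls)"
  proof -
    have "mat_diag r (\<lambda>i. ls i * ?h i) = mat_diag r (\<lambda>_. 1)"
      using ls_pos by (intro eq_matI) (auto simp: mat_diag_def, force)
    then have "V = V * mat_diag r ls * mat_diag r ?h"
      using V(1) assoc_mult_mat[OF V(1) D D, of ls ?h] by simp
    also have "\<dots> = V * mat_diag r ls * ((V\<^sup>T * V) * mat_diag r ?h)"
      unfolding VTV using left_mult_one_mat[OF D[of ?h]] by simp
    also have "(V\<^sup>T * V) * mat_diag r ?h = V\<^sup>T * (V * mat_diag r ?h)"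
      by (rule assoc_mult_mat[OF V(2,1) D])
    also have "V * mat_diag r ls * (V\<^sup>T * (V * mat_diag r ?h)) = core ls * (V * mat_diag r ?h)"
      unfolding core_def by (rule assoc_mult_mat[OF VD V(2) mult_carrier_mat[OF V(1) D], symmetric])
    finally have "V = core ls * (V * mat_diag r ?h)" .
    then show ?thesis using rank_mult_le[OF core_carrier mult_carrier_mat[OF V(1) D], of ls ?h] by simp
  qed
  moreover have "rank V = r"
  proof (rule lin_indpt_full_rank[OF V(1)])
    have inj: "a = 0\<^sub>v r" if a: "a \<in> carrier_vec r" "V *\<^sub>v a = 0\<^sub>v p" for a
      using V_isometry[OF a(1)] a scalar_prod_self_eq_0[OF a(1)] by simp
    \<comment> \<open>The rank criterion views the columns as a set, hence distinctness comes before
      independence.\<close>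
    show dist: "distinct (cols V)"
    proof (rule ccontr)
      assume "\<not> distinct (cols V)"
      then obtain i j where ij: "i < r" "j < r" "i \<noteq> j" "col V i = col V j"
        using V(1) by (auto simp: distinct_conv_nth)
      have "V *\<^sub>v unit_vec r i = V *\<^sub>v unit_vec r j"
      proof -
        have "V *\<^sub>v unit_vec r l = col V l" if "l < r" for l
          using that V(1) by (intro eq_vecI) (auto simp: scalar_prod_right_unit)
        then show ?thesis using ij by simp
      qed
      then have "V *\<^sub>v (unit_vec r i - unit_vec r j) = 0\<^sub>v p"
        using mult_minus_distrib_mat_vec[OF V(1), of "unit_vec r i" "unit_vec r j"]
          mult_mat_vec_carrier[OF V(1), of "unit_vec r j"] by simp
      then have "unit_vec r i - unit_vec r j = (0\<^sub>v r :: real Matrix.vec)" by (intro inj) auto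
      then have "(unit_vec r i - unit_vec r j :: real Matrix.vec) $ i = 0" using ij by simp
      then show False using ij by simp
    qed
    show "lin_indpt (set (cols V))"
    proof
      assume "lin_dep (set (cols V))"
      then obtain a where "a \<in> carrier_vec r" "a \<noteq> 0\<^sub>v r" "V *\<^sub>v a = 0\<^sub>v p"
        using lin_depE[OF V(1) _ dist] by blast
      then show False using inj by blast
    qed
  qed
  ultimately show ?thesis by simp
qed

end

section \<open>Rank selection on the good event\<close>

text \<open>
  With \<open>X = Z R\<close>, where \<open>R\<close> is the square root of \<open>\<Sigma>\<close>, the matrix \<open>whiten S\<close> is the
  sample covariance matrix of the standard Gaussian data \<open>Z\<close>.
\<close>

locale spiked_event = spiked_covariance +
  fixes k n :: nat and \<gamma>1 \<eta> :: real and S :: "real mat" and J :: "nat set"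
  assumes S: "S \<in> carrier_mat p p" "S\<^sup>T = S"
    and J: "J \<subseteq> {..<p}" "card J = k" "row_supp V \<subseteq> J"
    and k: "k \<ge> 1"
    and \<eta>_def: "\<eta> = eta k n p \<gamma>1"
    and \<eta>: "0 < \<eta>" "\<eta> \<le> 1 / 10"
    and eta_bounds: "\<And>m. m \<le> k \<Longrightarrow> 0 \<le> eta m n p \<gamma>1 \<and> eta m n p \<gamma>1 \<le> \<eta>"
    and gram: "\<And>D v. D \<subseteq> {..<p} \<Longrightarrow> card D \<le> k \<Longrightarrow> v \<in> supp_in p D \<Longrightarrow>
      \<bar>v \<bullet> ((whiten S - 1\<^sub>m p) *\<^sub>v v)\<bar> \<le> eta (card D) n p \<gamma>1 * (v \<bullet> v)"
    and gram2: "\<And>D v. D \<subseteq> {..<p} \<Longrightarrow> card D \<le> 2 * k \<Longrightarrow> v \<in> supp_in p D \<Longrightarrow>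
      \<bar>v \<bullet> ((whiten S - 1\<^sub>m p) *\<^sub>v v)\<bar> \<le> 3 / 2 * \<eta> * (v \<bullet> v)"
begin

abbreviation W :: "real mat" where "W \<equiv> whiten S"

lemma S_bilinear:
  assumes u: "u \<in> carrier_vec p" and v: "v \<in> carrier_vec p"
  shows "u \<bullet> (S *\<^sub>v v) = (R *\<^sub>v u) \<bullet> (W *\<^sub>v (R *\<^sub>v v))"
  unfolding whiten_bilinear[OF S(1) R_mult_carrier[OF u] R_mult_carrier[OF v]] Rinv_R_mult[OF u] Rinv_R_mult[OF v] ..

lemma gram_k:
  assumes "D \<subseteq> {..<p}" "card D \<le> k" "v \<in> supp_in p D"
  shows "\<bar>v \<bullet> (W *\<^sub>v v) - v \<bullet> v\<bar> \<le> eta (card D) n p \<gamma>1 * (v \<bullet> v)" "\<bar>v \<bullet> (W *\<^sub>v v) - v \<bullet> v\<bar> \<le> \<eta> * (v \<bullet> v)"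
proof -
  show 1: "\<bar>v \<bullet> (W *\<^sub>v v) - v \<bullet> v\<bar> \<le> eta (card D) n p \<gamma>1 * (v \<bullet> v)"
    using gram[OF assms] whiten_minus_bilinear[OF S(1) supp_inD[OF assms(3)] supp_inD[OF assms(3)]] by simp
  have "eta (card D) n p \<gamma>1 * (v \<bullet> v) \<le> \<eta> * (v \<bullet> v)"
    using eta_bounds[OF assms(2)] by (intro mult_right_mono scalar_prod_self_nonneg) auto
  then show "\<bar>v \<bullet> (W *\<^sub>v v) - v \<bullet> v\<bar> \<le> \<eta> * (v \<bullet> v)" using 1 by linarith
qed

lemma gram_2k:
  assumes "D \<subseteq> {..<p}" "card D \<le> 2 * k" "v \<in> supp_in p D"
  shows "\<bar>v \<bullet> (W *\<^sub>v v) - v \<bullet> v\<bar> \<le> 3 / 2 * \<eta> * (v \<bullet> v)"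
  using gram2[OF assms] whiten_minus_bilinear[OF S(1) supp_inD[OF assms(3)] supp_inD[OF assms(3)]] by simp

text \<open>R maps vectors supported on J to vectors supported on J, so only k columns are involved
  and the loss is \<open>\<eta>\<close> instead of 3/2 of it.\<close>

lemma S_quadratic_supp_J:
  assumes v: "v \<in> supp_in p J"
  shows "(1 - \<eta>) * (v \<bullet> (Sig *\<^sub>v v)) \<le> v \<bullet> (S *\<^sub>v v)"
proof -
  have Rv: "R *\<^sub>v v \<in> supp_in p J" using R_supp_in[OF v J(3)] by simp
  have "\<bar>(R *\<^sub>v v) \<bullet> (W *\<^sub>v (R *\<^sub>v v)) - (R *\<^sub>v v) \<bullet> (R *\<^sub>v v)\<bar> \<le> \<eta> * ((R *\<^sub>v v) \<bullet> (R *\<^sub>v v))"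
    using J by (intro gram_k(2)[OF _ _ Rv]) auto
  then show ?thesis unfolding S_bilinear[OF supp_inD[OF v] supp_inD[OF v]] R_norm[OF supp_inD[OF v]]
    by (simp add: algebra_simps)
qed

lemma S_quadratic_card_k:
  assumes B: "B \<subseteq> {..<p}" "card B \<le> k" and v: "v \<in> supp_in p B"
  shows "\<bar>v \<bullet> (S *\<^sub>v v) - v \<bullet> (Sig *\<^sub>v v)\<bar> \<le> 3 / 2 * \<eta> * (v \<bullet> (Sig *\<^sub>v v))"
proof -
  have Rv: "R *\<^sub>v v \<in> supp_in p (J \<union> B)" by (rule R_supp_in[OF v J(3)])
  have "card (J \<union> B) \<le> 2 * k" using card_Un_le[of J B] J B by simp
  then have "\<bar>(R *\<^sub>v v) \<bullet> (W *\<^sub>v (R *\<^sub>v v)) - (R *\<^sub>v v) \<bullet> (R *\<^sub>v v)\<bar> \<le> 3 / 2 * \<eta> * ((R *\<^sub>v v) \<bullet> (R *\<^sub>v v))"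
    using J B by (intro gram_2k[OF _ _ Rv]) auto
  then show ?thesis unfolding S_bilinear[OF supp_inD[OF v] supp_inD[OF v]] R_norm[OF supp_inD[OF v]] .
qed

lemma Sig_quadratic_ge:
  assumes "v \<in> carrier_vec p"
  shows "v \<bullet> v \<le> v \<bullet> (Sig *\<^sub>v v)"
  unfolding spike_quadratic[OF assms] using ls_pos by (simp, intro sum_nonneg mult_nonneg_nonneg) (auto intro: less_imp_le)

lemma S_psd:
  assumes B: "B \<subseteq> {..<p}" "card B \<le> k" and v: "v \<in> supp_in p B"
  shows "v \<bullet> (S *\<^sub>v v) \<ge> (1 - 3 / 2 * \<eta>) * (v \<bullet> (Sig *\<^sub>v v))" "v \<bullet> (S *\<^sub>v v) \<ge> 1 / 2 * (v \<bullet> v)"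
proof -
  show 1: "v \<bullet> (S *\<^sub>v v) \<ge> (1 - 3 / 2 * \<eta>) * (v \<bullet> (Sig *\<^sub>v v))"
    using abs_le_D2[OF S_quadratic_card_k[OF B v]] by (simp add: algebra_simps)
  have "1 / 2 * (v \<bullet> v) \<le> (1 - 3 / 2 * \<eta>) * (v \<bullet> (Sig *\<^sub>v v))"
    using Sig_quadratic_ge[OF supp_inD[OF v]] \<eta> scalar_prod_self_nonneg[of v] by (intro mult_mono) auto
  then show "v \<bullet> (S *\<^sub>v v) \<ge> 1 / 2 * (v \<bullet> v)" using 1 by linarith
qed

lemma spectral_norm_pad_ge:
  assumes B: "B \<subseteq> {..<p}" "card B = k"
  shows "spectral_norm (pad_id p S B) \<ge> 1 / 2"
proof -
  obtain i where i: "i \<in> B" using B k by (metis card.empty equals0I not_one_le_zero)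
  then have ip: "i < p" using B by auto
  let ?e = "unit_vec p i :: real Matrix.vec"
  have e: "?e \<in> supp_in p B" using i ip by (auto simp: supp_in_def)
  have ee: "?e \<bullet> ?e = 1" using ip by simp
  have "1 / 2 \<le> ?e \<bullet> (S *\<^sub>v ?e)" using S_psd(2)[OF B(1) _ e] B ee by simp
  also have "\<dots> = ?e \<bullet> (pad_id p S B *\<^sub>v ?e)" using pad_id_quadratic_supp(1)[OF S(1) B(1) e] by (simp only:)
  also have "\<dots> \<le> spectral_norm (pad_id p S B) * (?e \<bullet> ?e)"
    using quadratic_le_spectral_norm[OF pad_id_carrier[of p S B] unit_vec_carrier[of p i]] by linarith
  finally show ?thesis using ee by simp
qed

text \<open>For D outside J the square root R fixes vectors on D, so there S acts as the Gram matrix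
  of white noise and the sharp bound for \<open>card D\<close> columns applies. In the cross block
  the identity part of the Gram matrix drops out by orthogonality, and the length of R v is
  controlled by the form of S on J.\<close>

lemma true_support_in_BB: "J \<in> BB k n p \<gamma>1 S"
proof -
  have "spectral_norm (pad_id p S D - 1\<^sub>m p) \<le> eta (card D) n p \<gamma>1 \<and>
        spectral_norm (submatrix S D J) \<le> 2 * sqrt (spectral_norm (pad_id p S J)) * eta k n p \<gamma>1"
    if D: "D \<subseteq> {..<p} - J" "card D \<le> k" for D
  proof
    have Dp: "D \<subseteq> {..<p}" using D by auto
    have disj: "D \<inter> row_supp V = {}" using D J by auto
    have fixD: "R *\<^sub>v v = v" if "v \<in> supp_in p D" for v
      by (rule R_fixes_orthogonal[OF supp_inD[OF that] VT_outside_supp[OF that disj]])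
    show "spectral_norm (pad_id p S D - 1\<^sub>m p) \<le> eta (card D) n p \<gamma>1"
    proof (rule spectral_norm_symmetric_le)
      show "pad_id p S D - 1\<^sub>m p \<in> carrier_mat p p" by (rule minus_carrier_mat[OF one_carrier_mat])
      show "(pad_id p S D - 1\<^sub>m p)\<^sup>T = pad_id p S D - 1\<^sub>m p"
        using transpose_minus[OF pad_id_carrier[of p S D] one_carrier_mat] pad_id_transpose[OF S] by simp
      show e0: "0 \<le> eta (card D) n p \<gamma>1" using eta_bounds[OF D(2)] by simp
      fix v :: "real Matrix.vec" assume v: "v \<in> carrier_vec p"
      let ?r = "restr p D v"
      have r: "?r \<in> supp_in p D" by (rule restr_supp_in[OF Dp])
      have "\<bar>?r \<bullet> (W *\<^sub>v ?r) - ?r \<bullet> ?r\<bar> \<le> eta (card D) n p \<gamma>1 * (?r \<bullet> ?r)"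
        by (rule gram_k(1)[OF Dp D(2) r])
      also have "\<dots> \<le> eta (card D) n p \<gamma>1 * (v \<bullet> v)"
        using restr_norm_split[OF v Dp] scalar_prod_self_nonneg[of "restr p ({..<p} - D) v"] e0
        by (intro mult_left_mono) auto
      finally show "\<bar>v \<bullet> ((pad_id p S D - 1\<^sub>m p) *\<^sub>v v)\<bar> \<le> eta (card D) n p \<gamma>1 * (v \<bullet> v)"
        unfolding pad_id_quadratic(2)[OF S(1) Dp v] S_bilinear[OF supp_inD[OF r] supp_inD[OF r]] fixD[OF r] .
    qed
    let ?L = "spectral_norm (pad_id p S J)"
    have L: "?L \<ge> 1 / 2" by (rule spectral_norm_pad_ge[OF J(1,2)])
    show "spectral_norm (submatrix S D J) \<le> 2 * sqrt ?L * eta k n p \<gamma>1"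
    proof (rule spectral_norm_le_bilinear)
      show "submatrix S D J \<in> carrier_mat (card D) (card J)"
        unfolding submatrix_eq_sel[OF S(1) Dp J(1)]
        by (intro mult_carrier_mat[of _ _ p] mult_carrier_mat[OF S(1) sel_carrier]) simp
      show "0 \<le> 2 * sqrt ?L * eta k n p \<gamma>1" using L \<eta> \<eta>_def by simp
      fix u v :: "real Matrix.vec" assume u: "u \<in> carrier_vec (card D)" and v: "v \<in> carrier_vec (card J)"
      let ?u = "sel p D *\<^sub>v u" and ?v = "sel p J *\<^sub>v v"
      have su: "?u \<in> supp_in p D" by (rule sel_supp_in[OF Dp u])
      have sv: "?v \<in> supp_in p J" by (rule sel_supp_in[OF J(1) v])
      have sb: "R *\<^sub>v ?v \<in> supp_in p J" using R_supp_in[OF sv J(3)] by simp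
      let ?b = "R *\<^sub>v ?v"
      have su': "?u \<in> supp_in p (D \<union> J)" and sb': "?b \<in> supp_in p (D \<union> J)"
        using supp_in_mono[OF su] supp_in_mono[OF sb] by auto
      have cDJ: "D \<union> J \<subseteq> {..<p}" "card (D \<union> J) \<le> 2 * k" using card_Un_le[of D J] J D Dp by auto
      \<comment> \<open>The supports D and J are disjoint, so W may be replaced by W - 1, which is
        small on their union.\<close>
      have orth: "?u \<bullet> ?b = 0"
        unfolding scalar_prod_supp_in(1)[OF su Dp supp_inD[OF sb]]
        using sb D by (intro sum.neutral) (auto simp: supp_in_def)
      have quad: "\<bar>w \<bullet> ((W - 1\<^sub>m p) *\<^sub>v w)\<bar> \<le> 3 / 2 * \<eta> * (w \<bullet> w)" if "w \<in> supp_in p (D \<union> J)" for w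
        using gram_2k[OF cDJ that] unfolding whiten_minus_bilinear[OF S(1) supp_inD[OF that] supp_inD[OF that]] .
      have "u \<bullet> (submatrix S D J *\<^sub>v v) = ?u \<bullet> ((W - 1\<^sub>m p) *\<^sub>v ?b)"
        unfolding submatrix_bilinear[OF S(1) Dp J(1) u v] S_bilinear[OF supp_inD[OF su] supp_inD[OF sv]] fixD[OF su]
          whiten_minus_bilinear[OF S(1) supp_inD[OF su] supp_inD[OF sb]] orth by simp
      then have bil: "\<bar>u \<bullet> (submatrix S D J *\<^sub>v v)\<bar> \<le> 3 / 2 * \<eta> * vnorm ?u * vnorm ?b"
        using bilinear_bound_from_quadratic[OF whiten_minus[OF S] quad su' sb'] by simp
      have nu: "vnorm ?u = vnorm u" by (simp add: vnorm_def sel_isometry[OF Dp u])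
      have "(1 - \<eta>) * (?b \<bullet> ?b) \<le> ?v \<bullet> (S *\<^sub>v ?v)"
        unfolding R_norm[OF supp_inD[OF sv]] by (rule S_quadratic_supp_J[OF sv])
      also have "\<dots> = ?v \<bullet> (pad_id p S J *\<^sub>v ?v)" using pad_id_quadratic_supp(1)[OF S(1) J(1) sv] by (simp only:)
      also have "\<dots> \<le> ?L * (?v \<bullet> ?v)"
        using quadratic_le_spectral_norm[OF pad_id_carrier[of p S J] supp_inD[OF sv]] by linarith
      also have "?v \<bullet> ?v = v \<bullet> v" by (rule sel_isometry[OF J(1) v])
      finally have 1: "(1 - \<eta>) * (?b \<bullet> ?b) \<le> ?L * (v \<bullet> v)" .
      \<comment> \<open>With \<open>\<eta>\<close> \<le> 1/10 the squared constant is at most 9/4 *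
        10/9 = 5/2, below the 4 that the factor 2 in \<open>BB\<close> allows.\<close>
      have "9 / 10 * (?b \<bullet> ?b) \<le> (1 - \<eta>) * (?b \<bullet> ?b)"
        using \<eta> by (intro mult_right_mono scalar_prod_self_nonneg) auto
      moreover have "0 \<le> ?L * (v \<bullet> v)" using L scalar_prod_self_nonneg[of v] by simp
      moreover have "(3 / 2 * vnorm ?b)\<^sup>2 = 9 / 4 * (?b \<bullet> ?b)"
        by (simp only: power_mult_distrib vnorm_sq) (simp add: power2_eq_square)
      moreover have "(2 * sqrt ?L * vnorm v)\<^sup>2 = 4 * (?L * (v \<bullet> v))"
        using L by (simp add: power_mult_distrib vnorm_sq)
      ultimately have "(3 / 2 * vnorm ?b)\<^sup>2 \<le> (2 * sqrt ?L * vnorm v)\<^sup>2"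
        using 1 scalar_prod_self_nonneg[of ?b] by linarith
      then have "3 / 2 * vnorm ?b \<le> 2 * sqrt ?L * vnorm v"
        using L by (intro power2_le_imp_le[of "3 / 2 * vnorm ?b"] mult_nonneg_nonneg vnorm_nonneg) auto
      then have "\<eta> * vnorm u * (3 / 2 * vnorm ?b) \<le> \<eta> * vnorm u * (2 * sqrt ?L * vnorm v)"
        using \<eta> vnorm_nonneg[of u] by (intro mult_left_mono) auto
      then show "\<bar>u \<bullet> (submatrix S D J *\<^sub>v v)\<bar> \<le> 2 * sqrt ?L * eta k n p \<gamma>1 * vnorm u * vnorm v"
        using bil unfolding nu \<eta>_def[symmetric] by (simp add: mult_ac)
    qed
  qed
  then show ?thesis using J unfolding BB_def by blast
qed

lemma submatrix_BB_props:
  assumes B: "B \<subseteq> {..<p}" "card B = k"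
  shows "submatrix S B B \<in> carrier_mat k k" "(submatrix S B B)\<^sup>T = submatrix S B B"
    "\<And>v. v \<in> carrier_vec k \<Longrightarrow> v \<bullet> (submatrix S B B *\<^sub>v v) \<ge> 0"
proof -
  have c: "sel p B \<in> carrier_mat p k" using sel_carrier[of p B] B by simp
  have cT: "(sel p B)\<^sup>T \<in> carrier_mat k p" using c by simp
  have Sc: "S * sel p B \<in> carrier_mat p k" by (rule mult_carrier_mat[OF S(1) c])
  note eq = submatrix_eq_sel[OF S(1) B(1) B(1)]
  show "submatrix S B B \<in> carrier_mat k k" unfolding eq by (rule mult_carrier_mat[OF cT Sc])
  have "(submatrix S B B)\<^sup>T = (S * sel p B)\<^sup>T * sel p B" unfolding eq using transpose_mult[OF cT Sc] by simp
  also have "(S * sel p B)\<^sup>T = (sel p B)\<^sup>T * S" using transpose_mult[OF S(1) c] S(2) by simp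
  also have "(sel p B)\<^sup>T * S * sel p B = submatrix S B B" unfolding eq by (rule assoc_mult_mat[OF cT S(1) c])
  finally show "(submatrix S B B)\<^sup>T = submatrix S B B" .
  fix v :: "real Matrix.vec" assume "v \<in> carrier_vec k"
  then have v: "v \<in> carrier_vec (card B)" using B by simp
  show "v \<bullet> (submatrix S B B *\<^sub>v v) \<ge> 0"
    unfolding submatrix_bilinear[OF S(1) B(1) B(1) v v]
    using S_psd(2)[OF B(1) _ sel_supp_in[OF B(1) v]] B scalar_prod_self_nonneg[of "sel p B *\<^sub>v v"] by simp
qed

text \<open>The r constraints are the columns of V restricted to B. A vector satisfying them is,
  after padding, orthogonal to all columns of V, hence fixed by R, and sees the white Gram matrix
  alone.\<close>

lemma sing_val_noise:
  assumes B: "B \<subseteq> {..<p}" "card B = k" and l: "r < l" "l \<le> k"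
  shows "sing_val l (submatrix S B B) \<le> 1 + 3 / 2 * \<eta>"
proof (rule sing_val_le[OF submatrix_BB_props[OF B], of "(\<lambda>i. (sel p B)\<^sup>T *\<^sub>v col V i) ` {..<r}"])
  have c: "sel p B \<in> carrier_mat p k" using sel_carrier[of p B] B by simp
  have cT: "(sel p B)\<^sup>T \<in> carrier_mat k p" using c by simp
  let ?W = "(\<lambda>i. (sel p B)\<^sup>T *\<^sub>v col V i) ` {..<r}"
  have colV: "col V i \<in> carrier_vec p" for i using V(1) by auto
  show "card ?W < l" using card_image_le[of "{..<r}" "\<lambda>i. (sel p B)\<^sup>T *\<^sub>v col V i"] l by simp
  show "l \<le> k" by (rule l(2))
  show "finite ?W" by simp
  show "?W \<subseteq> carrier_vec k" using mult_mat_vec_carrier[OF cT colV] by blast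
  fix v :: "real Matrix.vec" assume vk: "v \<in> carrier_vec k" and orth: "\<And>w. w \<in> ?W \<Longrightarrow> w \<bullet> v = 0"
  then have v: "v \<in> carrier_vec (card B)" using B by simp
  let ?v = "sel p B *\<^sub>v v"
  have sv: "?v \<in> supp_in p B" by (rule sel_supp_in[OF B(1) v])
  have "V\<^sup>T *\<^sub>v ?v = 0\<^sub>v r"
  proof (rule eq_vecI)
    fix i assume "i < dim_vec (0\<^sub>v r)"
    then have i: "i < r" by simp
    have "col V i \<bullet> ?v = ((sel p B)\<^sup>T *\<^sub>v col V i) \<bullet> v"
      by (rule scalar_prod_mult_mat_vec[OF c colV vk])
    also have "\<dots> = 0" using orth i by blast
    finally show "(V\<^sup>T *\<^sub>v ?v) $ i = 0\<^sub>v r $ i" using i V(1) by simp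
  qed (use V in simp)
  then have "R *\<^sub>v ?v = ?v" by (rule R_fixes_orthogonal[OF supp_inD[OF sv]])
  then have "v \<bullet> (submatrix S B B *\<^sub>v v) = ?v \<bullet> (W *\<^sub>v ?v)"
    unfolding submatrix_bilinear[OF S(1) B(1) B(1) v v] S_bilinear[OF supp_inD[OF sv] supp_inD[OF sv]] by simp
  also have "\<dots> \<le> (1 + 3 / 2 * \<eta>) * (?v \<bullet> ?v)"
  proof -
    have "?v \<bullet> (W *\<^sub>v ?v) - ?v \<bullet> ?v \<le> 3 / 2 * \<eta> * (?v \<bullet> ?v)"
      using B by (intro abs_le_D1[OF gram_2k[OF B(1) _ sv]]) simp
    then show ?thesis by (simp add: algebra_simps)
  qed
  also have "?v \<bullet> ?v = v \<bullet> v" by (rule sel_isometry[OF B(1) v])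
  finally show "v \<bullet> (submatrix S B B *\<^sub>v v) \<le> (1 + 3 / 2 * \<eta>) * (v \<bullet> v)" .
qed

end

text \<open>The square root of L is at most 2 + 2 sqrt lam. Each of the two terms is charged to a
  quarter of lam / \<tau>: the constant one by the hypothesis on \<open>\<eta>\<close>, which is
  linear in lam, the other by a bound on \<open>\<eta>\<close> of order sqrt lam.\<close>

lemma threshold_below_signal:
  fixes \<eta> \<tau> \<gamma>2 lam L :: real
  assumes \<eta>: "0 < \<eta>" "\<eta> \<le> 1 / 10" and \<tau>: "\<tau> \<ge> 1" and \<gamma>2: "\<gamma>2 \<ge> 8" and lam: "lam > 0"
    and le: "\<eta> \<le> lam / (64 * \<tau>\<^sup>2 * \<gamma>2\<^sup>2)" and L: "0 \<le> L" "L \<le> 2 * (1 + lam)"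
  shows "1 + \<gamma>2 * sqrt L * \<eta> \<le> (1 - \<eta>) * (1 + 3 / 4 * (lam / \<tau>))"
proof -
  have g: "\<gamma>2 > 0" "\<tau> > 0" using \<gamma>2 \<tau> by auto
  have "sqrt L \<le> sqrt ((2 + 2 * sqrt lam)\<^sup>2)"
  proof (rule real_sqrt_le_mono)
    have e: "(2 + 2 * sqrt lam)\<^sup>2 = 4 + 4 * lam + 8 * sqrt lam"
      using lam by (simp add: power2_sum power_mult_distrib)
    obtain s where s: "sqrt lam = s" "0 \<le> s" using lam by simp
    show "L \<le> (2 + 2 * sqrt lam)\<^sup>2" 
      unfolding e unfolding s(1) using L(2)[unfolded distrib_left] lam s(2) by linarith
  qed
  then have sL: "sqrt L \<le> 2 + 2 * sqrt lam" using lam by simp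
  have "sqrt \<eta> \<le> sqrt (lam / (64 * \<tau>\<^sup>2 * \<gamma>2\<^sup>2))" by (rule real_sqrt_le_mono[OF le])
  also have "\<dots> = sqrt lam / (8 * \<tau> * \<gamma>2)"
  proof -
    have "64 * \<tau>\<^sup>2 * \<gamma>2\<^sup>2 = (8 * \<tau> * \<gamma>2)\<^sup>2" by (simp add: power_mult_distrib)
    then show ?thesis using g by (simp add: real_sqrt_divide real_sqrt_mult)
  qed
  finally have s\<eta>: "sqrt \<eta> \<le> sqrt lam / (8 * \<tau> * \<gamma>2)" .
  \<comment> \<open>Interpolating between \<open>\<eta>\<close> \<le> 1 and the linear hypothesis
    gives the order sqrt lam. For large lam this is what pays for the growth of the threshold, and
    it fixes the square of 8 \<tau> \<gamma>2 in the hypothesis.\<close>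
  have "\<eta> = sqrt \<eta> * sqrt \<eta>" using \<eta> by simp
  also have "\<dots> \<le> (sqrt lam / (8 * \<tau> * \<gamma>2)) * 1"
    using s\<eta> \<eta> lam g by (intro mult_mono) auto
  finally have \<eta>1: "\<eta> \<le> sqrt lam / (8 * \<tau> * \<gamma>2)" by simp
  have "\<gamma>2 * (2 * sqrt lam) * \<eta> \<le> \<gamma>2 * (2 * sqrt lam) * (sqrt lam / (8 * \<tau> * \<gamma>2))"
    using g lam by (intro mult_left_mono[OF \<eta>1]) auto
  also have "\<dots> = 1 / 4 * (lam / \<tau>)" using g lam by (simp add: field_simps)
  finally have 1: "\<gamma>2 * (2 * sqrt lam) * \<eta> \<le> 1 / 4 * (lam / \<tau>)" .
  \<comment> \<open>Besides the constant term of the threshold this covers the \<open>\<eta>\<close>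
    lost in the factor 1 - \<open>\<eta>\<close> on the right.\<close>
  have "(1 + 2 * \<gamma>2) * \<eta> \<le> 3 * \<gamma>2 * (lam / (64 * \<tau>\<^sup>2 * \<gamma>2\<^sup>2))"
    using \<gamma>2 \<eta> le by (intro mult_mono) auto
  also have "\<dots> = (lam / \<tau>) * (3 / (64 * \<tau> * \<gamma>2))" using g by (simp add: field_simps power2_eq_square)
  also have "\<dots> \<le> (lam / \<tau>) * (1 / 4)"
  proof (rule mult_left_mono)
    have "1 * 8 \<le> \<tau> * \<gamma>2" using \<tau> \<gamma>2 by (intro mult_mono) auto
    then show "3 / (64 * \<tau> * \<gamma>2) \<le> 1 / 4" using g by (simp add: field_simps)
  qed (use lam g in simp)
  finally have 2: "(1 + 2 * \<gamma>2) * \<eta> \<le> 1 / 4 * (lam / \<tau>)" by simp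
  have "\<gamma>2 * sqrt L * \<eta> \<le> \<gamma>2 * (2 + 2 * sqrt lam) * \<eta>"
    using sL g \<eta> by (intro mult_right_mono mult_left_mono) auto
  then have "1 + \<gamma>2 * sqrt L * \<eta> \<le> 1 - \<eta> + 1 / 2 * (lam / \<tau>)"
    using 1 2 by (simp add: algebra_simps)
  \<comment> \<open>9/10 * 3/4 exceeds 1/2.\<close>
  also have "\<dots> \<le> 1 - \<eta> + (1 - \<eta>) * (3 / 4) * (lam / \<tau>)"
    using \<eta> lam g by (intro add_left_mono mult_right_mono) auto
  also have "\<dots> = (1 - \<eta>) * (1 + 3 / 4 * (lam / \<tau>))" by (simp only: distrib_left mult.assoc mult_1_right)
  finally show ?thesis .
qed

context spiked_covariance
begin

lemma VT_norm_le:
  assumes v: "v \<in> carrier_vec p"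
  shows "(V\<^sup>T *\<^sub>v v) \<bullet> (V\<^sup>T *\<^sub>v v) \<le> v \<bullet> v"
proof -
  let ?y = "V\<^sup>T *\<^sub>v v"
  have y: "?y \<in> carrier_vec r" by (rule mult_mat_vec_carrier[OF V(2) v])
  have Vy: "V *\<^sub>v ?y \<in> carrier_vec p" by (rule mult_mat_vec_carrier[OF V(1) y])
  have "(vnorm ?y)\<^sup>2 = v \<bullet> (V *\<^sub>v ?y)" unfolding vnorm_sq V_adjoint[OF v y] ..
  also have "\<dots> \<le> vnorm v * vnorm (V *\<^sub>v ?y)" using Cauchy_Schwarz_vec[OF v Vy] by linarith
  also have "vnorm (V *\<^sub>v ?y) = vnorm ?y" by (simp add: vnorm_def V_isometry[OF y])
  finally have "vnorm ?y * vnorm ?y \<le> vnorm v * vnorm ?y" by (simp add: power2_eq_square)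
  then have "vnorm ?y \<le> vnorm v"
    using vnorm_nonneg[of ?y] vnorm_nonneg[of v] by (cases "vnorm ?y = 0") auto
  then have "(vnorm ?y)\<^sup>2 \<le> (vnorm v)\<^sup>2" by (intro power_mono vnorm_nonneg)
  then show ?thesis by (simp only: vnorm_sq)
qed

lemma Sig_quadratic_bounds:
  assumes v: "v \<in> carrier_vec p" and ls: "\<And>i. i < r \<Longrightarrow> a \<le> ls i \<and> ls i \<le> b" and b: "b \<ge> 0"
  shows "v \<bullet> v + a * ((V\<^sup>T *\<^sub>v v) \<bullet> (V\<^sup>T *\<^sub>v v)) \<le> v \<bullet> (Sig *\<^sub>v v)"
    and "v \<bullet> (Sig *\<^sub>v v) \<le> (1 + b) * (v \<bullet> v)"
proof -
  let ?y = "V\<^sup>T *\<^sub>v v"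
  have y: "?y \<in> carrier_vec r" by (rule mult_mat_vec_carrier[OF V(2) v])
  have yy: "?y \<bullet> ?y = (\<Sum>i<r. (?y $ i)\<^sup>2)" using carrier_vecD[OF y]
    by (simp add: scalar_prod_def lessThan_atLeast0 power2_eq_square del: index_mult_mat_vec)
  have "a * (?y \<bullet> ?y) \<le> (\<Sum>i<r. ls i * (?y $ i)\<^sup>2)"
    unfolding yy sum_distrib_left using ls by (intro sum_mono mult_right_mono) auto
  then show "v \<bullet> v + a * (?y \<bullet> ?y) \<le> v \<bullet> (Sig *\<^sub>v v)" unfolding spike_quadratic[OF v] by simp
  have "(\<Sum>i<r. ls i * (?y $ i)\<^sup>2) \<le> b * (?y \<bullet> ?y)"
    unfolding yy sum_distrib_left using ls by (intro sum_mono mult_right_mono) auto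
  also have "\<dots> \<le> b * (v \<bullet> v)" using VT_norm_le[OF v] b by (rule mult_left_mono)
  finally show "v \<bullet> (Sig *\<^sub>v v) \<le> (1 + b) * (v \<bullet> v)" unfolding spike_quadratic[OF v] by (simp add: algebra_simps)
qed

end

section \<open>The spike seen through an arbitrary member of the collection\<close>

locale spiked_signal = spiked_event +
  fixes \<tau> \<gamma>2 lam :: real and B :: "nat set"
  assumes \<tau>: "\<tau> \<ge> 1" and \<gamma>2: "\<gamma>2 \<ge> 8" and lam: "lam > 0"
    and ls_bounds: "\<And>i. i < r \<Longrightarrow> lam / \<tau> \<le> ls i \<and> ls i \<le> lam"
    and signal: "\<eta> \<le> lam / (64 * \<tau>\<^sup>2 * \<gamma>2\<^sup>2)"
    and rk: "r \<le> k"
    and B_in_BB: "B \<in> BB k n p \<gamma>1 S"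
begin

lemma B: "B \<subseteq> {..<p}" "card B = k"
  using B_in_BB by (auto simp: BB_def)

lemma spectral_norm_pad_le: "spectral_norm (pad_id p S B) \<le> 2 * (1 + lam)"
proof (rule spectral_norm_symmetric_le[OF pad_id_carrier pad_id_transpose[OF S]])
  show "0 \<le> 2 * (1 + lam)" using lam by simp
  fix v :: "real Matrix.vec" assume v: "v \<in> carrier_vec p"
  let ?b = "restr p B v" and ?c = "restr p ({..<p} - B) v"
  have b: "?b \<in> supp_in p B" by (rule restr_supp_in[OF B(1)])
  have cB: "card B \<le> k" using B by simp
  have "?b \<bullet> (S *\<^sub>v ?b) \<le> (1 + 3 / 2 * \<eta>) * (?b \<bullet> (Sig *\<^sub>v ?b))"
    using abs_le_D1[OF S_quadratic_card_k[OF B(1) cB b]] by (simp add: algebra_simps)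
  also have "\<dots> \<le> 2 * ((1 + lam) * (?b \<bullet> ?b))"
    using Sig_quadratic_bounds(2)[OF supp_inD[OF b] ls_bounds] Sig_quadratic_ge[OF supp_inD[OF b]]
      scalar_prod_self_nonneg[of ?b] lam \<eta> by (intro mult_mono) auto
  finally have up: "?b \<bullet> (S *\<^sub>v ?b) \<le> 2 * (1 + lam) * (?b \<bullet> ?b)" by (simp only: mult.assoc)
  have c0: "0 \<le> ?c \<bullet> ?c" "0 \<le> ?b \<bullet> ?b" by (rule scalar_prod_self_nonneg)+
  have lo: "0 \<le> ?b \<bullet> (S *\<^sub>v ?b)" using S_psd(2)[OF B(1) cB b] c0 by simp
  have "1 * (?c \<bullet> ?c) \<le> 2 * (1 + lam) * (?c \<bullet> ?c)" using lam c0 by (intro mult_right_mono) auto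
  then show "\<bar>v \<bullet> (pad_id p S B *\<^sub>v v)\<bar> \<le> 2 * (1 + lam) * (v \<bullet> v)"
    unfolding pad_id_quadratic(1)[OF S(1) B(1) v] restr_norm_split[OF v B(1)]
    using up lo c0 by (simp add: algebra_simps)
qed

text \<open>
  Coordinates of the true support missed by \<open>B\<close> carry little of the spike: on them \<open>S\<close> is
  close to the identity since \<open>B\<close> belongs to \<open>BB\<close>.
\<close>

lemma missed_spike_small:
  assumes u: "u \<in> supp_in p (J - B)"
  shows "(V\<^sup>T *\<^sub>v u) \<bullet> (V\<^sup>T *\<^sub>v u) \<le> 1 / 4 * (u \<bullet> u)"
proof -
  let ?D = "J - B" and ?y = "V\<^sup>T *\<^sub>v u"
  have g: "\<gamma>2 > 0" "\<tau> > 0" using \<gamma>2 \<tau> by auto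
  have D: "?D \<subseteq> {..<p}" "?D \<subseteq> {..<p} - B" using J by auto
  have cD: "card ?D \<le> k" using J by (metis D(1) Diff_subset card_mono finite_lessThan finite_subset)
  have u0: "0 \<le> u \<bullet> u" by (rule scalar_prod_self_nonneg)
  have "\<bar>u \<bullet> ((pad_id p S ?D - 1\<^sub>m p) *\<^sub>v u)\<bar> \<le> spectral_norm (pad_id p S ?D - 1\<^sub>m p) * (u \<bullet> u)"
    by (rule quadratic_le_spectral_norm[OF minus_carrier_mat[OF one_carrier_mat] supp_inD[OF u]])
  also have "\<dots> \<le> \<eta> * (u \<bullet> u)"
  proof (rule mult_right_mono[OF _ u0])
    have "\<forall>D. D \<subseteq> {..<p} - B \<and> card D \<le> k \<longrightarrow> spectral_norm (pad_id p S D - 1\<^sub>m p) \<le> eta (card D) n p \<gamma>1"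
      using B_in_BB unfolding BB_def by blast
    then show "spectral_norm (pad_id p S ?D - 1\<^sub>m p) \<le> \<eta>"
      using D(2) cD eta_bounds[OF cD] order_trans by blast
  qed
  finally have "u \<bullet> (S *\<^sub>v u) \<le> (1 + \<eta>) * (u \<bullet> u)"
    unfolding pad_id_quadratic_supp(2)[OF S(1) D(1) u] by (simp add: algebra_simps)
  moreover have "(1 - \<eta>) * (u \<bullet> (Sig *\<^sub>v u)) \<le> u \<bullet> (S *\<^sub>v u)"
    by (rule S_quadratic_supp_J[OF supp_in_mono[OF u]]) auto
  moreover have "(1 - \<eta>) * (u \<bullet> u + lam / \<tau> * (?y \<bullet> ?y)) \<le> (1 - \<eta>) * (u \<bullet> (Sig *\<^sub>v u))"
    using Sig_quadratic_bounds(1)[OF supp_inD[OF u] ls_bounds] lam \<eta> by (intro mult_left_mono) auto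
  ultimately have "(1 - \<eta>) * (u \<bullet> u + lam / \<tau> * (?y \<bullet> ?y)) \<le> (1 + \<eta>) * (u \<bullet> u)" by linarith
  \<comment> \<open>The noise parts of the two bounds nearly cancel, so what is left of the spike is
    of order \<open>\<eta>\<close>; the signal hypothesis makes this small against lam /
    \<tau>.\<close>
  then have 1: "(1 - \<eta>) * (lam / \<tau> * (?y \<bullet> ?y)) \<le> 2 * \<eta> * (u \<bullet> u)" by (simp add: algebra_simps)
  have y0: "0 \<le> lam / \<tau> * (?y \<bullet> ?y)" using lam g scalar_prod_self_nonneg[of ?y] by simp
  have "1 / 2 * (lam / \<tau> * (?y \<bullet> ?y)) \<le> (1 - \<eta>) * (lam / \<tau> * (?y \<bullet> ?y))"
    using \<eta> by (intro mult_right_mono[OF _ y0]) auto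
  then have "lam / \<tau> * (?y \<bullet> ?y) \<le> 4 * \<eta> * (u \<bullet> u)" using 1 by linarith
  also have "\<dots> \<le> 4 * (lam / (64 * \<tau>\<^sup>2 * \<gamma>2\<^sup>2)) * (u \<bullet> u)"
    by (intro mult_right_mono[OF _ u0] mult_left_mono[OF signal]) simp
  also have "\<dots> = lam / \<tau> * ((1 / (16 * \<tau> * \<gamma>2\<^sup>2)) * (u \<bullet> u))"
    using g by (simp add: field_simps power2_eq_square)
  finally have "?y \<bullet> ?y \<le> (1 / (16 * \<tau> * \<gamma>2\<^sup>2)) * (u \<bullet> u)"
    using lam g by (simp only: mult_le_cancel_left_pos[OF divide_pos_pos])
  also have "\<dots> \<le> 1 / 4 * (u \<bullet> u)"
  proof (rule mult_right_mono[OF _ u0])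
    have "1 * 1 \<le> \<tau> * \<gamma>2\<^sup>2" using \<tau> \<gamma>2 by (intro mult_mono one_le_power) auto
    then show "1 / (16 * \<tau> * \<gamma>2\<^sup>2) \<le> 1 / 4" using g by (simp add: field_simps)
  qed
  finally show ?thesis .
qed

text \<open>Let b = V a, with parts w on B and u on the missed coordinates. Each part x satisfies
  x.x = x.b = (V'x).a, so Cauchy-Schwarz applies to both. For u, smallness of V'u gives an upper
  bound on u and so a lower bound on w; for w the same inequality, read backwards, shows that V'w is
  large.\<close>

lemma restricted_spike_directions:
  assumes a: "a \<in> carrier_vec r"
  defines "w \<equiv> restr p B (V *\<^sub>v a)"
  shows "3 / 4 * (a \<bullet> a) \<le> w \<bullet> w" "3 / 4 * (w \<bullet> w) \<le> (V\<^sup>T *\<^sub>v w) \<bullet> (V\<^sup>T *\<^sub>v w)"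
proof -
  let ?b = "V *\<^sub>v a" and ?u = "restr p (J - B) (V *\<^sub>v a)"
  have b: "?b \<in> supp_in p J" by (rule V_mult_supp_in[OF a J(3)])
  have bc: "?b \<in> carrier_vec p" by (rule supp_inD[OF b])
  have w: "w \<in> carrier_vec p" by (simp add: w_def restr_def)
  have D: "J - B \<subseteq> {..<p}" using J by auto
  have u: "?u \<in> supp_in p (J - B)" by (rule restr_supp_in[OF D])
  have "restr p ({..<p} - B) ?b = ?u"
    using b by (intro eq_vecI) (auto simp: restr_def supp_in_def simp del: index_mult_mat_vec)
  then have split: "a \<bullet> a = w \<bullet> w + ?u \<bullet> ?u"
    using restr_norm_split[OF bc B(1)] V_isometry[OF a] by (simp add: w_def)
  have sq: "(x \<bullet> x)\<^sup>2 \<le> ((V\<^sup>T *\<^sub>v x) \<bullet> (V\<^sup>T *\<^sub>v x)) * (a \<bullet> a)"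
    if x: "x \<in> carrier_vec p" "x \<bullet> x = x \<bullet> ?b" for x
  proof -
    have y: "V\<^sup>T *\<^sub>v x \<in> carrier_vec r" by (rule mult_mat_vec_carrier[OF V(2) x(1)])
    have "\<bar>x \<bullet> x\<bar> \<le> vnorm (V\<^sup>T *\<^sub>v x) * vnorm a"
      unfolding x(2) V_adjoint[OF x(1) a] by (rule Cauchy_Schwarz_vec[OF y a])
    then have "\<bar>x \<bullet> x\<bar>\<^sup>2 \<le> (vnorm (V\<^sup>T *\<^sub>v x) * vnorm a)\<^sup>2" by (intro power_mono) auto
    then show ?thesis by (simp add: power_mult_distrib vnorm_sq)
  qed
  have nn: "0 \<le> a \<bullet> a" "0 \<le> ?u \<bullet> ?u" "0 \<le> w \<bullet> w" by (rule scalar_prod_self_nonneg)+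
  have ub: "?u \<bullet> ?u = ?u \<bullet> ?b" and wb: "w \<bullet> w = w \<bullet> ?b"
    unfolding w_def using scalar_prod_restr(2)[OF bc bc] by auto
  have "(?u \<bullet> ?u)\<^sup>2 \<le> ((V\<^sup>T *\<^sub>v ?u) \<bullet> (V\<^sup>T *\<^sub>v ?u)) * (a \<bullet> a)" by (rule sq[OF supp_inD[OF u] ub])
  also have "\<dots> \<le> 1 / 4 * (?u \<bullet> ?u) * (a \<bullet> a)" by (intro mult_right_mono missed_spike_small[OF u] nn)
  finally have "?u \<bullet> ?u \<le> 1 / 4 * (a \<bullet> a)"
    using nn by (cases "?u \<bullet> ?u = 0") (auto simp: power2_eq_square)
  then show 1: "3 / 4 * (a \<bullet> a) \<le> w \<bullet> w" using split by linarith
  let ?z = "(V\<^sup>T *\<^sub>v w) \<bullet> (V\<^sup>T *\<^sub>v w)"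
  have z0: "0 \<le> ?z" by (rule scalar_prod_self_nonneg)
  have "(w \<bullet> w)\<^sup>2 \<le> ?z * (a \<bullet> a)" by (rule sq[OF w wb])
  also have "\<dots> \<le> ?z * (4 / 3 * (w \<bullet> w))" using 1 z0 by (intro mult_left_mono) auto
  finally show "3 / 4 * (w \<bullet> w) \<le> ?z"
    using nn z0 by (cases "w \<bullet> w = 0") (auto simp: power2_eq_square)
qed

text \<open>The test space consists of the vectors V a restricted to B. It has dimension r since
  restriction keeps 3/4 of the squared length, and on it the spike contributes at least 3/4 of lam /
  \<tau>.\<close>

lemma sing_val_signal:
  assumes r: "r \<ge> 1"
  shows "1 + \<gamma>2 * sqrt (spectral_norm (pad_id p S B)) * eta k n p \<gamma>1 \<le> sing_val r (submatrix S B B)"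
proof -
  let ?F = "(sel p B)\<^sup>T * V"
  have cT: "(sel p B)\<^sup>T \<in> carrier_mat k p" using sel_carrier[of p B] B by simp
  have F: "?F \<in> carrier_mat k r" by (rule mult_carrier_mat[OF cT V(1)])
  have g: "\<tau> > 0" using \<tau> by simp
  have L: "0 \<le> spectral_norm (pad_id p S B)" using spectral_norm_pad_ge[OF B] by simp
  note thr = threshold_below_signal[OF \<eta> \<tau> \<gamma>2 lam signal L spectral_norm_pad_le]
  have Fa: "?F *\<^sub>v a \<in> carrier_vec (card B)" "sel p B *\<^sub>v (?F *\<^sub>v a) = restr p B (V *\<^sub>v a)"
    "(?F *\<^sub>v a) \<bullet> (?F *\<^sub>v a) = restr p B (V *\<^sub>v a) \<bullet> restr p B (V *\<^sub>v a)" if a: "a \<in> carrier_vec r" for a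
  proof -
    have Va: "V *\<^sub>v a \<in> carrier_vec p" by (rule mult_mat_vec_carrier[OF V(1) a])
    show c: "?F *\<^sub>v a \<in> carrier_vec (card B)" using mult_mat_vec_carrier[OF F a] B by simp
    have "?F *\<^sub>v a = (sel p B)\<^sup>T *\<^sub>v (V *\<^sub>v a)" by (rule assoc_mult_mat_vec[OF cT V(1) a])
    then show e: "sel p B *\<^sub>v (?F *\<^sub>v a) = restr p B (V *\<^sub>v a)"
      using sel_mult_transpose[OF B(1) Va] by simp
    show "(?F *\<^sub>v a) \<bullet> (?F *\<^sub>v a) = restr p B (V *\<^sub>v a) \<bullet> restr p B (V *\<^sub>v a)"
      using sel_isometry[OF B(1) c] unfolding e ..
  qed
  show ?thesis
  proof (rule sing_val_ge[OF submatrix_BB_props[OF B] r rk F])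
    fix a :: "real Matrix.vec" assume a: "a \<in> carrier_vec r" "a \<noteq> 0\<^sub>v r"
    have "a \<bullet> a \<noteq> 0" using a scalar_prod_self_eq_0 by blast
    then have "(?F *\<^sub>v a) \<bullet> (?F *\<^sub>v a) \<noteq> 0"
      using restricted_spike_directions(1)[OF a(1)] scalar_prod_self_nonneg[of a] unfolding Fa(3)[OF a(1)] by linarith
    then show "?F *\<^sub>v a \<noteq> 0\<^sub>v k" by auto
  next
    fix a :: "real Matrix.vec" assume a: "a \<in> carrier_vec r"
    let ?w = "restr p B (V *\<^sub>v a)"
    let ?z = "(V\<^sup>T *\<^sub>v ?w) \<bullet> (V\<^sup>T *\<^sub>v ?w)"
    \<comment> \<open>Restricting to B does not leave J, so the lower bound with constant 1 -
      \<open>\<eta>\<close> is available.\<close>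
    have w: "?w \<in> supp_in p J"
      using V_mult_supp_in[OF a J(3)] by (auto simp: restr_def supp_in_def simp del: index_mult_mat_vec)
    have w0: "0 \<le> ?w \<bullet> ?w" by (rule scalar_prod_self_nonneg)
    have "(1 + \<gamma>2 * sqrt (spectral_norm (pad_id p S B)) * \<eta>) * (?w \<bullet> ?w)
        \<le> (1 - \<eta>) * (1 + 3 / 4 * (lam / \<tau>)) * (?w \<bullet> ?w)"
      by (rule mult_right_mono[OF thr w0])
    also have "\<dots> = (1 - \<eta>) * (?w \<bullet> ?w + lam / \<tau> * (3 / 4 * (?w \<bullet> ?w)))" by (simp add: algebra_simps)
    also have "\<dots> \<le> (1 - \<eta>) * (?w \<bullet> ?w + lam / \<tau> * ?z)"
      using restricted_spike_directions(2)[OF a] \<eta> lam g by (intro mult_left_mono add_left_mono) auto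
    also have "\<dots> \<le> (1 - \<eta>) * (?w \<bullet> (Sig *\<^sub>v ?w))"
      using Sig_quadratic_bounds(1)[OF supp_inD[OF w] ls_bounds] lam \<eta> by (intro mult_left_mono) auto
    also have "\<dots> \<le> ?w \<bullet> (S *\<^sub>v ?w)" by (rule S_quadratic_supp_J[OF w])
    also have "\<dots> = (?F *\<^sub>v a) \<bullet> (submatrix S B B *\<^sub>v (?F *\<^sub>v a))"
      unfolding submatrix_bilinear[OF S(1) B(1) B(1) Fa(1)[OF a] Fa(1)[OF a]] Fa(2)[OF a] ..
    finally show "(1 + \<gamma>2 * sqrt (spectral_norm (pad_id p S B)) * eta k n p \<gamma>1) * ((?F *\<^sub>v a) \<bullet> (?F *\<^sub>v a))
      \<le> (?F *\<^sub>v a) \<bullet> (submatrix S B B *\<^sub>v (?F *\<^sub>v a))"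
      unfolding Fa(3)[OF a] \<eta>_def[symmetric] .
  qed
qed

lemma rank_estimate_correct: "rank_estimate k n p \<gamma>1 \<gamma>2 S B = r"
proof -
  let ?L = "spectral_norm (pad_id p S B)"
  let ?A = "{l \<in> {1..k}. sing_val l (submatrix S B B) \<ge> 1 + \<gamma>2 * sqrt ?L * eta k n p \<gamma>1}"
  \<comment> \<open>The spectral norm is at least 1/2, so the threshold exceeds 1 by at least 4
    \<open>\<eta>\<close>, while noise singular values exceed 1 by at most 3/2
    \<open>\<eta>\<close>.\<close>
  have "sqrt (1 / 4) \<le> sqrt ?L" using spectral_norm_pad_ge[OF B] by (intro real_sqrt_le_mono) simp
  then have "1 / 2 \<le> sqrt ?L" by (simp add: real_sqrt_divide)
  then have "8 * (1 / 2) \<le> \<gamma>2 * sqrt ?L" using \<gamma>2 by (intro mult_mono) auto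
  then have "4 * \<eta> \<le> \<gamma>2 * sqrt ?L * \<eta>" using \<eta> by (intro mult_right_mono) auto
  then have thr: "1 + 3 / 2 * \<eta> < 1 + \<gamma>2 * sqrt ?L * eta k n p \<gamma>1" using \<eta> \<eta>_def by simp
  have le: "l \<le> r" if "l \<in> ?A" for l
    using sing_val_noise[OF B, of l] that thr by (cases "r < l") auto
  have "Max (insert 0 ?A) = r"
  proof (rule Max_eqI)
    \<comment> \<open>For r = 0 there is no signal, and the inserted 0 is the maximum.\<close>
    show "r \<in> insert 0 ?A" using sing_val_signal rk by (cases "r = 0") auto
  qed (use le in auto)
  then show ?thesis using B_in_BB unfolding rank_estimate_def by auto
qed

end

section \<open>Probability of the good event\<close>

definition log_ratio :: "nat \<Rightarrow> nat \<Rightarrow> real" where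
  "log_ratio p m = ln (exp 1 * real p / real m)"

lemma log_ratio_eq: "1 \<le> m \<Longrightarrow> m \<le> p \<Longrightarrow> log_ratio p m = 1 + ln (real p) - ln (real m)"
  by (simp add: log_ratio_def ln_div ln_mult)

lemma log_ratio_ge_1: "1 \<le> m \<Longrightarrow> m \<le> p \<Longrightarrow> log_ratio p m \<ge> 1"
  by (simp add: log_ratio_eq)

text \<open>The function x log(e p / x) increases up to x = p; here this follows from ln y \<le> y -
  1 at y = k / m together with \<open>log_ratio p k\<close> \<ge> 1.\<close>

lemma mult_log_ratio_mono:
  assumes "1 \<le> m" "m \<le> k" "k \<le> p"
  shows "real m * log_ratio p m \<le> real k * log_ratio p k"
proof -
  have k: "log_ratio p k \<ge> 1" using assms by (intro log_ratio_ge_1) auto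
  have "ln (real k / real m) \<le> real k / real m - 1" using assms by (intro ln_le_minus_one) simp
  then have "real m * (ln (real k) - ln (real m)) \<le> real m * (real k / real m - 1)"
    using assms by (intro mult_left_mono) (auto simp: ln_div)
  also have "\<dots> = (real k - real m) * 1" using assms by (simp add: field_simps)
  also have "\<dots> \<le> (real k - real m) * log_ratio p k" using assms k by (intro mult_left_mono) auto
  finally show ?thesis using assms by (simp add: log_ratio_eq algebra_simps)
qed

lemma mult_log_ratio_double:
  assumes "1 \<le> m" "m \<le> 2 * k" "1 \<le> k" "k \<le> p" "m \<le> p"
  shows "real m * log_ratio p m \<le> 2 * (real k * log_ratio p k)"
proof (cases "m \<le> k")
  case True
  have "0 \<le> real k * log_ratio p k" using log_ratio_ge_1[of k p] assms by simp
  then show ?thesis using mult_log_ratio_mono[OF assms(1) True assms(4)] by simp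
next
  case False
  then have "log_ratio p m \<le> log_ratio p k" using assms by (simp add: log_ratio_eq)
  then have "real m * log_ratio p m \<le> real (2 * k) * log_ratio p k"
    using assms log_ratio_ge_1[of m p] by (intro mult_mono) auto
  then show ?thesis by simp
qed

lemma eta_root_eq:
  assumes "1 \<le> m" "m \<le> p" "\<gamma>1 \<ge> 0"
  shows "eta_root m n p \<gamma>1 = sqrt (real m / real n) * (1 + sqrt (\<gamma>1 * log_ratio p m))"
proof -
  have "\<gamma>1 / real n * real m * ln (exp 1 * real p / real m) = (real m / real n) * (\<gamma>1 * log_ratio p m)"
    by (simp add: log_ratio_def)
  then show ?thesis unfolding eta_root_def by (simp only: real_sqrt_mult distrib_left mult_1_right)
qed

lemma eta_root_pos:
  assumes "1 \<le> m" "m \<le> p" "\<gamma>1 \<ge> 0" "n \<ge> 1"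
  shows "eta_root m n p \<gamma>1 > 0"
  unfolding eta_root_eq[OF assms(1-3)] using assms log_ratio_ge_1[OF assms(1,2)]
  by (intro mult_pos_pos add_pos_nonneg) auto

lemma eta_root_le:
  assumes "1 \<le> m" "m \<le> p" "\<gamma>1 \<ge> 1" "n \<ge> 1"
  shows "eta_root m n p \<gamma>1 \<le> 2 * sqrt \<gamma>1 * sqrt (real m * log_ratio p m / real n)"
proof -
  have "1 * 1 \<le> \<gamma>1 * log_ratio p m" using assms log_ratio_ge_1[OF assms(1,2)] by (intro mult_mono) auto
  then have "1 \<le> sqrt (\<gamma>1 * log_ratio p m)" by simp
  then have "eta_root m n p \<gamma>1 \<le> sqrt (real m / real n) * (2 * sqrt (\<gamma>1 * log_ratio p m))"
    using assms by (subst eta_root_eq) (auto intro!: mult_left_mono)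
  also have "\<dots> = 2 * sqrt \<gamma>1 * sqrt (real m / real n * log_ratio p m)" by (simp only: real_sqrt_mult mult_ac)
  finally show ?thesis by simp
qed

lemma eta_root_mono_factor:
  assumes "1 \<le> m" "m \<le> p" "1 \<le> k" "k \<le> p" "\<gamma>1 \<ge> 0" "n \<ge> 1" "c \<ge> 0"
    and "real m \<le> c * real k" "real m * log_ratio p m \<le> c * (real k * log_ratio p k)"
  shows "eta_root m n p \<gamma>1 \<le> sqrt c * eta_root k n p \<gamma>1"
proof -
  have "sqrt (real m / real n) \<le> sqrt (c * (real k / real n))"
    using assms by (intro real_sqrt_le_mono) (simp add: divide_right_mono)
  moreover have "sqrt (\<gamma>1 / real n * (real m * log_ratio p m)) \<le> sqrt (c * (\<gamma>1 / real n * (real k * log_ratio p k)))"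
  proof (rule real_sqrt_le_mono)
    have "\<gamma>1 / real n * (real m * log_ratio p m) \<le> \<gamma>1 / real n * (c * (real k * log_ratio p k))"
      using assms by (intro mult_left_mono) auto
    then show "\<gamma>1 / real n * (real m * log_ratio p m) \<le> c * (\<gamma>1 / real n * (real k * log_ratio p k))"
      by (simp only: mult_ac)
  qed
  ultimately show ?thesis
    unfolding eta_root_def log_ratio_def[symmetric] mult.assoc by (simp only: real_sqrt_mult distrib_left add_mono)
qed

lemma eta_root_mono:
  assumes "1 \<le> m" "m \<le> k" "k \<le> p" "\<gamma>1 \<ge> 0" "n \<ge> 1"
  shows "eta_root m n p \<gamma>1 \<le> eta_root k n p \<gamma>1"
  using eta_root_mono_factor[of m p k \<gamma>1 n 1] mult_log_ratio_mono[of m k p] assms by simp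

lemma eta_nonneg_mono:
  assumes "m \<le> k" "1 \<le> k" "k \<le> p" "\<gamma>1 \<ge> 0" "n \<ge> 1"
  shows "0 \<le> eta m n p \<gamma>1" "eta m n p \<gamma>1 \<le> eta k n p \<gamma>1"
proof -
  have k: "eta_root k n p \<gamma>1 > 0" using assms by (intro eta_root_pos) auto
  have m: "m \<noteq> 0 \<Longrightarrow> eta_root m n p \<gamma>1 > 0" using assms by (intro eta_root_pos) auto
  show "0 \<le> eta m n p \<gamma>1" using m by (auto simp: eta_def)
  show "eta m n p \<gamma>1 \<le> eta k n p \<gamma>1"
  proof (cases "m = 0")
    case True
    then show ?thesis using k assms by (simp add: eta_def)
  next
    case False
    then have "eta_root m n p \<gamma>1 \<le> eta_root k n p \<gamma>1" using assms by (intro eta_root_mono) auto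
    moreover have "(eta_root m n p \<gamma>1)\<^sup>2 \<le> (eta_root k n p \<gamma>1)\<^sup>2"
      using calculation m[OF False] by (intro power_mono) auto
    ultimately show ?thesis using False assms by (simp add: eta_def)
  qed
qed

text \<open>Doubling the number of columns costs sqrt 2 \<le> 3/2, and \<open>eta\<close> dominates
  twice \<open>eta_root\<close>. This is the bound for the union of two sets of size k.\<close>

lemma eta_root_double:
  assumes "1 \<le> m" "m \<le> 2 * k" "1 \<le> k" "k \<le> p" "m \<le> p" "\<gamma>1 \<ge> 0" "n \<ge> 1"
  shows "2 * eta_root m n p \<gamma>1 \<le> 3 / 2 * eta k n p \<gamma>1"
proof -
  have k: "eta_root k n p \<gamma>1 > 0" using assms by (intro eta_root_pos) auto
  have "eta_root m n p \<gamma>1 \<le> sqrt 2 * eta_root k n p \<gamma>1"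
    using assms mult_log_ratio_double[of m k p] by (intro eta_root_mono_factor) auto
  also have "sqrt 2 \<le> 3 / 2" by (rule real_le_lsqrt) (auto simp: power2_eq_square)
  then have "sqrt 2 * eta_root k n p \<gamma>1 \<le> 3 / 2 * eta_root k n p \<gamma>1" using k by (intro mult_right_mono) auto
  finally have "2 * eta_root m n p \<gamma>1 \<le> 3 / 2 * (2 * eta_root k n p \<gamma>1)" by simp
  also have "\<dots> \<le> 3 / 2 * eta k n p \<gamma>1" using assms by (simp add: eta_def)
  finally show ?thesis .
qed

section \<open>Union bound estimates\<close>

lemma binomial_le_exp_log_ratio:
  assumes "1 \<le> m" "m \<le> p"
  shows "real (p choose m) \<le> exp (real m * log_ratio p m)"
proof -
  \<comment> \<open>Keeping one term of the binomial expansion of (1 + x)^p at x = m / p gives the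
    bound (e p / m)^m.\<close>
  define x where "x = real m / real p"
  have x: "x > 0" using assms by (simp add: x_def)
  have "real (p choose m) * x ^ m \<le> (\<Sum>i\<le>p. real (p choose i) * x ^ i * 1 ^ (p - i))"
    using assms x by (intro order_trans[OF _ member_le_sum[of m]]) auto
  also have "\<dots> = (x + 1) ^ p" by (rule binomial_ring[symmetric])
  also have "\<dots> \<le> exp x ^ p" using exp_ge_add_one_self[of x] x by (intro power_mono) (auto simp: add.commute)
  also have "\<dots> = exp (real m)" using assms by (simp add: x_def flip: exp_of_nat_mult)
  finally have "real (p choose m) \<le> exp (real m) / x ^ m" using x by (simp add: field_simps)
  also have "\<dots> = (exp 1 / x) ^ m" by (simp add: power_divide flip: exp_of_nat_mult)
  also have "exp 1 / x = exp (log_ratio p m)" using assms by (simp add: log_ratio_def x_def)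
  also have "\<dots> ^ m = exp (real m * log_ratio p m)" by (simp flip: exp_of_nat_mult)
  finally show ?thesis .
qed

text \<open>m log(e p / m) is at least ln p + m / 2. The first part yields the power of p common to
  all m, the second a geometric factor that makes the sum over m converge.\<close>

lemma exp_log_ratio_tail:
  assumes m: "1 \<le> m" "m \<le> p" and q: "q \<ge> 4"
  shows "exp (- q * (real m * log_ratio p m)) \<le> real p powr (- q) * (1 / 4) ^ m"
proof -
  have "ln (real m / 2) \<le> real m / 2 - 1" using m by (intro ln_le_minus_one) simp
  then have "ln (real m) \<le> real m / 2 - 1 + ln 2" using m by (simp add: ln_div)
  then have lm: "ln (real m) \<le> real m / 2" using ln_2_less_1 by linarith
  have "0 \<le> (real m - 1) * (ln (real p) - ln (real m))" using m by (intro mult_nonneg_nonneg) auto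
  then have "real m * log_ratio p m \<ge> ln (real p) + real m / 2"
    using m lm by (simp add: log_ratio_eq algebra_simps)
  then have "- q * (real m * log_ratio p m) \<le> - q * (ln (real p) + real m / 2)"
    using q by (intro mult_left_mono_neg) auto
  also have "\<dots> \<le> - q * ln (real p) + real m * (- 2)"
  proof -
    have "4 * (real m / 2) \<le> q * (real m / 2)" using q by (intro mult_right_mono) auto
    then show ?thesis by (simp add: algebra_simps)
  qed
  finally have "exp (- q * (real m * log_ratio p m)) \<le> exp (- q * ln (real p)) * exp (- 2) ^ m"
    by (simp flip: exp_add exp_of_nat_mult)
  also have "exp (- q * ln (real p)) = real p powr (- q)" using m by (simp add: powr_def)
  also have "exp (- 2 :: real) \<le> 1 / 4"
  proof -
    have "(1 + 2 / real 2) ^ 2 \<le> exp (2 :: real)" by (rule exp_ge_one_plus_x_over_n_power_n) auto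
    then show ?thesis by (simp add: exp_minus field_simps)
  qed
  then have "real p powr (- q) * exp (- 2) ^ m \<le> real p powr (- q) * (1 / 4) ^ m"
    by (intro mult_left_mono power_mono) auto
  finally show ?thesis .
qed

text \<open>
  The chi-square exponent at relative deviation \<open>2 t\<close> is close to \<open>n t\<^sup>2\<close>, twice what the target
  probability requires. This gap pays for the factor \<open>57 ^ m\<close> of the net; 3/5 is a lower bound
  for what remains of the exponent when the deviation is shrunk by 4/5.
\<close>

lemma net_tail_bound:
  fixes a :: real
  assumes a: "a \<ge> 10"
  shows "57 ^ m * exp (- (3 / 5) * (real m * (1 + sqrt a)\<^sup>2)) \<le> exp (- (real m * a / 2))"
proof -
  have s: "31 / 10 \<le> sqrt a" using a by (intro real_le_rsqrt) (simp add: power2_eq_square)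
  \<comment> \<open>1.5^10 is about 57.67, so the net costs at most exp (5 m).\<close>
  have "(1 + 5 / real 10) ^ 10 \<le> exp (5 :: real)" by (rule exp_ge_one_plus_x_over_n_power_n) auto
  then have e: "57 \<le> exp (5 :: real)" by (simp add: eval_nat_numeral)
  have "5 - 3 / 5 * (1 + sqrt a)\<^sup>2 = 5 - 3 / 5 - 6 / 5 * sqrt a - 3 / 5 * a"
    using a by (simp add: power2_eq_square algebra_simps)
  also have "\<dots> \<le> - (a / 2)" using s a by linarith
  finally have "5 - 3 / 5 * (1 + sqrt a)\<^sup>2 \<le> - (a / 2)" .
  then have "real m * (5 - 3 / 5 * (1 + sqrt a)\<^sup>2) \<le> real m * (- (a / 2))" by (intro mult_left_mono) auto
  then have "exp (real m * 5) * exp (- (3 / 5) * (real m * (1 + sqrt a)\<^sup>2)) \<le> exp (- (real m * a / 2))"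
    by (simp flip: exp_add add: algebra_simps)
  moreover have "57 ^ m \<le> exp (5 :: real) ^ m" using e by (intro power_mono) auto
  then have "57 ^ m \<le> exp (real m * 5)" by (simp flip: exp_of_nat_mult)
  then have "57 ^ m * exp (- (3 / 5) * (real m * (1 + sqrt a)\<^sup>2)) \<le> exp (real m * 5) * exp (- (3 / 5) * (real m * (1 + sqrt a)\<^sup>2))"
    by (intro mult_right_mono) auto
  ultimately show ?thesis by linarith
qed

section \<open>The sample covariance and the bad event\<close>

lemma sample_cov_carrier [simp]: "sample_cov n p x \<in> carrier_mat p p"
  by (auto simp: sample_cov_def data_mat_def)

lemma sample_cov_transpose: "(sample_cov n p x)\<^sup>T = sample_cov n p x"
proof -
  have X: "data_mat n p x \<in> carrier_mat n p" by (simp add: data_mat_def)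
  have "((data_mat n p x)\<^sup>T * data_mat n p x)\<^sup>T = (data_mat n p x)\<^sup>T * data_mat n p x"
    using transpose_mult[of "(data_mat n p x)\<^sup>T" p n "data_mat n p x" p] X by simp
  moreover have "(c \<cdot>\<^sub>m A)\<^sup>T = c \<cdot>\<^sub>m A\<^sup>T" for c and A :: "real mat" by (rule eq_matI) auto
  ultimately show ?thesis unfolding sample_cov_def by simp
qed

lemma sample_cov_quadratic:
  assumes w: "w \<in> carrier_vec p"
  shows "w \<bullet> (sample_cov n p x *\<^sub>v w) = sum_squares n p (\<lambda>i. w $ i) x / real n"
proof -
  let ?X = "data_mat n p x"
  have X: "?X \<in> carrier_mat n p" "?X\<^sup>T \<in> carrier_mat p n" by (auto simp: data_mat_def)
  have Xw: "?X *\<^sub>v w \<in> carrier_vec n" by (rule mult_mat_vec_carrier[OF X(1) w])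
  have XX: "?X\<^sup>T * ?X \<in> carrier_mat p p" by (rule mult_carrier_mat[OF X(2,1)])
  have "sample_cov n p x *\<^sub>v w = (1 / real n) \<cdot>\<^sub>v (?X\<^sup>T *\<^sub>v (?X *\<^sub>v w))"
    unfolding sample_cov_def assoc_mult_mat_vec[OF X(2,1) w, symmetric]
    using w XX by (intro eq_vecI) auto
  then have "w \<bullet> (sample_cov n p x *\<^sub>v w) = (1 / real n) * (w \<bullet> (?X\<^sup>T *\<^sub>v (?X *\<^sub>v w)))"
    using w mult_mat_vec_carrier[OF X(2) Xw] by simp
  also have "w \<bullet> (?X\<^sup>T *\<^sub>v (?X *\<^sub>v w)) = (?X *\<^sub>v w) \<bullet> (?X *\<^sub>v w)"
    using scalar_prod_mult_mat_vec[OF X(2) w Xw] by simp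
  also have "\<dots> = (\<Sum>t<n. ((?X *\<^sub>v w) $ t)\<^sup>2)"
    using carrier_vecD[OF Xw] by (simp add: scalar_prod_def[of "?X *\<^sub>v w"] lessThan_atLeast0 power2_eq_square del: index_mult_mat_vec)
  also have "\<dots> = sum_squares n p (\<lambda>i. w $ i) x"
    using w by (intro sum.cong arg_cong[of _ _ "\<lambda>y. y\<^sup>2"])
      (auto simp: data_mat_def scalar_prod_def lessThan_atLeast0 mult.commute intro!: sum.cong)
  finally show ?thesis by simp
qed

context spiked_covariance
begin

lemma gram_quadratic:
  assumes v: "v \<in> carrier_vec p"
  shows "v \<bullet> ((whiten (sample_cov n p x) - 1\<^sub>m p) *\<^sub>v v)
    = sum_squares n p (\<lambda>i. (Rinv *\<^sub>v v) $ i) x / real n - v \<bullet> v"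
  unfolding whiten_minus_bilinear[OF sample_cov_carrier v v] whiten_bilinear[OF sample_cov_carrier v v]
    sample_cov_quadratic[OF mult_mat_vec_carrier[OF Rinv(1) v]] ..

lemmas gram_symmetric = whiten_minus[OF sample_cov_carrier sample_cov_transpose]

definition deviation :: "nat \<Rightarrow> real \<Rightarrow> real Matrix.vec \<Rightarrow> (nat \<Rightarrow> nat \<Rightarrow> real) set" where
  "deviation n y v = {x \<in> space (data_space n p).
     \<bar>v \<bullet> ((whiten (sample_cov n p x) - 1\<^sub>m p) *\<^sub>v v)\<bar> > y}"

lemma deviation_eq:
  assumes "v \<in> carrier_vec p"
  shows "deviation n y v = {x \<in> space (data_space n p).
    \<bar>sum_squares n p (\<lambda>i. (Rinv *\<^sub>v v) $ i) x / real n - v \<bullet> v\<bar> > y}"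
  unfolding deviation_def gram_quadratic[OF assms] ..

lemma sets_deviation:
  assumes "v \<in> carrier_vec p"
  shows "deviation n y v \<in> sets (data_law n p Sig)"
  unfolding deviation_eq[OF assms] sets_data_law by measurable

text \<open>The linear form with coefficients \<open>Rinv v\<close> has variance v.v, since R undoes
  \<open>Rinv\<close>; the bound is therefore the same for every spiked covariance.\<close>

lemma measure_deviation:
  assumes v: "v \<in> carrier_vec p" "v \<noteq> 0\<^sub>v p" "v \<bullet> v \<le> 1" and y: "0 < y" "y < 1" and n: "n \<ge> 1"
  shows "measure (data_law n p Sig) (deviation n y v) \<le> 2 * exp (- real n * y\<^sup>2 / 4 * (1 - 2 * y / 3))"
  unfolding deviation_eq[OF v(1)]
proof (rule chi_square_concentration[OF _ _ v(3) y n])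
  have "v \<bullet> v \<noteq> 0" using v scalar_prod_self_eq_0 by blast
  then show "0 < v \<bullet> v" using scalar_prod_self_nonneg[of v] by linarith
  let ?w = "Rinv *\<^sub>v v"
  have w: "?w \<in> carrier_vec p" by (rule mult_mat_vec_carrier[OF Rinv(1) v(1)])
  have "(\<Sum>i<p. ?w $ i * R $$ (i, j)) = v $ j" if j: "j < p" for j
  proof -
    have "(R\<^sup>T *\<^sub>v ?w) $ j = (\<Sum>i<p. R $$ (i, j) * ?w $ i)"
      using j psd_sqrt_spec(1) carrier_vecD[OF w]
      by (simp add: scalar_prod_def lessThan_atLeast0 del: carrier_vec_dim_vec) 
    also have "R\<^sup>T *\<^sub>v ?w = v" unfolding psd_sqrt_spec(2) by (rule R_Rinv_mult[OF v(1)])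
    finally show ?thesis by (simp add: mult.commute)
  qed
  then show "(\<Sum>j<p. (\<Sum>i<p. ?w $ i * R $$ (i, j))\<^sup>2) = v \<bullet> v"
    using v(1) by (simp add: scalar_prod_def lessThan_atLeast0 power2_eq_square)
qed

text \<open>The radius 8/5 becomes 2 after division by the net factor 4/5. The zero vector is left
  out because its form vanishes, while the chi-square bound asks for positive variance.\<close>

definition bad_event :: "nat \<Rightarrow> nat \<Rightarrow> real \<Rightarrow> (nat \<Rightarrow> nat \<Rightarrow> real) set" where
  "bad_event k n \<gamma>1 = (\<Union>D\<in>{D. D \<subseteq> {..<p} \<and> 1 \<le> card D \<and> card D \<le> 2 * k}.
     \<Union>v\<in>net p D - {0\<^sub>v p}. deviation n (8 / 5 * eta_root (card D) n p \<gamma>1) v)"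

lemma finite_subsets_upto: "finite {D. D \<subseteq> {..<p} \<and> 1 \<le> card D \<and> card D \<le> 2 * k}"
  by (rule finite_subset[of _ "Pow {..<p}"]) auto

lemma sets_deviation_net:
  assumes "D \<subseteq> {..<p}"
  shows "(\<Union>v\<in>net p D - {0\<^sub>v p}. deviation n y v) \<in> sets (data_law n p Sig)"
  using finite_net[OF finite_subset[OF assms], of p]
  by (intro sets.finite_UN sets_deviation supp_inD[OF net_supp_in]) auto

lemma sets_bad_event: "bad_event k n \<gamma>1 \<in> sets (data_law n p Sig)"
  unfolding bad_event_def by (intro sets.finite_UN finite_subsets_upto sets_deviation_net) auto

lemma measure_bad_event:
  assumes n: "n \<ge> 1" and k: "1 \<le> k" "k \<le> p" and \<gamma>1: "\<gamma>1 \<ge> 10"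
    and small: "\<And>m. 1 \<le> m \<Longrightarrow> m \<le> 2 * k \<Longrightarrow> m \<le> p \<Longrightarrow> eta_root m n p \<gamma>1 \<le> 1 / 30"
  shows "measure (data_law n p Sig) (bad_event k n \<gamma>1) \<le> real p powr (1 - \<gamma>1 / 2)"
proof -
  let ?M = "data_law n p Sig"
  let ?DD = "{D. D \<subseteq> {..<p} \<and> 1 \<le> card D \<and> card D \<le> 2 * k}"
  let ?t = "\<lambda>m. eta_root m n p \<gamma>1"
  let ?g = "\<lambda>m. 2 * exp (- (\<gamma>1 / 2) * (real m * log_ratio p m))"
  let ?EE = "{D. D \<subseteq> {..<p} \<and> card D \<in> {1..p}}"
  interpret prob_space ?M by (rule prob_space_data_law)
  have perD: "prob (\<Union>v\<in>net p D - {0\<^sub>v p}. deviation n (8 / 5 * ?t (card D)) v) \<le> ?g (card D)" if D: "D \<in> ?DD" for D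
  proof -
    let ?m = "card D"
    have Dp: "D \<subseteq> {..<p}" "1 \<le> ?m" "?m \<le> 2 * k" and fin: "finite D" using D finite_subset by auto
    have mp: "?m \<le> p" using card_mono[OF _ Dp(1)] by simp
    have t: "0 < ?t ?m" "?t ?m \<le> 1 / 30" using eta_root_pos[OF Dp(2) mp _ n] small[OF Dp(2,3) mp] \<gamma>1 by auto
    let ?y = "8 / 5 * ?t ?m" and ?a = "\<gamma>1 * log_ratio p ?m"
    let ?e = "exp (- (3 / 5) * (real ?m * (1 + sqrt ?a)\<^sup>2))"
    have a: "?a \<ge> 10"
    proof -
      have "10 * 1 \<le> ?a" using \<gamma>1 log_ratio_ge_1[OF Dp(2) mp] by (intro mult_mono) auto
      then show ?thesis by simp
    qed
    have nt: "real n * (?t ?m)\<^sup>2 = real ?m * (1 + sqrt ?a)\<^sup>2"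
      using eta_root_eq[OF Dp(2) mp, of \<gamma>1 n] \<gamma>1 n by (simp add: power_mult_distrib)
    \<comment> \<open>With y = 8 t / 5 the exponent is n t^2 times 16/25 (1 - 16 t / 15), and t
      \<le> 1/30 keeps this factor above 3/5.\<close>
    have e: "- real n * ?y\<^sup>2 / 4 * (1 - 2 * ?y / 3) \<le> - (3 / 5) * (real ?m * (1 + sqrt ?a)\<^sup>2)"
    proof -
      have "- real n * ?y\<^sup>2 / 4 * (1 - 2 * ?y / 3) = - (real n * (?t ?m)\<^sup>2 * (16 / 25 * (1 - 16 / 15 * ?t ?m)))"
        by (simp add: power_mult_distrib power2_eq_square[of "8/5::real"] field_simps)
      moreover have "real n * (?t ?m)\<^sup>2 * (3 / 5) \<le> real n * (?t ?m)\<^sup>2 * (16 / 25 * (1 - 16 / 15 * ?t ?m))"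
        using t(2) by (intro mult_left_mono) auto
      ultimately show ?thesis unfolding nt[symmetric] by linarith
    qed
    have "prob (\<Union>v\<in>net p D - {0\<^sub>v p}. deviation n ?y v) \<le> (\<Sum>v\<in>net p D - {0\<^sub>v p}. prob (deviation n ?y v))"
      using finite_net[OF fin] by (intro measure_UNION_le sets_deviation supp_inD[OF net_supp_in]) auto
    also have "\<dots> \<le> (\<Sum>v\<in>net p D - {0\<^sub>v p}. 2 * ?e)"
    proof (rule sum_mono)
      fix v assume v: "v \<in> net p D - {0\<^sub>v p}"
      have "prob (deviation n ?y v) \<le> 2 * exp (- real n * ?y\<^sup>2 / 4 * (1 - 2 * ?y / 3))"
        using v t net_norm_le_1[OF _ Dp(1), of v] supp_inD[OF net_supp_in, of v] n
        by (intro measure_deviation) auto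
      also have "\<dots> \<le> 2 * ?e" using e by simp
      finally show "prob (deviation n ?y v) \<le> 2 * ?e" .
    qed
    also have "\<dots> = real (card (net p D - {0\<^sub>v p})) * (2 * ?e)" by simp
    also have "\<dots> \<le> 57 ^ ?m * (2 * ?e)"
    proof (rule mult_right_mono)
      have "card (net p D - {0\<^sub>v p}) \<le> card (net p D)" by (intro card_mono finite_net[OF fin]) auto
      then show "real (card (net p D - {0\<^sub>v p})) \<le> 57 ^ ?m" using card_net[OF fin, of p] by linarith
    qed simp
    also have "\<dots> = 2 * (57 ^ ?m * ?e)" by simp
    also have "\<dots> \<le> 2 * exp (- (real ?m * ?a / 2))" using net_tail_bound[OF a, of ?m] by (rule mult_left_mono) simp
    also have "\<dots> = ?g ?m" by (simp add: mult_ac)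
    finally show ?thesis .
  qed
  have "prob (bad_event k n \<gamma>1) \<le> (\<Sum>D\<in>?DD. prob (\<Union>v\<in>net p D - {0\<^sub>v p}. deviation n (8 / 5 * ?t (card D)) v))"
    unfolding bad_event_def by (intro measure_UNION_le finite_subsets_upto sets_deviation_net) auto
  also have "\<dots> \<le> (\<Sum>D\<in>?DD. ?g (card D))" by (intro sum_mono perD)
  also have "\<dots> \<le> (\<Sum>D\<in>?EE. ?g (card D))"
  proof (rule sum_mono2)
    show "finite ?EE" by (rule finite_subset[of _ "Pow {..<p}"]) auto
    show "?DD \<subseteq> ?EE" using card_mono[of "{..<p}"] by fastforce
  qed simp
  \<comment> \<open>Grouping the column sets by size turns the union bound into a sum over m with
    binomial weights.\<close>
  also have "\<dots> = (\<Sum>m\<in>{1..p}. \<Sum>D\<in>{D \<in> ?EE. card D = m}. ?g (card D))"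
    by (rule sum.group[symmetric]) (auto intro: finite_subset[of _ "Pow {..<p}"])
  also have "\<dots> = (\<Sum>m\<in>{1..p}. real (p choose m) * ?g m)"
  proof (rule sum.cong[OF refl])
    fix m assume m: "m \<in> {1..p}"
    then have "{D \<in> ?EE. card D = m} = {D. D \<subseteq> {..<p} \<and> card D = m}" by auto
    then show "(\<Sum>D\<in>{D \<in> ?EE. card D = m}. ?g (card D)) = real (p choose m) * ?g m"
      using n_subsets[of "{..<p}" m] by simp
  qed
  also have "\<dots> \<le> (\<Sum>m\<in>{1..p}. 2 * (real p powr (1 - \<gamma>1 / 2) * (1 / 4) ^ m))"
  proof (rule sum_mono)
    fix m assume "m \<in> {1..p}"
    then have m: "1 \<le> m" "m \<le> p" by auto
    \<comment> \<open>Counting the sets lowers the exponent from \<gamma>1 / 2 to \<gamma>1 / 2 - 1.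
      This is at least 4 by \<gamma>1 \<ge> 10, as the tail lemma requires.\<close>
    have "real (p choose m) * ?g m \<le> exp (real m * log_ratio p m) * ?g m"
      by (intro mult_right_mono binomial_le_exp_log_ratio m) simp
    also have "\<dots> = 2 * exp (- (\<gamma>1 / 2 - 1) * (real m * log_ratio p m))"
      by (simp flip: exp_add add: algebra_simps)
    also have "\<dots> \<le> 2 * (real p powr (- (\<gamma>1 / 2 - 1)) * (1 / 4) ^ m)"
      using exp_log_ratio_tail[OF m, of "\<gamma>1 / 2 - 1"] \<gamma>1 by simp
    finally show "real (p choose m) * ?g m \<le> 2 * (real p powr (1 - \<gamma>1 / 2) * (1 / 4) ^ m)" by simp
  qed
  also have "\<dots> = real p powr (1 - \<gamma>1 / 2) * (2 * (\<Sum>m\<in>{1..p}. (1 / 4) ^ m))"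
    by (simp add: sum_distrib_left mult_ac)
  \<comment> \<open>The geometric series with ratio 1/4 is below 1/3, which absorbs the factor 2 of
    the two-sided tail.\<close>
  also have "\<dots> \<le> real p powr (1 - \<gamma>1 / 2) * 1"
  proof (rule mult_left_mono)
    have "3 * (\<Sum>m\<in>{1..p}. (1 / 4 :: real) ^ m) = 1 - (1 / 4) ^ p"
    proof (induction p)
      case (Suc p)
      have "(\<Sum>m\<in>{1..Suc p}. (1 / 4 :: real) ^ m) = (\<Sum>m\<in>{1..p}. (1 / 4) ^ m) + 1 / 4 * (1 / 4) ^ p" by simp
      then show ?case using Suc.IH unfolding power_Suc by linarith
    qed simp
    moreover have "0 \<le> (1 / 4 :: real) ^ p" by simp
    ultimately show "2 * (\<Sum>m\<in>{1..p}. (1 / 4 :: real) ^ m) \<le> 1" by linarith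
  qed simp
  finally show ?thesis by simp
qed

lemma gram_bound_off_bad_event:
  assumes n: "n \<ge> 1" and \<gamma>1: "\<gamma>1 \<ge> 0"
    and x: "x \<in> space (data_space n p)" "x \<notin> bad_event k n \<gamma>1"
    and D: "D \<subseteq> {..<p}" "card D \<le> 2 * k" and v: "v \<in> supp_in p D"
  shows "\<bar>v \<bullet> ((whiten (sample_cov n p x) - 1\<^sub>m p) *\<^sub>v v)\<bar> \<le> 2 * eta_root (card D) n p \<gamma>1 * (v \<bullet> v)"
proof (cases "D = {}")
  case True
  then have "v = 0\<^sub>v p" using v by (intro eq_vecI) (auto simp: supp_in_def)
  then show ?thesis using gram_quadratic[of "0\<^sub>v p" n x] mult_mat_vec_carrier[OF gram_symmetric(1), of "0\<^sub>v p" n x] by simp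
next
  case False
  have fin: "finite D" using D finite_subset by blast
  have m: "1 \<le> card D" using False fin by (simp add: Suc_le_eq card_gt_0_iff)
  have t: "0 < eta_root (card D) n p \<gamma>1" using card_mono[OF _ D(1)] by (intro eta_root_pos m \<gamma>1 n) simp
  have "\<bar>v \<bullet> ((whiten (sample_cov n p x) - 1\<^sub>m p) *\<^sub>v v)\<bar> \<le> 8 / 5 * eta_root (card D) n p \<gamma>1 / (4 / 5) * (v \<bullet> v)"
  proof (rule quadratic_bound_from_net[OF gram_symmetric D(1) False _ v])
    fix w assume w: "w \<in> net p D"
    show "\<bar>w \<bullet> ((whiten (sample_cov n p x) - 1\<^sub>m p) *\<^sub>v w)\<bar> \<le> 8 / 5 * eta_root (card D) n p \<gamma>1"
    proof (cases "w = 0\<^sub>v p")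
      case True
      then show ?thesis using t mult_mat_vec_carrier[OF gram_symmetric(1), of "0\<^sub>v p" n x] by simp
    next
      case False
      then have "x \<notin> deviation n (8 / 5 * eta_root (card D) n p \<gamma>1) w"
        using x(2) w D m unfolding bad_event_def by blast
      then show ?thesis using x(1) by (auto simp: deviation_def)
    qed
  qed
  then show ?thesis by simp
qed

end

section \<open>Constants and assembly\<close>

lemma eta_root_small:
  assumes \<gamma>1: "\<gamma>1 \<ge> 10" and \<tau>: "\<tau> \<ge> 1" and n: "n \<ge> 1" and k: "1 \<le> k" "k \<le> p"
    and small: "\<tau> * real k / real n * ln (exp 1 * real p / real k) \<le> 1 / (10000 * \<gamma>1)"
    and m: "1 \<le> m" "m \<le> 2 * k" "m \<le> p"
  shows "eta_root m n p \<gamma>1 \<le> 1 / 30"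
proof -
  have q0: "0 \<le> real k * log_ratio p k / real n" using log_ratio_ge_1[OF k] by simp
  then have "1 * (real k * log_ratio p k / real n) \<le> \<tau> * (real k * log_ratio p k / real n)"
    using \<tau> by (intro mult_right_mono)
  also have "\<dots> \<le> 1 / (10000 * \<gamma>1)" using small by (simp add: log_ratio_def)
  finally have kq: "real k * log_ratio p k / real n \<le> 1 / (10000 * \<gamma>1)" by simp
  have "real m * log_ratio p m / real n \<le> 2 * (real k * log_ratio p k / real n)"
    using divide_right_mono[OF mult_log_ratio_double[OF m(1,2) k m(3)], of "real n"] by simp
  also have "\<dots> \<le> 2 * (1 / (10000 * \<gamma>1))" using kq by linarith
  finally have mq: "real m * log_ratio p m / real n \<le> 2 * (1 / (10000 * \<gamma>1))" .
  have "eta_root m n p \<gamma>1 \<le> 2 * sqrt \<gamma>1 * sqrt (real m * log_ratio p m / real n)"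
    using \<gamma>1 by (intro eta_root_le m n) simp
  also have "\<dots> \<le> 2 * sqrt \<gamma>1 * sqrt (2 * (1 / (10000 * \<gamma>1)))"
    using \<gamma>1 by (intro mult_left_mono real_sqrt_le_mono mq) simp
  also have "\<dots> = sqrt (4 * \<gamma>1 * (2 * (1 / (10000 * \<gamma>1))))"
    by (simp only: real_sqrt_mult[of "4 * \<gamma>1"] real_sqrt_mult[of 4] real_sqrt_four)
  \<comment> \<open>\<gamma>1 cancels, the reason for its place in c0; 10000 makes the root smaller
    than 1/30, as the exponent estimate for the bad event demands.\<close>
  also have "\<dots> = sqrt (8 / 10000)" using \<gamma>1 by simp
  also have "\<dots> \<le> 1 / 30" by (rule real_le_lsqrt) (auto simp: power2_eq_square)
  finally show ?thesis .
qed

lemma rank_error_probability: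
  fixes \<gamma>1 \<gamma>2 \<tau> lam :: real
  assumes \<gamma>1: "\<gamma>1 \<ge> 10" and \<gamma>2: "\<gamma>2 \<ge> 8" and \<tau>: "\<tau> \<ge> 1" and n: "n \<ge> 1" and k: "1 \<le> k" "k \<le> p"
    and lam: "lam > 0"
    and small: "\<tau> * real k / real n * ln (exp 1 * real p / real k) \<le> 1 / (10000 * \<gamma>1)"
    and strong: "lam \<ge> 6 * sqrt \<gamma>1 * (64 * \<tau>\<^sup>2 * \<gamma>2\<^sup>2) * sqrt (real k / real n * ln (exp 1 * real p / real k))"
    and A: "support_selector k n p \<gamma>1 A" and M: "M \<in> Theta2 k p lam \<tau>"
  shows "measure (data_law n p M) {x \<in> space (data_law n p M).
      rank_estimate k n p \<gamma>1 \<gamma>2 (sample_cov n p x) (A x) \<noteq> vec_space.rank p (M - 1\<^sub>m p)}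
    \<le> real p powr (1 - \<gamma>1 / 2)"
proof -
  obtain r V ls where r: "r \<le> k" and V0: "V \<in> orthonormal_mats p r" "card (row_supp V) \<le> k"
    and ls: "\<And>i. i < r \<Longrightarrow> lam / \<tau> \<le> ls i \<and> ls i \<le> lam"
    and M_eq: "M = V * mat_diag r ls * V\<^sup>T + 1\<^sub>m p"
  proof -
    obtain r where "r \<le> k" "M \<in> Theta0 k p r lam \<tau>" using M unfolding Theta2_def by auto
    then show ?thesis using that unfolding Theta0_def by blast
  qed
  interpret spiked_covariance p r V ls
  proof
    show "V \<in> orthonormal_mats p r" by (rule V0(1))
    fix i assume "i < r"
    then have "lam / \<tau> \<le> ls i" using ls by blast
    moreover have "lam / \<tau> > 0" using lam \<tau> by simp
    ultimately show "ls i > 0" by linarith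
  qed
  have MS: "M = Sig" unfolding M_eq spike_def core_def ..
  have "row_supp V \<subseteq> {..<p}" using carrier_matD[OF V(1)] by (auto simp: row_supp_def)
  \<comment> \<open>The support may have fewer than k elements, while members of \<open>BB\<close>
    have exactly k.\<close>
  then obtain J where J: "row_supp V \<subseteq> J" "J \<subseteq> {..<p}" "card J = k"
    using exists_subset_between[of "row_supp V" k "{..<p}"] V0(2) k by auto
  interpret D: prob_space "data_law n p M" by (rule prob_space_data_law)
  have g1: "\<gamma>1 \<ge> 0" "\<gamma>1 \<ge> 1" using \<gamma>1 by auto
  let ?t = "eta_root k n p \<gamma>1" and ?\<eta> = "eta k n p \<gamma>1"
  have t_small: "eta_root m n p \<gamma>1 \<le> 1 / 30" if "1 \<le> m" "m \<le> 2 * k" "m \<le> p" for m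
    by (rule eta_root_small[OF \<gamma>1 \<tau> n k small that])
  have t: "0 < ?t" "?t \<le> 1 / 30" using eta_root_pos[OF k g1(1) n] t_small[of k] k by auto
  have \<eta>t: "?\<eta> = 2 * ?t + ?t * ?t" using k by (simp add: eta_def power2_eq_square)
  have tt: "0 < ?t * ?t" "?t * ?t \<le> 1 * ?t" using t by (auto intro: mult_right_mono)
  have \<eta>: "0 < ?\<eta>" "?\<eta> \<le> 1 / 10" "?\<eta> \<le> 3 * ?t" using t tt unfolding \<eta>t by linarith+
  \<comment> \<open>\<open>eta\<close> is at most 3 \<open>eta_root\<close> since
    \<open>eta_root\<close> \<le> 1. This gives the part 6 sqrt \<gamma>1 of \<beta>.\<close>
  have "?\<eta> \<le> 3 * (2 * sqrt \<gamma>1 * sqrt (real k * log_ratio p k / real n))"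
    using \<eta>(3) eta_root_le[OF k g1(2) n] by linarith
  also have "\<dots> = 6 * sqrt \<gamma>1 * sqrt (real k / real n * ln (exp 1 * real p / real k))"
    by (simp add: log_ratio_def)
  also have "\<dots> \<le> lam / (64 * \<tau>\<^sup>2 * \<gamma>2\<^sup>2)"
  proof -
    have "0 < 64 * \<tau>\<^sup>2 * \<gamma>2\<^sup>2" using \<tau> \<gamma>2 by simp
    then show ?thesis using strong by (simp only: pos_le_divide_eq mult_ac)
  qed
  finally have signal: "?\<eta> \<le> lam / (64 * \<tau>\<^sup>2 * \<gamma>2\<^sup>2)" .
  have correct: "rank_estimate k n p \<gamma>1 \<gamma>2 (sample_cov n p x) (A x) = r"
    if x: "x \<in> space (data_space n p)" "x \<notin> bad_event k n \<gamma>1" for x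
  proof -
    note gram = gram_bound_off_bad_event[OF n g1(1) x]
    have ev: "spiked_event p r V ls k n \<gamma>1 ?\<eta> (sample_cov n p x) J"
    proof unfold_locales
      fix m assume "m \<le> k"
      then show "0 \<le> eta m n p \<gamma>1 \<and> eta m n p \<gamma>1 \<le> ?\<eta>"
        using eta_nonneg_mono[OF _ k g1(1) n] by blast
    next
      fix D v assume D: "D \<subseteq> {..<p}" "card D \<le> k" and v: "v \<in> supp_in p D"
      \<comment> \<open>For empty D both sides are 0; otherwise the square in \<open>eta\<close> is
        the slack.\<close>
      have "2 * eta_root (card D) n p \<gamma>1 \<le> eta (card D) n p \<gamma>1" by (simp add: eta_def eta_root_def)
      then have "2 * eta_root (card D) n p \<gamma>1 * (v \<bullet> v) \<le> eta (card D) n p \<gamma>1 * (v \<bullet> v)"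
        by (intro mult_right_mono scalar_prod_self_nonneg)
      then show "\<bar>v \<bullet> ((whiten (sample_cov n p x) - 1\<^sub>m p) *\<^sub>v v)\<bar> \<le> eta (card D) n p \<gamma>1 * (v \<bullet> v)"
        using gram[OF D(1) _ v] D(2) by linarith
    next
      fix D v assume D: "D \<subseteq> {..<p}" "card D \<le> 2 * k" and v: "v \<in> supp_in p D"
      have "2 * eta_root (card D) n p \<gamma>1 \<le> 3 / 2 * ?\<eta>"
      proof (cases "card D = 0")
        case True
        then show ?thesis using \<eta> by (simp add: eta_root_def)
      next
        case False
        then show ?thesis using D card_mono[OF _ D(1)] by (intro eta_root_double k g1 n) auto
      qed
      then have "2 * eta_root (card D) n p \<gamma>1 * (v \<bullet> v) \<le> 3 / 2 * ?\<eta> * (v \<bullet> v)"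
        by (intro mult_right_mono scalar_prod_self_nonneg)
      then show "\<bar>v \<bullet> ((whiten (sample_cov n p x) - 1\<^sub>m p) *\<^sub>v v)\<bar> \<le> 3 / 2 * ?\<eta> * (v \<bullet> v)"
        using gram[OF D(1,2) v] by linarith
    qed (use J k \<eta> sample_cov_transpose in auto)
    have "J \<in> BB k n p \<gamma>1 (sample_cov n p x)" by (rule spiked_event.true_support_in_BB[OF ev])
    then have "A x \<in> BB k n p \<gamma>1 (sample_cov n p x)" using A x unfolding support_selector_def by blast
    then have "spiked_signal p r V ls k n \<gamma>1 ?\<eta> (sample_cov n p x) J \<tau> \<gamma>2 lam (A x)"
      using ev \<tau> \<gamma>2 lam ls signal r by (simp add: spiked_signal_def spiked_signal_axioms_def)
    then show ?thesis by (rule spiked_signal.rank_estimate_correct)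
  qed
  \<comment> \<open>Off the bad event the argument is deterministic, so the error event is contained
    in the bad one, a finite union of measurable deviation events.\<close>
  have "{x \<in> space (data_law n p M). rank_estimate k n p \<gamma>1 \<gamma>2 (sample_cov n p x) (A x)
      \<noteq> vec_space.rank p (M - 1\<^sub>m p)} \<subseteq> bad_event k n \<gamma>1"
    using correct unfolding space_data_law MS rank_core by blast
  moreover have "bad_event k n \<gamma>1 \<in> sets (data_law n p M)" unfolding MS by (rule sets_bad_event)
  ultimately have "measure (data_law n p M) {x \<in> space (data_law n p M).
      rank_estimate k n p \<gamma>1 \<gamma>2 (sample_cov n p x) (A x) \<noteq> vec_space.rank p (M - 1\<^sub>m p)}
    \<le> measure (data_law n p M) (bad_event k n \<gamma>1)" by (rule D.finite_measure_mono)
  also have "\<dots> \<le> real p powr (1 - \<gamma>1 / 2)"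
    unfolding MS by (rule measure_bad_event[OF n k \<gamma>1 t_small])
  finally show ?thesis .
qed

text \<open>A supremum of reals is bounded termwise only over a nonempty index set; r = 0 always
  contributes the identity matrix.\<close>

lemma Theta2_nonempty: "Theta2 k p lam \<tau> \<noteq> {}"
proof -
  have "0\<^sub>m p 0 \<in> orthonormal_mats p 0" by (auto simp: orthonormal_mats_def intro!: eq_matI)
  moreover have "row_supp (0\<^sub>m p 0) = {}" by (auto simp: row_supp_def)
  ultimately have "0\<^sub>m p 0 * mat_diag 0 (\<lambda>_. 0) * (0\<^sub>m p 0)\<^sup>T + 1\<^sub>m p \<in> Theta0 k p 0 lam \<tau>"
    unfolding Theta0_def by fastforce
  then show ?thesis unfolding Theta2_def by fastforce
qed


theorem theorem2:
  shows "\<exists>C::real. C > 0 \<and> (\<forall>\<gamma>1::real. \<gamma>1 \<ge> 10 \<longrightarrow>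
    (\<exists>c0::real. 0 < c0 \<and> c0 < 1 \<and>
      (\<forall>(\<gamma>2::real) (\<tau>::real). \<gamma>2 \<ge> 8 * sqrt \<gamma>1 + 34 \<and> \<tau> \<ge> 1 \<longrightarrow>
        (\<exists>\<beta>::real. \<beta> > 0 \<and>
          (\<forall>(n::nat) (k::nat) (p::nat) (lam::real) A.
             n \<ge> 1 \<and> 1 \<le> k \<and> k \<le> p \<and> lam > 0 \<and>
             \<tau> * real k / real n * ln (exp 1 * real p / real k) \<le> c0 \<and>
             lam \<ge> \<beta> * sqrt (real k / real n * ln (exp 1 * real p / real k)) \<and>
             support_selector k n p \<gamma>1 A \<longrightarrow>
             (SUP Sig\<in>Theta2 k p lam \<tau>.
                measure (data_law n p Sig)
                  {x \<in> space (data_law n p Sig).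
                     rank_estimate k n p \<gamma>1 \<gamma>2 (sample_cov n p x) (A x)
                       \<noteq> vec_space.rank p (Sig - 1\<^sub>m p)})
             \<le> C * real p powr (1 - \<gamma>1 / 2))))))"
\<comment> \<open>C = 1 suffices because the geometric series absorbed all factors of the union
  bound.\<close>
proof (rule exI[of _ 1], intro conjI allI impI, goal_cases)
  case (2 \<gamma>1)
  show ?case
  \<comment> \<open>This c0 brings \<open>eta_root\<close> below 1/30 for all sizes up to 2
    k.\<close>
  proof (rule exI[of _ "1 / (10000 * \<gamma>1)"], intro conjI allI impI, goal_cases)
    case (3 \<gamma>2 \<tau>)
    have "0 \<le> 8 * sqrt \<gamma>1" using 2 by simp
    then have \<gamma>2: "\<gamma>2 \<ge> 8" and \<tau>: "\<tau> \<ge> 1" using 3 by linarith+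
    show ?case
    \<comment> \<open>6 sqrt \<gamma>1 bounds \<open>eta\<close> by the square root in the
      assumption on lam; the other factor is the signal-to-noise ratio that the threshold comparison
      asks for.\<close>
    proof (rule exI[of _ "6 * sqrt \<gamma>1 * (64 * \<tau>\<^sup>2 * \<gamma>2\<^sup>2)"], intro conjI allI impI, goal_cases)
      case 1
      show ?case using 2 \<gamma>2 \<tau> by simp
    next
      case (2 n k p lam A)
      then show ?case unfolding mult_1
        by (intro cSUP_least Theta2_nonempty rank_error_probability[OF \<open>\<gamma>1 \<ge> 10\<close> \<gamma>2 \<tau>]) blast+
    qed
  qed (use 2 in auto)
qed simp

end
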